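(* Let $K\ge 2$ and consider the $K$-user $(K-1)\times 1$ MISO broadcast channel with periodic CSI feedback under the feedback-link-delay-limited model (Model 2) with coherence time $T_{\mathrm c}$, feedback delay $T_{\mathrm{fb}}$ and normalized feedback delay $\gamma=\frac{T_{\mathrm{fb}}}{T_{\mathrm c}}$. Then the following sum-DoF is achievable: $$ d(\gamma)=\begin{cases} K-1, & 0\le\gamma\le\frac1K,\\[2pt] \left(-K+\frac{K\,c(K)}{K-1}\right)\gamma+K-\frac{c(K)}{K-1}, & \frac1K<\gamma\le 1,\\[2pt] c(K), & \gamma\ge 1, \end{cases} \qquad\text{where}\quad c(K)=\frac{K-1}{1+\frac12+\cdots+\frac1{K-1}}. $$
   Context: **Channel.** A transmitter with $N_{\mathrm t}=K-1$ antennas sends independent messages $m^{(1)},\dots,m^{(K)}$ to $K$ single-antenna users. At channel use (time slot) $n=1,2,\dots$ user $k$ receives $$y^{(k)}[n]=\mathbf h^{(k)}[n]^{T}\mathbf x[n]+z^{(k)}[n],$$ where $\mathbf x[n]\in\mathbb C^{N_{\mathrm t}}$ is the transmitted signal, subject to the average power constraint $\mathbb E[\mathrm{Tr}(\mathbf x[n]\mathbf x[n]^* )]\le P$; $\mathbf h^{(k)}[n]\in\mathbb C^{N_{\mathrm t}}$ is the channel vector of user $k$; and the noises $z^{(k)}[n]\sim\mathcal{CN}(0,1)$ are independent over users and time and independent of channels and messages. SNR means $P$. **Fading (Model 2).** Ideal block fading: time is divided into consecutive blocks of $T_{\mathrm c}$ slots ($T_{\mathrm c}$ a positive integer, the channel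 coherence time), with the same block boundaries for all users. The channel vectors are constant within a block and change independently between blocks. The entries are i.i.d. over antennas, users and blocks, drawn from a continuous distribution (one having a density on $\mathbb C$), with absolute values bounded between a strictly positive minimum and a finite maximum. **CSI at the receivers.** Receivers have perfect channel state information (CSI), including the channel knowledge (other users' channels, and hence effective precoded channels) needed for decoding. **CSI at the transmitter (Model 2, feedback-link-delay-limited).** Each user feeds back its channel vector once per block, in the first slot of the block. The feedback is noiseless but arrives with a delay of $T_{\mathrm{fb}}$ slots ($T_{\mathrm{fb}}$ a nonnegative integer): CSI sent at slot $n$ is known to the transmitter from slot $n+T_{\mathrm{fb}}$ on. Thus for $\gamma<1$ the transmitter knows, in the first $T_{\mathrm{fb}}$ slots of a block, only the channels of all previous blocks, and in the remaining $T_{\mathrm c}-T_{\mathrm{fb}}$ slots the channels of the current and all previous blocks; for $\gamma\ge1$ only completely outdated CSI is available. The transmitted signal $\mathbf x[n]$ may depend only on the messages and the CSI available to the transmitter at slot $n$ (and on the known channel statistics). **Achievable sum-DoF.** For a code spanning $n$ channel uses, user $k$'s rate is $R^{(k)}(\gamma,\mathrm{SNR})=\frac{\log|m^{(k)}(\gamma,\mathrm{SNR})|}{n}$, where $|m^{(k)}|$ is the number of messages for user $k$; a rate tuple is achievable if the error probability of every message can be made to tend to $0$ as $n\to\infty$. A sum-DoF $d$ is achievable if it can be approached arbitrarily closely by values $$\lim_{\mathrm{SNR}\to\infty}\frac{\sum_{k=1}^K R^{(k)}(\gamma,\mathrm{SNR})}{\log \mathrm{SNR}}$$ with achievable rate tuples,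 one for each SNR. *)

theory Defs
  imports "HOL-Probability.Probability"
begin

text \<open>
  Time slots are numbered from 1, blocks, users and antennas from 0: slot \<open>t\<close> lies in block
  \<open>(t - 1) div Tc\<close>, the users are \<open>{..<K}\<close> and the transmit antennas \<open>{..<K - 1}\<close>.
  A realisation of the block fading process is a function \<open>h\<close>, where \<open>h (b, k, i)\<close> is the
  coefficient from antenna \<open>i\<close> to user \<open>k\<close> throughout block \<open>b\<close>.
\<close>

type_synonym fading = "nat \<times> nat \<times> nat \<Rightarrow> complex"

definition block_of :: "nat \<Rightarrow> nat \<Rightarrow> nat" where
  "block_of Tc t = (t - 1) div Tc"

definition csi_index :: "nat \<Rightarrow> nat set \<Rightarrow> (nat \<times> nat \<times> nat) set" where
  "csi_index K B = B \<times> {..<K} \<times> {..<K - 1}"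

text \<open>
  The first slot of block \<open>b\<close> is \<open>b * Tc + 1\<close>. All users feed back their channel vectors in that
  slot, and the transmitter knows them from slot \<open>b * Tc + 1 + Tfb\<close> on.
\<close>

definition known_blocks :: "nat \<Rightarrow> nat \<Rightarrow> nat \<Rightarrow> nat set" where
  "known_blocks Tc Tfb t = {b. b * Tc + 1 + Tfb \<le> t}"

text \<open>
  The blocks touched by slots \<open>1, \<dots>, n\<close>; their channels are known at every receiver.
\<close>

definition spanned_blocks :: "nat \<Rightarrow> nat \<Rightarrow> nat set" where
  "spanned_blocks Tc n = block_of Tc ` {1..n}"

text \<open>
  The distribution \<open>CN(0,1)\<close>: real and imaginary part are independent and normal with variance
  1/2 each. (The second argument of \<open>normal_density\<close> is the standard deviation.)
\<close>

definition std_complex_normal :: "complex measure" where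
  "std_complex_normal =
     (let N = density lborel (\<lambda>x. ennreal (normal_density 0 (sqrt (1 / 2)) x))
      in distr (N \<Otimes>\<^sub>M N) borel (\<lambda>(a, b). Complex a b))"

text \<open>
  Independent, uniformly distributed messages; user \<open>k\<close> has \<open>M k\<close> possible messages.
\<close>

definition message_space :: "nat \<Rightarrow> (nat \<Rightarrow> nat) \<Rightarrow> (nat \<Rightarrow> nat) measure" where
  "message_space K M = PiM {..<K} (\<lambda>k. uniform_count_measure {..<M k})"

definition fading_space :: "nat \<Rightarrow> complex measure \<Rightarrow> fading measure" where
  "fading_space K D = PiM (csi_index K UNIV) (\<lambda>_. D)"

definition noise_space :: "nat \<Rightarrow> (nat \<times> nat \<Rightarrow> complex) measure" where
  "noise_space K = PiM ({1..} \<times> {..<K}) (\<lambda>_. std_complex_normal)"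

text \<open>
  \<open>encode C t m H i\<close> is the signal sent in slot \<open>t\<close> on antenna \<open>i\<close> for the message tuple \<open>m\<close> when
  the transmitter's CSI is \<open>H\<close>; \<open>decode C k y H\<close> is user \<open>k\<close>'s estimate of its message from its
  received sequence \<open>y\<close> and the receiver CSI \<open>H\<close>.
\<close>

record bc_code =
  num_msgs :: "nat \<Rightarrow> nat"
  encode :: "nat \<Rightarrow> (nat \<Rightarrow> nat) \<Rightarrow> fading \<Rightarrow> nat \<Rightarrow> complex"
  decode :: "nat \<Rightarrow> (nat \<Rightarrow> complex) \<Rightarrow> fading \<Rightarrow> nat"

text \<open>
  Restricting \<open>h\<close> to the known blocks is what makes the transmitted signal a function of the
  messages and the available CSI only.
\<close>

definition transmitted ::
  "nat \<Rightarrow> nat \<Rightarrow> nat \<Rightarrow> bc_code \<Rightarrow> nat \<Rightarrow> (nat \<Rightarrow> nat) \<Rightarrow> fading \<Rightarrow> nat \<Rightarrow> complex" where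
  "transmitted K Tc Tfb C t m h =
     encode C t m (restrict h (csi_index K (known_blocks Tc Tfb t)))"

definition received ::
  "nat \<Rightarrow> nat \<Rightarrow> nat \<Rightarrow> bc_code \<Rightarrow> nat \<Rightarrow> nat \<Rightarrow> (nat \<Rightarrow> nat) \<Rightarrow> fading \<Rightarrow> (nat \<times> nat \<Rightarrow> complex) \<Rightarrow> complex" where
  "received K Tc Tfb C k t m h z =
     (\<Sum>i<K - 1. h (block_of Tc t, k, i) * transmitted K Tc Tfb C t m h i) + z (t, k)"

definition decoded ::
  "nat \<Rightarrow> nat \<Rightarrow> nat \<Rightarrow> nat \<Rightarrow> bc_code \<Rightarrow> nat \<Rightarrow> (nat \<Rightarrow> nat) \<Rightarrow> fading \<Rightarrow> (nat \<times> nat \<Rightarrow> complex) \<Rightarrow> nat" where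
  "decoded K Tc Tfb n C k m h z =
     decode C k (\<lambda>t\<in>{1..n}. received K Tc Tfb C k t m h z)
       (restrict h (csi_index K (spanned_blocks Tc n)))"

definition error_prob ::
  "nat \<Rightarrow> nat \<Rightarrow> nat \<Rightarrow> complex measure \<Rightarrow> nat \<Rightarrow> bc_code \<Rightarrow> nat \<Rightarrow> real" where
  "error_prob K Tc Tfb D n C k =
     (let S = message_space K (num_msgs C) \<Otimes>\<^sub>M (fading_space K D \<Otimes>\<^sub>M noise_space K)
      in measure S {(m, h, z) \<in> space S. decoded K Tc Tfb n C k m h z \<noteq> m k})"

text \<open>
  Measurability and, in every slot, the power constraint
  \<open>E[Tr(x x*)] \<le> P\<close>, where \<open>Tr(x x*)\<close> is the squared Euclidean norm of \<open>x\<close>. The constraint uses the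
  nonnegative integral, so that a signal of infinite power violates it.
\<close>

definition valid_code ::
  "nat \<Rightarrow> nat \<Rightarrow> nat \<Rightarrow> complex measure \<Rightarrow> real \<Rightarrow> nat \<Rightarrow> bc_code \<Rightarrow> bool" where
  "valid_code K Tc Tfb D P n C \<longleftrightarrow>
     (\<forall>k<K. 1 \<le> num_msgs C k) \<and>
     (\<forall>t\<in>{1..n}. \<forall>m\<in>(\<Pi>\<^sub>E k\<in>{..<K}. {..<num_msgs C k}). \<forall>i<K - 1.
        (\<lambda>H. encode C t m H i) \<in>
          borel_measurable (PiM (csi_index K (known_blocks Tc Tfb t)) (\<lambda>_. borel))) \<and>
     (\<forall>k<K. (\<lambda>(y, H). decode C k y H) \<in>
        measurable (PiM {1..n} (\<lambda>_. borel) \<Otimes>\<^sub>M PiM (csi_index K (spanned_blocks Tc n)) (\<lambda>_. borel))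
          (count_space UNIV)) \<and>
     (\<forall>t\<in>{1..n}.
        (\<integral>\<^sup>+ (m, h). ennreal (\<Sum>i<K - 1. (cmod (transmitted K Tc Tfb C t m h i))\<^sup>2)
           \<partial>(message_space K (num_msgs C) \<Otimes>\<^sub>M fading_space K D)) \<le> ennreal P)"

definition achievable_rates ::
  "nat \<Rightarrow> nat \<Rightarrow> nat \<Rightarrow> complex measure \<Rightarrow> real \<Rightarrow> (nat \<Rightarrow> real) \<Rightarrow> bool" where
  "achievable_rates K Tc Tfb D P R \<longleftrightarrow>
     (\<exists>C :: nat \<Rightarrow> bc_code.
        (\<forall>n\<ge>1. valid_code K Tc Tfb D P n (C n)) \<and>
        (\<forall>k<K. (\<lambda>n. ln (real (num_msgs (C n) k)) / real n) \<longlonglongrightarrow> R k) \<and>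
        (\<forall>k<K. (\<lambda>n. error_prob K Tc Tfb D n (C n) k) \<longlonglongrightarrow> 0))"

text \<open>
  The noise has unit power, so the SNR is the power \<open>P\<close>. The base of the logarithms cancels in the
  ratio of rate and \<open>log SNR\<close>.
\<close>

definition achievable_sum_dof ::
  "nat \<Rightarrow> nat \<Rightarrow> nat \<Rightarrow> complex measure \<Rightarrow> real \<Rightarrow> bool" where
  "achievable_sum_dof K Tc Tfb D d \<longleftrightarrow>
     (\<forall>\<epsilon>>0. \<exists>R :: real \<Rightarrow> nat \<Rightarrow> real. \<exists>d'.
        (\<forall>P>0. achievable_rates K Tc Tfb D P (R P)) \<and>
        ((\<lambda>P. (\<Sum>k<K. R P k) / ln P) \<longlongrightarrow> d') at_top \<and> \<bar>d' - d\<bar> < \<epsilon>)"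

definition dof_outdated :: "nat \<Rightarrow> real" where
  "dof_outdated K = (real K - 1) / harm (K - 1)"

definition dof :: "nat \<Rightarrow> real \<Rightarrow> real" where
  "dof K \<gamma> =
     (if \<gamma> \<le> 1 / real K then real K - 1
      else if \<gamma> \<le> 1 then
        (- real K + real K * dof_outdated K / (real K - 1)) * \<gamma>
          + real K - dof_outdated K / (real K - 1)
      else dof_outdated K)"

lemma prob_space_std_complex_normal: "prob_space std_complex_normal"
proof -
  let ?N = "density lborel (\<lambda>x. ennreal (normal_density 0 (sqrt (1 / 2)) x))"
  interpret N: prob_space ?N
    by (rule prob_space_normal_density) simp
  interpret NN: pair_prob_space ?N ?N ..
  have "(\<lambda>(a, b). Complex a b) \<in> ?N \<Otimes>\<^sub>M ?N \<rightarrow>\<^sub>M borel"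
    unfolding Complex_eq case_prod_beta by measurable
  then show ?thesis
    unfolding std_complex_normal_def Let_def by (rule NN.prob_space_distr)
qed

end

theory Submission
  imports Defs "Jordan_Normal_Form.Determinant" "HOL-Real_Asymp.Real_Asymp"
begin

unbundle no vec_syntax

text \<open>
  Consider precoding schemes in which the transmitted signals are linear in the data symbols. User \<open>k\<close>
  can decode if its noiseless observations determine its own symbols. Two such schemes are
  needed. In space-time interference alignment (\<open>K\<close> slots, \<open>K (K - 1)\<close> symbols) slot \<open>0\<close> is sent
  without current channel knowledge, and the later slots reproduce, at every unintended user, the
  interference received in slot \<open>0\<close>, which is then cancelled. The scheme of Maddah-Ali and
  Tse for \<open>K - 1\<close> users works with outdated channel knowledge only. That decoding is almost surely
  possible means that certain polynomials in the channel coefficients do not vanish, for which it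
  suffices to exhibit one channel. Interleaving the two schemes, so that the first one uses as many slots with
  current channel knowledge as possible, gives the number \<open>dof\<close> of symbols per slot in the limit of long
  superblocks.

  The symbols of a superblock are taken from a square grid of fixed spacing whose size grows with the
  power. For a well-conditioned channel and bounded noise no symbol is confused with another one.
  The remaining superblocks are an arbitrarily small fraction, since the superblocks are independent,
  and an outer Gilbert-Varshamov code corrects them; its relative rate loss vanishes as
  the power tends to infinity and the fraction to \<open>0\<close>.
\<close>

subsection \<open>Polynomial functions vanish almost nowhere\<close>

text \<open>The grid grows with the power while noise and channel do not, so one conditioning
  constant has to serve all powers. This works because differences of grid points are multiples of
  Gaussian integers: a wrong symbol is off by at least the spacing. Moreover only a user's own
  symbols have to be separated; the interference may be explained in any way. Noise threshold,
  conditioning constant and spacing are fixed by the scheme and the tolerated fraction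
  \<open>\<tau>\<close> of bad superblocks. A grid with a number of points proportional to
  \<open>P\<close> then fits into power \<open>P\<close>, and each symbol contributes one
  \<open>ln P\<close>. The mean power of the polynomial precoders is never computed: signals are
  clipped, which bounds the power surely and does not act on well-conditioned channels. The
  alignment scheme needs current channel knowledge in \<open>K - 1\<close> of its \<open>K\<close>
  slots. It can fill all slots as long as the knowledge is missing in at most a fraction
  \<open>1 / K\<close> of them, which is the first break point of \<open>dof\<close>; beyond it,
  time sharing with the outdated scheme gives the linear piece.\<close>

inductive polyfun :: "'i set \<Rightarrow> (('i \<Rightarrow> complex) \<Rightarrow> complex) \<Rightarrow> bool" for J :: "'i set" where
  const: "polyfun J (\<lambda>_. c)"
| coord: "j \<in> J \<Longrightarrow> polyfun J (\<lambda>x. x j)"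
| add: "polyfun J p \<Longrightarrow> polyfun J q \<Longrightarrow> polyfun J (\<lambda>x. p x + q x)"
| mult: "polyfun J p \<Longrightarrow> polyfun J q \<Longrightarrow> polyfun J (\<lambda>x. p x * q x)"

lemma polyfun_sum:
  assumes "\<And>a. a \<in> A \<Longrightarrow> polyfun J (p a)"
  shows "polyfun J (\<lambda>x. \<Sum>a\<in>A. p a x)"
  using assms by (induction A rule: infinite_finite_induct) (auto intro: polyfun.intros)

lemma polyfun_prod:
  assumes "\<And>a. a \<in> A \<Longrightarrow> polyfun J (p a)"
  shows "polyfun J (\<lambda>x. \<Prod>a\<in>A. p a x)"
  using assms by (induction A rule: infinite_finite_induct) (auto intro: polyfun.intros)

lemma polyfun_diff:
  assumes "polyfun J p" "polyfun J q"
  shows "polyfun J (\<lambda>x. p x - q x)"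
proof -
  have "polyfun J (\<lambda>x. p x + (- 1) * q x)"
    by (intro polyfun.intros assms)
  then show ?thesis by simp
qed

lemma polyfun_det:
  assumes "\<And>r c. r < n \<Longrightarrow> c < n \<Longrightarrow> polyfun J (\<lambda>x. f x r c)"
  shows "polyfun J (\<lambda>x. Determinant.det (mat n n (\<lambda>(r, c). f x r c)))"
proof -
  have "polyfun J (\<lambda>x. \<Sum>p\<in>{p. p permutes {0..<n}}.
      signof p * (\<Prod>i\<in>{0..<n}. f x i (p i)))"
    by (intro polyfun_sum polyfun.mult polyfun.const polyfun_prod assms)
       (auto dest: permutes_in_image)
  moreover have "Determinant.det (mat n n (\<lambda>(r, c). f x r c)) =
      (\<Sum>p\<in>{p. p permutes {0..<n}}. signof p * (\<Prod>i\<in>{0..<n}. f x i (p i)))" for x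
    by (subst det_def'[of _ n]) (auto intro!: sum.cong prod.cong simp: permutes_in_image)
  ultimately show ?thesis by simp
qed

lemma polyfun_cong_on:
  assumes "polyfun J p" and "\<And>j. j \<in> J \<Longrightarrow> x j = y j"
  shows "p x = p y"
  using assms by (induction rule: polyfun.induct) auto

lemma polyfun_mono:
  assumes "polyfun J p" "J \<subseteq> J'"
  shows "polyfun J' p"
  using assms by (induction rule: polyfun.induct) (auto intro: polyfun.intros)

text \<open>A polynomial involves finitely many coordinates; this reduces the infinite product of
  block channels to a finite one.\<close>

lemma polyfun_finite_support:
  assumes "polyfun I p"
  obtains J where "finite J" "J \<subseteq> I" "polyfun J p"
proof -
  from assms have "\<exists>J. finite J \<and> J \<subseteq> I \<and> polyfun J p"
  proof (induction rule: polyfun.induct)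
    case (const c)
    show ?case by (rule exI[of _ "{}"]) (auto intro: polyfun.intros)
  next
    case (coord j)
    then show ?case by (intro exI[of _ "{j}"]) (auto intro: polyfun.intros)
  next
    case (add p q)
    then obtain A B where AB: "finite A" "A \<subseteq> I" "polyfun A p" "finite B" "B \<subseteq> I" "polyfun B q"
      by blast
    then show ?case
      by (intro exI[of _ "A \<union> B"] conjI polyfun.add polyfun_mono[OF AB(3)] polyfun_mono[OF AB(6)]) auto
  next
    case (mult p q)
    then obtain A B where AB: "finite A" "A \<subseteq> I" "polyfun A p" "finite B" "B \<subseteq> I" "polyfun B q"
      by blast
    then show ?case
      by (intro exI[of _ "A \<union> B"] conjI polyfun.mult polyfun_mono[OF AB(3)] polyfun_mono[OF AB(6)]) auto
  qed
  with that show ?thesis by blast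
qed

lemma polyfun_measurable:
  assumes "polyfun J p" and "\<And>j. j \<in> J \<Longrightarrow> (\<lambda>x. x j) \<in> borel_measurable M"
  shows "p \<in> borel_measurable M"
  using assms by (induction rule: polyfun.induct) auto

lemma polyfun_univariate:
  assumes "polyfun (insert j J) p"
  shows "\<exists>q. \<forall>y. p (x(j := y)) = poly q y"
  using assms
proof (induction rule: polyfun.induct)
  case (const c)
  show ?case by (rule exI[of _ "[:c:]"]) simp
next
  case (coord i)
  show ?case
  proof (cases "i = j")
    case True
    then show ?thesis by (intro exI[of _ "[:0, 1:]"]) simp
  next
    case False
    then show ?thesis by (intro exI[of _ "[:x i:]"]) simp
  qed
next
  case (add p q)
  then obtain a b where "\<forall>y. p (x(j := y)) = poly a y" "\<forall>y. q (x(j := y)) = poly b y"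
    by blast
  then show ?case by (metis poly_add)
next
  case (mult p q)
  then obtain a b where "\<forall>y. p (x(j := y)) = poly a y" "\<forall>y. q (x(j := y)) = poly b y"
    by blast
  then show ?case by (metis poly_mult)
qed

lemma polyfun_fix_coord:
  assumes "polyfun (insert j J) p"
  shows "polyfun J (\<lambda>x. p (x(j := c)))"
  using assms
proof (induction rule: polyfun.induct)
  case (coord i)
  then show ?case by (cases "i = j") (auto intro: polyfun.intros)
qed (auto intro: polyfun.intros)

text \<open>Fubini over the new coordinate. Freezing it at its value in \<open>x0\<close> gives a
  polynomial that is nonzero for almost all remaining coordinates, by induction. Wherever this
  holds, the polynomial in the new coordinate alone is not the zero polynomial, and its finitely
  many roots are null points of \<open>D\<close>.\<close>

lemma AE_polyfun_nonzero_finite: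
  fixes D :: "complex measure"
  assumes D: "prob_space D" "sets D = sets borel" "\<And>x. emeasure D {x} = 0"
    and "finite J" "polyfun J p" "p x0 \<noteq> 0"
  shows "AE x in PiM J (\<lambda>_. D). p x \<noteq> 0"
  using assms(4-)
proof (induction J arbitrary: p rule: finite_induct)
  case empty
  have "p x = p x0" for x by (rule polyfun_cong_on[OF empty(1)]) simp
  then have "p x \<noteq> 0" for x using empty by metis
  then show ?case by simp
next
  case (insert j J)
  interpret D: prob_space D by (rule D(1))
  interpret product_sigma_finite "\<lambda>_::'a. D"
    by (rule product_sigma_finite.intro) (rule D.sigma_finite_measure_axioms)
  have "(\<lambda>x. x i) \<in> borel_measurable (PiM (insert j J) (\<lambda>_. D))" if "i \<in> insert j J" for i
    using measurable_component_singleton[OF that, of "\<lambda>_. D"]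
    by (simp add: measurable_cong_sets[OF refl D(2)])
  then have meas: "p \<in> borel_measurable (PiM (insert j J) (\<lambda>_. D))"
    by (rule polyfun_measurable[OF insert.prems(1)])
  let ?N = "{x \<in> space (PiM (insert j J) (\<lambda>_. D)). p x = 0}"
  have N: "?N \<in> sets (PiM (insert j J) (\<lambda>_. D))"
    using meas by measurable
  have "AE x in PiM J (\<lambda>_. D). p (x(j := x0 j)) \<noteq> 0"
    using insert.prems by (intro insert.IH polyfun_fix_coord) simp_all
  then have "AE x in PiM J (\<lambda>_. D). (\<integral>\<^sup>+ y. indicator ?N (x(j := y)) \<partial>D) = 0"
  proof eventually_elim
    case (elim x)
    obtain q where q: "\<And>y. p (x(j := y)) = poly q y"
      using polyfun_univariate[OF insert.prems(1)] by blast
    have "q \<noteq> 0" using elim q by auto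
    then have fin: "finite {y. poly q y = 0}" by (rule poly_roots_finite)
    have "{y} \<in> null_sets D" for y
      using D(2,3) by (intro null_setsI) auto
    then have "(\<Union>y\<in>{y. poly q y = 0}. {y}) \<in> null_sets D"
      using fin by (intro null_sets_UN' countable_finite) auto
    then have "{y. poly q y = 0} \<in> null_sets D"
      by simp
    then have "AE y in D. \<not> poly q y = 0" by (rule AE_I') auto
    then have "AE y in D. indicator ?N (x(j := y)) = (0::ennreal)"
      by eventually_elim (auto simp: q)
    then show ?case by (subst nn_integral_cong_AE[where v = "\<lambda>_. 0"]) auto
  qed
  then have "(\<integral>\<^sup>+ x. (\<integral>\<^sup>+ y. indicator ?N (x(j := y)) \<partial>D) \<partial>PiM J (\<lambda>_. D)) = 0"
    by (subst nn_integral_cong_AE[where v = "\<lambda>_. 0"]) auto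
  moreover have "emeasure (PiM (insert j J) (\<lambda>_. D)) ?N =
      (\<integral>\<^sup>+ x. (\<integral>\<^sup>+ y. indicator ?N (x(j := y)) \<partial>D) \<partial>PiM J (\<lambda>_. D))"
    using insert.hyps N by (subst product_nn_integral_insert[symmetric]) auto
  ultimately show ?case using N by (intro AE_I[of _ _ ?N]) auto
qed

lemma AE_polyfun_nonzero:
  fixes D :: "complex measure"
  assumes D: "prob_space D" "sets D = sets borel" "\<And>x. emeasure D {x} = 0"
    and p: "polyfun I p" "p x0 \<noteq> 0"
  shows "AE x in PiM I (\<lambda>_. D). p x \<noteq> 0"
proof -
  interpret product_prob_space "\<lambda>_::'a. D" I
    by (rule product_prob_spaceI) (rule D(1))
  obtain J where J: "finite J" "J \<subseteq> I" "polyfun J p"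
    using polyfun_finite_support[OF p(1)] .
  have "AE x in distr (PiM I (\<lambda>_. D)) (PiM J (\<lambda>_. D)) (\<lambda>x. restrict x J). p x \<noteq> 0"
    unfolding distr_PiM_restrict_finite[OF J(1,2)]
    by (rule AE_polyfun_nonzero_finite[OF D J(1,3) p(2)])
  then have "AE x in PiM I (\<lambda>_. D). p (restrict x J) \<noteq> 0"
    by (rule AE_distrD[rotated]) (rule measurable_restrict_subset[OF J(2)])
  moreover have "p (restrict x J) = p x" for x
    by (rule polyfun_cong_on[OF J(3)]) simp
  ultimately show ?thesis by simp
qed

text \<open>The schemes are analysed through kernels, written as plain sums; the determinant is kept
  only as the polynomial whose zero set is null.\<close>

lemma det_nonzero_iff_trivial_kernel:
  fixes f :: "nat \<Rightarrow> nat \<Rightarrow> complex"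
  shows "Determinant.det (mat n n (\<lambda>(r, c). f r c)) \<noteq> 0 \<longleftrightarrow>
    (\<forall>u. (\<forall>r<n. (\<Sum>c<n. f r c * u c) = 0) \<longrightarrow> (\<forall>c<n. u c = 0))"
    (is "?L \<longleftrightarrow> ?R")
proof -
  let ?A = "mat n n (\<lambda>(r, c). f r c)"
  have A: "?A \<in> carrier_mat n n" by simp
  have mv: "(?A *\<^sub>v v) $ r = (\<Sum>c<n. f r c * v $ c)" if "r < n" "v \<in> carrier_vec n" for r v
    using that by (auto simp: scalar_prod_def atLeast0LessThan intro!: sum.cong)
  show ?thesis
  proof
    assume L: ?L
    show ?R
    proof (intro allI impI)
      fix u c assume u: "\<forall>r<n. (\<Sum>c<n. f r c * u c) = 0" and c: "c < n"
      let ?v = "vec n u"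
      have "?A *\<^sub>v ?v = 0\<^sub>v n"
        using u by (intro eq_vecI) (auto simp: mv simp del: index_mult_mat_vec)
      then have "?v = 0\<^sub>v n"
        using L det_0_iff_vec_prod_zero[OF A] vec_carrier[of n u] by metis
      then have "?v $ c = 0" using c by simp
      then show "u c = 0" using c by simp
    qed
  next
    assume R: ?R
    show ?L
    proof
      assume "Determinant.det ?A = 0"
      then obtain v where v: "v \<in> carrier_vec n" "v \<noteq> 0\<^sub>v n" "?A *\<^sub>v v = 0\<^sub>v n"
        using det_0_iff_vec_prod_zero[OF A] by blast
      have "\<forall>r<n. (\<Sum>c<n. f r c * v $ c) = 0"
        using mv[OF _ v(1)] v(3) by (metis index_zero_vec(1))
      then have "\<forall>c<n. v $ c = 0" using R by blast
      then show False using v by (auto intro!: eq_vecI)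
    qed
  qed
qed

subsection \<open>Linear schemes\<close>

definition precoded ::
  "'a set \<Rightarrow> (nat \<Rightarrow> nat \<Rightarrow> 'a \<Rightarrow> fading \<Rightarrow> complex) \<Rightarrow> nat \<Rightarrow> nat \<Rightarrow> ('a \<Rightarrow> complex) \<Rightarrow> fading \<Rightarrow> complex" where
  "precoded S v t i u H = (\<Sum>s\<in>S. v t i s H * u s)"

definition noiseless ::
  "nat \<Rightarrow> (nat \<Rightarrow> nat) \<Rightarrow> 'a set \<Rightarrow> (nat \<Rightarrow> nat \<Rightarrow> 'a \<Rightarrow> fading \<Rightarrow> complex) \<Rightarrow> nat \<Rightarrow> nat \<Rightarrow> ('a \<Rightarrow> complex) \<Rightarrow> fading \<Rightarrow> complex" where
  "noiseless K ch S v k t u H = (\<Sum>i<K - 1. H (ch t, k, i) * precoded S v t i u H)"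

locale diffuse = prob_space D for D :: "complex measure" +
  assumes sets_D: "sets D = sets borel" and null_point: "\<And>x. emeasure D {x} = 0"

text \<open>Slots are numbered from 0 here; \<open>kn t\<close> contains the blocks known in slot
  \<open>t\<close>, and \<open>ch t\<close> is the block that slot \<open>t\<close> lies in. By
  linearity, the own symbols are determined by the observations iff they vanish whenever the
  observations do; symbols of other users may remain undetermined. Coefficients take total channels
  as arguments, and \<open>causal\<close> restricts what they read.\<close>

locale linear_scheme =
  fixes K :: nat and D :: "complex measure" and kn :: "nat \<Rightarrow> nat set" and ch :: "nat \<Rightarrow> nat"
    and n :: nat and S :: "'a set" and own :: "'a \<Rightarrow> nat"
    and v :: "nat \<Rightarrow> nat \<Rightarrow> 'a \<Rightarrow> fading \<Rightarrow> complex"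
  assumes finite_symbols: "finite S"
    and own_less: "s \<in> S \<Longrightarrow> own s < K"
    and measurable_coeff: "\<lbrakk>t < n; i < K - 1; s \<in> S\<rbrakk> \<Longrightarrow> v t i s \<in> borel_measurable (PiM UNIV (\<lambda>_. borel))"
    and causal: "\<lbrakk>t < n; i < K - 1; s \<in> S; \<And>x. x \<in> csi_index K (kn t) \<Longrightarrow> H x = H' x\<rbrakk>
      \<Longrightarrow> v t i s H = v t i s H'"
    and decodable: "AE H in fading_space K D. \<forall>k<K. \<forall>u.
      (\<forall>t<n. noiseless K ch S v k t u H = 0) \<longrightarrow> (\<forall>s\<in>S. own s = k \<longrightarrow> u s = 0)"

lemma polyfun_measurable_UNIV:
  "polyfun J p \<Longrightarrow> p \<in> borel_measurable (PiM UNIV (\<lambda>_. borel))"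
  by (erule polyfun_measurable) simp

lemma (in diffuse) AE_fading_polyfun_nonzero:
  assumes "polyfun (csi_index K UNIV) p" "p x0 \<noteq> 0"
  shows "AE H in fading_space K D. p H \<noteq> 0"
  unfolding fading_space_def
  by (rule AE_polyfun_nonzero[OF prob_space_axioms sets_D null_point assms])

subsection \<open>Space-time interference alignment\<close>

text \<open>Increasing enumeration of the users other than \<open>k\<close>. There are as many of
  them as antennas, so their channel vectors form a square matrix.\<close>

definition skip :: "nat \<Rightarrow> nat \<Rightarrow> nat" where
  "skip k r = (if r < k then r else Suc r)"

lemma skip_neq: "skip k r \<noteq> k"
  by (auto simp: skip_def)

lemma skip_inject [simp]: "skip k r = skip k r' \<longleftrightarrow> r = r'"
  by (auto simp: skip_def)

lemma skip_less: "r < K - 1 \<Longrightarrow> skip k r < K"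
  by (auto simp: skip_def)

lemma skip_surj:
  assumes "l < K" "l \<noteq> k" "k < K"
  obtains r where "r < K - 1" "skip k r = l"
proof (cases "l < k")
  case True
  then show ?thesis using that[of l] assms by (auto simp: skip_def)
next
  case False
  then show ?thesis using that[of "l - 1"] assms by (auto simp: skip_def)
qed

definition others :: "nat \<Rightarrow> nat \<Rightarrow> nat \<Rightarrow> fading \<Rightarrow> complex mat" where
  "others K k j H = mat (K - 1) (K - 1) (\<lambda>(r, i). H (j, skip k r, i))"

text \<open>In slot \<open>0\<close> each symbol is sent uncoded on its own antenna. In a later slot
  its precoding vector has to give every unintended user the coefficient of slot \<open>0\<close> up
  to a scalar: a square linear system. The sum over \<open>r\<close> is the adjugate applied to the
  right-hand side, that is, the solution multiplied by the determinant, which avoids division. The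
  further determinants make the scalar the same for the symbols of all users.\<close>

definition stia_coeff :: "nat \<Rightarrow> nat \<Rightarrow> nat \<Rightarrow> nat \<times> nat \<Rightarrow> fading \<Rightarrow> complex" where
  "stia_coeff K j i s H = (case s of (k, a) \<Rightarrow>
     if j = 0 then (if i = a then 1 else 0)
     else (\<Prod>k'\<in>{..<K} - {k}. Determinant.det (others K k' j H)) *
       (\<Sum>r<K - 1. cofactor (others K k j H) r i * H (0, skip k r, a)))"

lemma sum_row_cofactor:
  fixes f :: "nat \<Rightarrow> nat \<Rightarrow> complex"
  assumes "r < m" "r' < m"
  shows "(\<Sum>i<m. f r i * cofactor (mat m m (\<lambda>(r, i). f r i)) r' i) =
    (if r = r' then Determinant.det (mat m m (\<lambda>(r, i). f r i)) else 0)"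
proof -
  let ?A = "mat m m (\<lambda>(r, i). f r i)"
  have A: "?A \<in> carrier_mat m m" by simp
  have "(?A * adj_mat ?A) $$ (r, r') = (\<Sum>i<m. f r i * cofactor ?A r' i)"
    using assms by (auto simp: adj_mat_def scalar_prod_def atLeast0LessThan intro!: sum.cong)
  moreover have "(?A * adj_mat ?A) $$ (r, r') = (if r = r' then Determinant.det ?A else 0)"
    using assms adj_mat(2)[OF A] by simp
  ultimately show ?thesis by simp
qed

lemma polyfun_det_others:
  assumes "k < K"
  shows "polyfun (csi_index K {j}) (\<lambda>H. Determinant.det (others K k j H))"
  unfolding others_def
  by (rule polyfun_det) (auto intro!: polyfun.coord simp: csi_index_def skip_less)

lemma polyfun_cofactor_others:
  assumes "k < K" "r < K - 1" "i < K - 1"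
  shows "polyfun (csi_index K {j}) (\<lambda>H. cofactor (others K k j H) r i)"
proof -
  have *: "mat_delete (others K k j H) r i =
      mat (K - 1 - 1) (K - 1 - 1) (\<lambda>(a, b). H (j, skip k (if a < r then a else Suc a), if b < i then b else Suc b))" for H
    using assms by (auto simp: mat_delete_def others_def)
  show ?thesis
    unfolding cofactor_def *
    by (intro polyfun.mult polyfun.const polyfun_det polyfun.coord)
       (auto simp: csi_index_def intro: skip_less)
qed

lemma polyfun_stia_coeff:
  assumes "k < K" "i < K - 1" "a < K - 1"
  shows "polyfun (csi_index K (if j = 0 then {} else {..j})) (stia_coeff K j i (k, a))"
proof (cases "j = 0")
  case True
  then show ?thesis by (simp add: stia_coeff_def[abs_def] polyfun.const)
next
  case False
  have sub: "csi_index K {j} \<subseteq> csi_index K {..j}"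
    by (auto simp: csi_index_def)
  have "polyfun (csi_index K {..j}) (\<lambda>H.
      (\<Prod>k'\<in>{..<K} - {k}. Determinant.det (others K k' j H)) *
       (\<Sum>r<K - 1. cofactor (others K k j H) r i * H (0, skip k r, a)))"
    using assms
    by (intro polyfun.mult polyfun_prod polyfun_sum polyfun.coord
        polyfun_mono[OF polyfun_det_others sub] polyfun_mono[OF polyfun_cofactor_others sub])
       (auto simp: csi_index_def intro: skip_less)
  then show ?thesis using False by (simp add: stia_coeff_def[abs_def])
qed

definition all_dets :: "nat \<Rightarrow> nat \<Rightarrow> fading \<Rightarrow> complex" where
  "all_dets K j H = (\<Prod>k<K. Determinant.det (others K k j H))"

text \<open>User \<open>l\<close> is a row of the matrix \<open>others K k j\<close>, and a matrix
  times its adjugate is the determinant times the identity.\<close>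

lemma stia_alignment:
  assumes "k < K" "l < K" "l \<noteq> k" "0 < j"
  shows "(\<Sum>i<K - 1. H (j, l, i) * stia_coeff K j i (k, a) H) = all_dets K j H * H (0, l, a)"
proof -
  obtain r0 where r0: "r0 < K - 1" "skip k r0 = l"
    using skip_surj[OF assms(2,3,1)] .
  let ?P = "\<Prod>k'\<in>{..<K} - {k}. Determinant.det (others K k' j H)"
  have "(\<Sum>i<K - 1. H (j, l, i) * stia_coeff K j i (k, a) H) =
      (\<Sum>i<K - 1. \<Sum>r<K - 1. ?P * H (0, skip k r, a) * (H (j, skip k r0, i) * cofactor (others K k j H) r i))"
    using assms(4) r0 by (simp add: stia_coeff_def sum_distrib_left mult_ac)
  also have "\<dots> = (\<Sum>r<K - 1. ?P * H (0, skip k r, a) *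
      (\<Sum>i<K - 1. H (j, skip k r0, i) * cofactor (others K k j H) r i))"
    by (subst sum.swap) (simp add: sum_distrib_left)
  also have "\<dots> = (\<Sum>r<K - 1. ?P * H (0, skip k r, a) *
      (if r0 = r then Determinant.det (others K k j H) else 0))"
    using r0 sum_row_cofactor[where f = "\<lambda>r i. H (j, skip k r, i)" and m = "K - 1"]
    by (intro sum.cong) (auto simp: others_def)
  also have "\<dots> = ?P * Determinant.det (others K k j H) * H (0, l, a)"
    using r0 by (simp add: sum.delta if_distrib cong: if_cong)
  also have "?P * Determinant.det (others K k j H) = all_dets K j H"
    unfolding all_dets_def using assms(1)
    by (subst prod.remove[of "{..<K}" k]) (simp_all add: mult.commute)
  finally show ?thesis .
qed

text \<open>What user \<open>k\<close> is left with in slot \<open>r + 1\<close> after cancelling the interference with slot \<open>0\<close>.\<close>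

definition stia_residual :: "nat \<Rightarrow> nat \<Rightarrow> fading \<Rightarrow> nat \<Rightarrow> nat \<Rightarrow> complex" where
  "stia_residual K k H r a =
     (\<Sum>i<K - 1. H (Suc r, k, i) * stia_coeff K (Suc r) i (k, a) H) - all_dets K (Suc r) H * H (0, k, a)"

text \<open>The factor \<open>all_dets\<close> does not depend on the interfering user, so one
  subtraction removes all interference at once and leaves \<open>K - 1\<close> equations in the
  \<open>K - 1\<close> own symbols.\<close>

lemma stia_noiseless_diff:
  assumes "k < K" "r < K - 1"
  defines "S \<equiv> {..<K} \<times> {..<K - 1}"
  shows "noiseless K id S (stia_coeff K) k (Suc r) u H - all_dets K (Suc r) H * noiseless K id S (stia_coeff K) k 0 u H =
    (\<Sum>a<K - 1. stia_residual K k H r a * u (k, a))"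
proof -
  let ?d = "all_dets K (Suc r) H"
  have swap: "noiseless K id S (stia_coeff K) k j u H =
      (\<Sum>l<K. \<Sum>a<K - 1. (\<Sum>i<K - 1. H (j, k, i) * stia_coeff K j i (l, a) H) * u (l, a))" for j
  proof -
    have "noiseless K id S (stia_coeff K) k j u H =
        (\<Sum>i<K - 1. \<Sum>s\<in>S. H (j, k, i) * stia_coeff K j i s H * u s)"
      by (simp add: noiseless_def precoded_def sum_distrib_left mult.assoc)
    also have "\<dots> = (\<Sum>s\<in>S. (\<Sum>i<K - 1. H (j, k, i) * stia_coeff K j i s H) * u s)"
      by (subst sum.swap) (simp add: sum_distrib_right)
    also have "\<dots> = (\<Sum>l<K. \<Sum>a<K - 1. (\<Sum>i<K - 1. H (j, k, i) * stia_coeff K j i (l, a) H) * u (l, a))"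
      by (simp add: S_def sum.cartesian_product case_prod_beta)
    finally show ?thesis .
  qed
  have "noiseless K id S (stia_coeff K) k 0 u H = (\<Sum>l<K. \<Sum>a<K - 1. H (0, k, a) * u (l, a))"
    unfolding swap
  proof (intro sum.cong refl arg_cong2[where f = "(*)"])
    fix l a assume "a \<in> {..<K - 1}"
    have "(\<Sum>i<K - 1. H (0, k, i) * stia_coeff K 0 i (l, a) H) = (\<Sum>i<K - 1. if i = a then H (0, k, a) else 0)"
      by (intro sum.cong) (auto simp: stia_coeff_def)
    with \<open>a \<in> {..<K - 1}\<close> show "(\<Sum>i<K - 1. H (0, k, i) * stia_coeff K 0 i (l, a) H) = H (0, k, a)"
      by simp
  qed
  then have "noiseless K id S (stia_coeff K) k (Suc r) u H - ?d * noiseless K id S (stia_coeff K) k 0 u H =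
    (\<Sum>l<K. \<Sum>a<K - 1. ((\<Sum>i<K - 1. H (Suc r, k, i) * stia_coeff K (Suc r) i (l, a) H) - ?d * H (0, k, a)) * u (l, a))"
    unfolding swap[of "Suc r"] by (simp add: sum_distrib_left sum_subtractf algebra_simps)
  also have "\<dots> = (\<Sum>l<K. if l = k then (\<Sum>a<K - 1. stia_residual K k H r a * u (k, a)) else 0)"
    using assms(1) stia_alignment[of _ K k "Suc r" H]
    by (intro sum.cong refl) (auto simp: stia_residual_def)
  also have "\<dots> = (\<Sum>a<K - 1. stia_residual K k H r a * u (k, a))"
    using assms(1) by simp
  finally show ?thesis .
qed

text \<open>At this channel the users other than \<open>k\<close> form an identity matrix in every slot, and the
  residual matrix of user \<open>k\<close> is diagonal.\<close>

definition stia_witness :: "nat \<Rightarrow> fading" where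
  "stia_witness k = (\<lambda>(j, l, i). if l = k then (if Suc i = j then 2 else 1)
     else if skip k i = l then 1 else 0)"

text \<open>The rows of users other than \<open>k\<close> are unit vectors and annihilate all
  coordinates of a kernel vector but at most one. If one is left, the row of \<open>k\<close> is
  present, and it has no zero entry.\<close>

lemma det_others_witness_nonzero:
  assumes "k < K" "k' < K"
  shows "Determinant.det (others K k' j (stia_witness k)) \<noteq> 0"
  unfolding others_def det_nonzero_iff_trivial_kernel
proof (intro allI impI)
  fix w c assume w: "\<forall>r<K - 1. (\<Sum>c<K - 1. stia_witness k (j, skip k' r, c) * w c) = 0" and c: "c < K - 1"
  have eq: "(\<Sum>c<K - 1. stia_witness k (j, l, c) * w c) = 0" if "l < K" "l \<noteq> k'" for l
    using w skip_surj[OF that assms(2)] by metis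
  have w0: "w i = 0" if i: "i < K - 1" "skip k i \<noteq> k'" for i
  proof -
    have "(\<Sum>c<K - 1. stia_witness k (j, skip k i, c) * w c) = (\<Sum>c<K - 1. if c = i then w c else 0)"
      using skip_neq[of k i] by (intro sum.cong) (auto simp: stia_witness_def)
    with eq[OF skip_less[OF i(1)] i(2)] i(1) show ?thesis by simp
  qed
  show "w c = 0"
  proof (cases "skip k c = k'")
    case True
    then have "k \<noteq> k'" using skip_neq by blast
    then have "0 = (\<Sum>i<K - 1. stia_witness k (j, k, i) * w i)"
      using eq[of k] assms(1) by simp
    also have "\<dots> = (\<Sum>i<K - 1. if i = c then stia_witness k (j, k, c) * w c else 0)"
    proof (intro sum.cong refl)
      fix i assume "i \<in> {..<K - 1}"
      then show "stia_witness k (j, k, i) * w i = (if i = c then stia_witness k (j, k, c) * w c else 0)"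
        using w0[of i] by (cases "i = c") (simp_all add: True[symmetric])
    qed
    finally show ?thesis using c by (simp add: stia_witness_def split: if_splits)
  qed (use w0 c in blast)
qed

text \<open>The precoder of the symbol \<open>(k, a)\<close> is \<open>all_dets\<close> times a unit
  vector here. User \<open>k\<close> sees the coefficient \<open>2\<close> in slot
  \<open>Suc a\<close> and \<open>1\<close> in slot \<open>0\<close> and all others, so the
  difference with slot \<open>0\<close> survives in slot \<open>Suc a\<close> alone.\<close>

lemma stia_residual_witness:
  assumes "k < K" "r < K - 1" "a < K - 1"
  shows "stia_residual K k (stia_witness k) r a = (if r = a then all_dets K (Suc r) (stia_witness k) else 0)"
proof -
  let ?H = "stia_witness k"
  have one: "others K k j ?H = 1\<^sub>m (K - 1)" for j
    by (rule eq_matI) (auto simp: others_def stia_witness_def skip_neq)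
  have cof: "cofactor (others K k j ?H) r i = (if i = r then 1 else 0)" if "r < K - 1" "i < K - 1" for j r i
  proof -
    have "cofactor (others K k j ?H) r i = (\<Sum>i'<K - 1. ?H (j, skip k i, i') * cofactor (others K k j ?H) r i')"
      using that by (simp add: stia_witness_def skip_neq if_distrib[where f = "\<lambda>x. x * _"] cong: if_cong)
    also have "\<dots> = (if i = r then Determinant.det (others K k j ?H) else 0)"
      unfolding others_def by (rule sum_row_cofactor[OF that(2,1)])
    finally show ?thesis by (simp add: one)
  qed
  have dets: "(\<Prod>k'\<in>{..<K} - {k}. Determinant.det (others K k' j ?H)) = all_dets K j ?H" for j
    unfolding all_dets_def using assms(1) by (subst prod.remove[of "{..<K}" k]) (simp_all add: one)
  have coeff: "stia_coeff K (Suc r) i (k, a) ?H = (if i = a then all_dets K (Suc r) ?H else 0)"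
    if "i < K - 1" for i
  proof -
    have "(\<Sum>r<K - 1. cofactor (others K k (Suc r0) ?H) r i * ?H (0, skip k r, a)) =
        (\<Sum>r<K - 1. if r = i then (if i = a then 1 else 0) else 0)" for r0
    proof (intro sum.cong refl)
      fix r assume "r \<in> {..<K - 1}"
      moreover have "?H (0, skip k r, a) = (if r = a then 1 else 0)"
        by (auto simp: stia_witness_def skip_neq)
      ultimately show "cofactor (others K k (Suc r0) ?H) r i * ?H (0, skip k r, a) =
          (if r = i then (if i = a then 1 else 0) else 0)"
        using that by (simp add: cof)
    qed
    then show ?thesis
      using that by (simp add: stia_coeff_def dets)
  qed
  have "(\<Sum>i<K - 1. ?H (Suc r, k, i) * stia_coeff K (Suc r) i (k, a) ?H) =
      (\<Sum>i<K - 1. if i = a then ?H (Suc r, k, a) * all_dets K (Suc r) ?H else 0)"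
    by (intro sum.cong) (auto simp: coeff)
  with assms show ?thesis
    by (simp add: stia_residual_def) (simp add: stia_witness_def)
qed

text \<open>Each slot lies in a block of its own, hence \<open>ch = id\<close>. Only slot
  \<open>0\<close> does without CSI; the others use their own block as well as the earlier
  ones.\<close>

lemma (in diffuse) linear_scheme_stia:
  "linear_scheme K D (\<lambda>j. if j = 0 then {} else {..j}) id K ({..<K} \<times> {..<K - 1}) fst (stia_coeff K)"
proof
  fix t i s assume "t < K" "i < K - 1" "s \<in> {..<K} \<times> {..<K - 1}"
  then have *: "polyfun (csi_index K (if t = 0 then {} else {..t})) (stia_coeff K t i s)"
    using polyfun_stia_coeff[of "fst s" K i "snd s" t] by (cases s) simp
  show "stia_coeff K t i s \<in> borel_measurable (PiM UNIV (\<lambda>_. borel))"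
    by (rule polyfun_measurable_UNIV[OF *])
  show "stia_coeff K t i s H = stia_coeff K t i s H'"
    if "\<And>x. x \<in> csi_index K (if t = 0 then {} else {..t}) \<Longrightarrow> H x = H' x" for H H'
    by (rule polyfun_cong_on[OF *]) (rule that)
next
  let ?S = "{..<K} \<times> {..<K - 1}"
  let ?R = "\<lambda>k H. Determinant.det (mat (K - 1) (K - 1) (\<lambda>(r, a). stia_residual K k H r a))"
  have "AE H in fading_space K D. ?R k H \<noteq> 0" if k: "k < K" for k
  proof (rule AE_fading_polyfun_nonzero)
    have sub: "csi_index K B \<subseteq> csi_index K UNIV" for B by (auto simp: csi_index_def)
    show "polyfun (csi_index K UNIV) (?R k)"
      unfolding stia_residual_def all_dets_def using k
      by (intro polyfun_det polyfun_diff polyfun_sum polyfun_prod polyfun.mult polyfun.coord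
          polyfun_mono[OF polyfun_det_others sub] polyfun_mono[OF polyfun_stia_coeff sub])
         (auto simp: csi_index_def)
    show "?R k (stia_witness k) \<noteq> 0"
      unfolding det_nonzero_iff_trivial_kernel
    proof (intro allI impI)
      fix u :: "nat \<Rightarrow> complex" and c
      assume u: "\<forall>r<K - 1. (\<Sum>a<K - 1. stia_residual K k (stia_witness k) r a * u a) = 0" and c: "c < K - 1"
      have "0 = (\<Sum>a<K - 1. stia_residual K k (stia_witness k) c a * u a)"
        using u c by simp
      also have "\<dots> = (\<Sum>a<K - 1. if a = c then all_dets K (Suc c) (stia_witness k) * u c else 0)"
        using k c by (intro sum.cong) (auto simp: stia_residual_witness)
      also have "\<dots> = all_dets K (Suc c) (stia_witness k) * u c"
        using c by simp
      finally show "u c = 0"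
        using det_others_witness_nonzero[OF k] by (auto simp: all_dets_def)
    qed
  qed
  then have "AE H in fading_space K D. \<forall>k\<in>{..<K}. ?R k H \<noteq> 0"
    by (intro AE_finite_allI) auto
  then show "AE H in fading_space K D. \<forall>k<K. \<forall>u.
      (\<forall>t<K. noiseless K id ?S (stia_coeff K) k t u H = 0) \<longrightarrow> (\<forall>s\<in>?S. fst s = k \<longrightarrow> u s = 0)"
  proof eventually_elim
    case (elim H)
    show ?case
    proof (intro allI impI ballI)
      fix k u s
      assume k: "k < K" and u: "\<forall>t<K. noiseless K id ?S (stia_coeff K) k t u H = 0"
        and s: "s \<in> ?S" "fst s = k"
      have "\<forall>r<K - 1. (\<Sum>a<K - 1. stia_residual K k H r a * u (k, a)) = 0"
        using u k stia_noiseless_diff[OF k, of _ u H] by (auto simp flip: stia_noiseless_diff)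
      moreover have "\<forall>u. (\<forall>r<K - 1. (\<Sum>a<K - 1. stia_residual K k H r a * u a) = 0) \<longrightarrow> (\<forall>a<K - 1. u a = 0)"
        using elim k unfolding det_nonzero_iff_trivial_kernel by simp
      ultimately have "\<forall>a<K - 1. u (k, a) = 0"
        by (elim allE[of _ "\<lambda>a. u (k, a)"] impE)
      then show "u s = 0" using s by (cases s) auto
    qed
  qed
qed auto

subsection \<open>The scheme of Maddah-Ali and Tse\<close>

text \<open>Chosen such that each phase produces exactly the symbols which the next one sends. Phase
  \<open>J\<close> then takes \<open>fact q / Suc J\<close> slots.\<close>

definition mat_reps :: "nat \<Rightarrow> nat \<Rightarrow> nat" where
  "mat_reps q J = fact J * fact (q - Suc J)"

text \<open>Phase \<open>J\<close> serves the sets of \<open>Suc J\<close> among the \<open>q\<close> users; a slot is a phase, such a set and a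
  repetition number.\<close>

definition mat_slots :: "nat \<Rightarrow> (nat \<times> nat set \<times> nat) set" where
  "mat_slots q = (SIGMA J:{..<q}. {U. U \<subseteq> {..<q} \<and> card U = Suc J} \<times> {..<mat_reps q J})"

text \<open>In the slot \<open>(J, U, \<rho>)\<close> the symbols \<open>\<rho> * (q - J) + a\<close> of the set \<open>U\<close> are sent on the antennas
  \<open>a < q - J\<close>. A symbol of phase \<open>Suc J\<close> is a linear combination of what the members \<open>r\<close> of \<open>U\<close>
  overheard in phase \<open>J\<close> when \<open>U - {r}\<close> was served.\<close>

primrec mat_symbol ::
  "nat \<Rightarrow> (nat \<times> nat set \<times> nat \<Rightarrow> nat) \<Rightarrow> fading \<Rightarrow> (nat \<times> nat \<Rightarrow> complex) \<Rightarrow> nat \<Rightarrow> nat set \<Rightarrow> nat \<Rightarrow> complex" where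
  "mat_symbol q g H u 0 = (\<lambda>U i. u (the_elem U, i))"
| "mat_symbol q g H u (Suc J) = (\<lambda>U i. \<Sum>r\<in>U. of_nat r ^ (i mod Suc J) *
     (\<Sum>a<q - J. H (g (J, U - {r}, i div Suc J), r, a) *
        mat_symbol q g H u J (U - {r}) (i div Suc J * (q - J) + a)))"

definition mat_heard ::
  "nat \<Rightarrow> (nat \<times> nat set \<times> nat \<Rightarrow> nat) \<Rightarrow> fading \<Rightarrow> (nat \<times> nat \<Rightarrow> complex) \<Rightarrow> nat \<Rightarrow> nat set \<Rightarrow> nat \<Rightarrow> nat \<Rightarrow> complex" where
  "mat_heard q g H u J U \<rho> r =
     (\<Sum>a<q - J. H (g (J, U, \<rho>), r, a) * mat_symbol q g H u J U (\<rho> * (q - J) + a))"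

lemma mat_symbol_Suc:
  "mat_symbol q g H u (Suc J) U i =
    (\<Sum>r\<in>U. of_nat r ^ (i mod Suc J) * mat_heard q g H u J (U - {r}) (i div Suc J) r)"
  by (simp add: mat_heard_def)

lemma finite_mat_slots: "finite (mat_slots q)"
  by (auto simp: mat_slots_def intro!: finite_SigmaI)

text \<open>Both sides count the symbols of one set of \<open>Suc (Suc J)\<close> users: as sent in
  phase \<open>Suc J\<close>, repetitions times antennas, and as produced from phase
  \<open>J\<close>, with \<open>Suc J\<close> combinations for each repetition.\<close>

lemma mat_reps_Suc:
  assumes "Suc J < q"
  shows "mat_reps q (Suc J) * (q - Suc J) = mat_reps q J * Suc J"
proof -
  have "q - Suc J = Suc (q - Suc (Suc J))" using assms by simp
  then have "fact (q - Suc J) = (q - Suc J) * fact (q - Suc (Suc J))"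
    by (metis fact_Suc of_nat_id)
  then have "mat_reps q (Suc J) * (q - Suc J) = fact (Suc J) * fact (q - Suc J)"
    by (simp only: mat_reps_def mult_ac)
  also have "\<dots> = mat_reps q J * Suc J"
    by (simp add: mat_reps_def algebra_simps)
  finally show ?thesis .
qed

lemma mat_index_div:
  assumes "Suc J < q" "i < mat_reps q (Suc J) * (q - Suc J)"
  shows "i div Suc J < mat_reps q J"
  using assms by (simp add: mat_reps_Suc less_mult_imp_div_less)

lemma mat_index_less:
  assumes "\<rho> < m" "a < (d::nat)"
  shows "\<rho> * d + a < m * d"
proof -
  have "\<rho> * d + a < Suc \<rho> * d" using assms by simp
  also have "\<dots> \<le> m * d" using assms by (intro mult_right_mono) auto
  finally show ?thesis .
qed

text \<open>The values at unit vectors are the precoder entries of the scheme. Cutting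
  \<open>u\<close> off outside \<open>S\<close> is needed since phase \<open>0\<close> may read
  \<open>u\<close> at any index.\<close>

lemma mat_symbol_linear:
  assumes "finite S"
  shows "mat_symbol q g H (\<lambda>s. if s \<in> S then u s else 0) J U i =
    (\<Sum>s\<in>S. mat_symbol q g H (\<lambda>s'. if s' = s then 1 else 0) J U i * u s)"
proof (induction J arbitrary: U i)
  case 0
  show ?case using assms by (simp add: if_distrib[where f = "\<lambda>x. x * _"] cong: if_cong)
next
  case (Suc J)
  show ?case
    unfolding mat_symbol.simps Suc
    by (simp add: sum_distrib_left sum_distrib_right mult_ac sum.swap[of _ S])
qed

text \<open>A symbol of phase \<open>Suc J\<close> involves, in addition to symbols of phase
  \<open>J\<close>, only channels of slots of phase \<open>J\<close>. Hence outdated CSI suffices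
  once slots are ordered by phase.\<close>

lemma polyfun_mat_symbol:
  assumes "U \<subseteq> {..<q}" "card U = Suc J" "i < mat_reps q J * (q - J)"
  shows "polyfun ((\<lambda>(s, r, a). (g s, r, a)) ` ((mat_slots q \<inter> {s. fst s < J}) \<times> {..<q} \<times> {..<q}))
    (\<lambda>H. mat_symbol q g H u J U i)"
  using assms
proof (induction J arbitrary: U i)
  case 0
  show ?case by (simp add: polyfun.const)
next
  case (Suc J)
  let ?I = "\<lambda>J. (\<lambda>(s, r, a). (g s, r, a)) ` ((mat_slots q \<inter> {s. fst s < J}) \<times> {..<q} \<times> {..<q})"
  have "Suc (Suc J) \<le> q"
    using card_mono[OF _ Suc.prems(1)] Suc.prems(2) by simp
  then have \<rho>: "i div Suc J < mat_reps q J"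
    using Suc.prems(3) by (intro mat_index_div) auto
  have U: "U - {r} \<subseteq> {..<q}" "card (U - {r}) = Suc J" if "r \<in> U" for r
    using Suc.prems(1,2) that by (auto simp: card_Diff_singleton)
  have sub: "?I J \<subseteq> ?I (Suc J)" by auto
  have mem: "(g (J, U - {r}, i div Suc J), r, a) \<in> ?I (Suc J)" if "r \<in> U" "a < q - J" for r a
  proof -
    have "(J, U - {r}, i div Suc J) \<in> mat_slots q \<inter> {s. fst s < Suc J}"
      using U[OF that(1)] \<rho> \<open>Suc (Suc J) \<le> q\<close> by (auto simp: mat_slots_def)
    moreover have "r < q" "a < q" using that Suc.prems(1) by auto
    ultimately show ?thesis
      by (intro image_eqI[of _ _ "((J, U - {r}, i div Suc J), r, a)"]) auto
  qed
  show ?case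
    unfolding mat_symbol.simps
    by (intro polyfun_sum polyfun.mult polyfun.const polyfun.coord mem
          polyfun_mono[OF Suc.IH sub] U mat_index_less[OF \<rho>]) auto
qed

text \<open>The assumption extends to all polynomials of degree below \<open>card A\<close>; apply
  it to the one that vanishes on \<open>A\<close> except at \<open>r\<close>.\<close>

lemma vandermonde_kernel:
  fixes y :: "nat \<Rightarrow> complex"
  assumes "finite A" and zero: "\<And>l. l < card A \<Longrightarrow> (\<Sum>r\<in>A. of_nat r ^ l * y r) = 0" and "r \<in> A"
  shows "y r = 0"
proof -
  define p :: "complex poly" where "p = (\<Prod>r'\<in>A - {r}. [:- of_nat r', 1:])"
  have "degree p \<le> (\<Sum>r'\<in>A - {r}. degree [:- of_nat r', 1 :: complex:])"
    unfolding p_def using degree_prod_sum_le[of "A - {r}" "\<lambda>r'. [:- of_nat r', 1 :: complex:]"] assms(1)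
    by (simp add: o_def)
  also have "\<dots> < card A"
    using assms(1,3) card_Diff1_less[of A r] by simp
  finally have deg: "degree p < card A" .
  have "(\<Sum>r'\<in>A. poly p (of_nat r') * y r') =
      (\<Sum>l\<le>degree p. coeff p l * (\<Sum>r'\<in>A. of_nat r' ^ l * y r'))"
    unfolding poly_altdef sum_distrib_right sum_distrib_left by (subst sum.swap) (simp add: mult_ac)
  also have "\<dots> = 0"
    using deg by (intro sum.neutral) (auto simp: zero)
  also have "(\<Sum>r'\<in>A. poly p (of_nat r') * y r') = (\<Sum>r'\<in>A. if r' = r then poly p (of_nat r) * y r else 0)"
    using assms(1) by (intro sum.cong refl) (auto simp: p_def poly_prod)
  finally have "poly p (of_nat r) * y r = 0"
    using assms(1,3) by simp
  moreover have "poly p (of_nat r) \<noteq> 0"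
    using assms(1) by (auto simp: p_def poly_prod)
  ultimately show ?thesis by simp
qed

text \<open>Backward induction on the phase. The \<open>q - J\<close> symbols of a slot serving
  \<open>U\<close> are found from \<open>q - J\<close> equations: the observation of
  \<open>k\<close> and those of the \<open>q - Suc J\<close> users outside \<open>U\<close>. For
  such a user \<open>r\<close>, the set \<open>insert r U\<close> contains \<open>k\<close>, so its
  symbols of the next phase vanish by induction. In these combinations the summand of
  \<open>k\<close> is an observation of \<open>k\<close> itself, hence zero; \<open>Suc J\<close>
  unknown summands remain in \<open>Suc J\<close> Vandermonde equations. In the last phase no user
  is outside \<open>U\<close>.\<close>

lemma mat_symbol_zero:
  assumes k: "k < q"
    and kernel: "\<And>s R w a. \<lbrakk>s \<in> mat_slots q; R \<subseteq> {..<q};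
      \<And>r. r \<in> R \<Longrightarrow> (\<Sum>a<card R. H (g s, r, a) * w a) = 0; a < card R\<rbrakk> \<Longrightarrow> w a = 0"
    and heard: "\<And>J U \<rho>. (J, U, \<rho>) \<in> mat_slots q \<Longrightarrow> mat_heard q g H u J U \<rho> k = 0"
    and "J < q" "k \<in> U" "U \<subseteq> {..<q}" "card U = Suc J" "i < mat_reps q J * (q - J)"
  shows "mat_symbol q g H u J U i = 0"
  using assms(4-)
proof (induction "q - J" arbitrary: J U i rule: less_induct)
  case less
  have fin: "finite U" using less.prems(3) finite_subset by blast
  define \<rho> a where "\<rho> = i div (q - J)" and "a = i mod (q - J)"
  have \<rho>: "\<rho> < mat_reps q J" and a: "a < q - J"
    using less.prems by (auto simp: \<rho>_def a_def less_mult_imp_div_less)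
  have i: "i = \<rho> * (q - J) + a"
    unfolding \<rho>_def a_def by (rule div_mult_mod_eq[symmetric])
  have s: "(J, U, \<rho>) \<in> mat_slots q"
    using less.prems \<rho> by (auto simp: mat_slots_def)
  define R where "R = insert k ({..<q} - U)"
  have R: "R \<subseteq> {..<q}" "card R = q - J"
    using less.prems k fin by (auto simp: R_def card_insert_if card_Diff_subset)
  have "mat_heard q g H u J U \<rho> r = 0" if "r \<in> R" for r
  proof (cases "r = k")
    case True
    then show ?thesis using heard[OF s] by simp
  next
    case False
    then have r: "r < q" "r \<notin> U" using that by (auto simp: R_def)
    define U' where "U' = insert r U"
    have U': "U' \<subseteq> {..<q}" "card U' = Suc (Suc J)" "k \<in> U'" "finite U'" "r \<in> U'"
      using less.prems r fin by (auto simp: U'_def)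
    then have J: "Suc J < q"
      using card_mono[OF _ U'(1)] by simp
    have slot: "(J, U' - {r'}, \<rho>) \<in> mat_slots q" if "r' \<in> U'" for r'
      using that U' \<rho> less.prems(1) by (auto simp: mat_slots_def card_Diff_singleton)
    have "(\<Sum>r'\<in>U' - {k}. of_nat r' ^ l * mat_heard q g H u J (U' - {r'}) \<rho> r') = 0"
      if l: "l < card (U' - {k})" for l
    proof -
      have l': "l < Suc J" using l U' by (simp add: card_Diff_singleton)
      have div: "(\<rho> * Suc J + l) div Suc J = \<rho>" "(\<rho> * Suc J + l) mod Suc J = l"
        using l' by (simp_all only: div_mult_self3 mod_mult_self3 div_less mod_less)
      have "mat_symbol q g H u (Suc J) U' (\<rho> * Suc J + l) = 0"
        using U' J mat_index_less[OF \<rho> l'] by (intro less.hyps) (auto simp: mat_reps_Suc[OF J] simp del: mult_Suc_right)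
      then have "0 = (\<Sum>r'\<in>U'. of_nat r' ^ l * mat_heard q g H u J (U' - {r'}) \<rho> r')"
        unfolding mat_symbol_Suc div by simp
      also have "\<dots> = (\<Sum>r'\<in>U' - {k}. of_nat r' ^ l * mat_heard q g H u J (U' - {r'}) \<rho> r')"
        using U' heard[OF slot] by (subst sum.remove[of _ k]) auto
      finally show ?thesis by simp
    qed
    moreover have "finite (U' - {k})" "r \<in> U' - {k}"
      using U' False by simp_all
    ultimately have "mat_heard q g H u J (U' - {r}) \<rho> r = 0"
      using vandermonde_kernel[of "U' - {k}" "\<lambda>r'. mat_heard q g H u J (U' - {r'}) \<rho> r'" r] by blast
    moreover have "U' - {r} = U" using r by (auto simp: U'_def)
    ultimately show ?thesis by simp
  qed
  then have "\<And>r. r \<in> R \<Longrightarrow> (\<Sum>a<card R. H (g (J, U, \<rho>), r, a) * mat_symbol q g H u J U (\<rho> * (q - J) + a)) = 0"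
    by (simp add: mat_heard_def R)
  from kernel[OF s R(1) this, of a] show ?case
    using a R by (simp add: i)
qed

text \<open>With \<open>q * fact q\<close> data symbols this amounts to \<open>q / harm q\<close>
  symbols per slot, which is \<open>dof_outdated\<close> for \<open>q = K - 1\<close>.\<close>

lemma card_mat_slots: "real (card (mat_slots q)) = fact q * harm q"
proof -
  have "real (card (mat_slots q)) = (\<Sum>J<q. real ((q choose Suc J) * mat_reps q J))"
    unfolding mat_slots_def
    by (subst card_SigmaI) (auto simp: card_cartesian_product n_subsets)
  also have "\<dots> = (\<Sum>J<q. fact q * inverse (real (Suc J)))"
  proof (intro sum.cong refl)
    fix J assume "J \<in> {..<q}"
    then have J: "Suc J \<le> q" by simp
    have "(q choose Suc J) * mat_reps q J * Suc J = fact (Suc J) * fact (q - Suc J) * (q choose Suc J)"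
      by (simp add: mat_reps_def algebra_simps)
    also have "\<dots> = fact q" by (rule binomial_fact_lemma[OF J])
    finally have "real ((q choose Suc J) * mat_reps q J) * real (Suc J) = fact q"
      by (metis of_nat_fact of_nat_mult)
    then show "real ((q choose Suc J) * mat_reps q J) = fact q * inverse (real (Suc J))"
      by (simp add: field_simps)
  qed
  also have "\<dots> = fact q * (\<Sum>J<q. inverse (real (Suc J)))"
    by (simp add: sum_distrib_left)
  also have "(\<Sum>J<q. inverse (real (Suc J))) = harm q"
    unfolding harm_def by (rule sum.reindex_bij_witness[of _ "\<lambda>k. k - 1" Suc]) auto
  finally show ?thesis .
qed

text \<open>Sending the slots in the order of their phases makes every coefficient depend on earlier
  slots only.\<close>

lemma mat_slots_enumeration:
  obtains f where "bij_betw f {..<card (mat_slots q)} (mat_slots q)"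
    and "\<And>t t'. t \<le> t' \<Longrightarrow> t' < card (mat_slots q) \<Longrightarrow> fst (f t) \<le> fst (f t')"
proof -
  obtain xs where xs: "set xs = mat_slots q" "distinct xs"
    using finite_distinct_list[OF finite_mat_slots] by blast
  define ys where "ys = sort_key fst xs"
  have ys: "set ys = mat_slots q" "distinct ys" "sorted (map fst ys)"
    using xs by (auto simp: ys_def)
  have len: "length ys = card (mat_slots q)"
    using ys distinct_card by metis
  show ?thesis
  proof (rule that[of "\<lambda>t. ys ! t"])
    show "bij_betw (\<lambda>t. ys ! t) {..<card (mat_slots q)} (mat_slots q)"
      using bij_betw_nth[OF ys(2) _ ys(1)[symmetric]] len by simp
    fix t t' assume "t \<le> t'" "t' < card (mat_slots q)"
    then show "fst (ys ! t) \<le> fst (ys ! t')"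
      using sorted_nth_mono[OF ys(3)] len by fastforce
  qed
qed

definition mat_coeff ::
  "nat \<Rightarrow> (nat \<times> nat set \<times> nat \<Rightarrow> nat) \<Rightarrow> (nat \<Rightarrow> nat \<times> nat set \<times> nat) \<Rightarrow> nat \<Rightarrow> nat \<Rightarrow> nat \<times> nat \<Rightarrow> fading \<Rightarrow> complex" where
  "mat_coeff q g f t i s H = (case f t of (J, U, \<rho>) \<Rightarrow>
     if i < q - J then mat_symbol q g H (\<lambda>s'. if s' = s then 1 else 0) J U (\<rho> * (q - J) + i) else 0)"

text \<open>These are the minors with rows \<open>R\<close> and the first \<open>card R\<close>
  antennas, as required for solving a slot of the outdated scheme. The channel exhibited for each of
  them makes the submatrix the identity.\<close>

lemma (in diffuse) AE_minors_nonzero: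
  fixes n :: nat
  shows "AE H in fading_space K D. \<forall>t<n. \<forall>R w a. R \<subseteq> {..<K - 1} \<longrightarrow>
    (\<forall>r\<in>R. (\<Sum>a<card R. H (t, r, a) * w a) = 0) \<longrightarrow> a < card R \<longrightarrow> w a = 0"
proof -
  let ?m = "\<lambda>t R H. Determinant.det (mat (card R) (card R) (\<lambda>(b, a). H (t, sorted_list_of_set R ! b, a)))"
  have "AE H in fading_space K D. ?m t R H \<noteq> 0" if R: "R \<subseteq> {..<K - 1}" for t R
  proof (rule AE_fading_polyfun_nonzero)
    have fin: "finite R" using R finite_subset by blast
    have cR: "card R \<le> K - 1" using card_mono[OF _ R] by simp
    have mem: "sorted_list_of_set R ! b \<in> R" if "b < card R" for b
      using that fin by (metis nth_mem length_sorted_list_of_set set_sorted_list_of_set)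
    show "polyfun (csi_index K UNIV) (?m t R)"
    proof (intro polyfun_det polyfun.coord)
      fix b a assume "b < card R" "a < card R"
      then show "(t, sorted_list_of_set R ! b, a) \<in> csi_index K UNIV"
        using cR mem[of b] R by (auto simp: csi_index_def)
    qed
    let ?H = "\<lambda>(t, r, a). if r = sorted_list_of_set R ! a then 1 else 0 :: complex"
    have "mat (card R) (card R) (\<lambda>(b, a). ?H (t, sorted_list_of_set R ! b, a)) = 1\<^sub>m (card R)"
      using fin by (intro eq_matI) (auto simp: nth_eq_iff_index_eq)
    then have "?m t R ?H = 1" by (simp only: det_one)
    then show "?m t R ?H \<noteq> 0" by (simp only: one_neq_zero not_False_eq_True)
  qed
  then have "AE H in fading_space K D. \<forall>(t, R)\<in>{..<n} \<times> Pow {..<K - 1}. ?m t R H \<noteq> 0"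
    by (intro AE_finite_allI) auto
  then show ?thesis
  proof eventually_elim
    case (elim H)
    show ?case
    proof (intro allI impI)
      fix t R w a
      assume t: "t < n" and R: "R \<subseteq> {..<K - 1}" and w: "\<forall>r\<in>R. (\<Sum>a<card R. H (t, r, a) * w a) = 0"
        and a: "a < card R"
      have fin: "finite R" using R finite_subset by blast
      have "sorted_list_of_set R ! b \<in> R" if "b < card R" for b
        using that fin by (metis nth_mem length_sorted_list_of_set set_sorted_list_of_set)
      then have "\<forall>b<card R. (\<Sum>a<card R. H (t, sorted_list_of_set R ! b, a) * w a) = 0"
        using w by blast
      moreover have "?m t R H \<noteq> 0" using elim t R by auto
      ultimately show "w a = 0"
        using a unfolding det_nonzero_iff_trivial_kernel by blast
    qed
  qed
qed

text \<open>The last user gets no symbols: only as many users as there are antennas are served. Slot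
  \<open>t\<close> relies on strictly earlier blocks.\<close>

lemma (in diffuse) linear_scheme_mat:
  assumes "2 \<le> K"
  shows "\<exists>v. linear_scheme K D (\<lambda>t. {..<t}) id (card (mat_slots (K - 1)))
    ({..<K - 1} \<times> {..<fact (K - 1) :: nat}) fst v"
proof -
  define q where "q = K - 1"
  let ?T = "card (mat_slots q)"
  let ?S = "{..<q} \<times> {..<fact q :: nat}"
  obtain f where f: "bij_betw f {..<?T} (mat_slots q)"
    and mono: "\<And>t t'. t \<le> t' \<Longrightarrow> t' < ?T \<Longrightarrow> fst (f t) \<le> fst (f t')"
    using mat_slots_enumeration by blast
  define g where "g = the_inv_into {..<?T} f"
  have gf: "g (f t) = t" if "t < ?T" for t
    unfolding g_def using f that by (intro the_inv_into_f_f) (auto simp: bij_betw_def)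
  have fg: "f (g s) = s" and g_less: "g s < ?T" if "s \<in> mat_slots q" for s
    using f that f_the_inv_into_f_bij_betw[OF f] bij_betwE[OF bij_betw_the_inv_into[OF f]]
    by (auto simp: g_def)
  have slot: "f t \<in> mat_slots q" if "t < ?T" for t
    using f that bij_betwE by fastforce
  have "linear_scheme K D (\<lambda>t. {..<t}) id ?T ?S fst (mat_coeff q g f)"
  proof
    fix t i s assume t: "t < ?T" and i: "i < K - 1" and "s \<in> ?S"
    obtain J U \<rho> where ft: "f t = (J, U, \<rho>)" by (cases "f t") auto
    have sl: "U \<subseteq> {..<q}" "card U = Suc J" "\<rho> < mat_reps q J"
      using slot[OF t] by (auto simp: ft mat_slots_def)
    have "polyfun (csi_index K {..<t}) (\<lambda>H. mat_symbol q g H (\<lambda>s'. if s' = s then 1 else 0) J U (\<rho> * (q - J) + i))"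
      if "i < q - J"
    proof (rule polyfun_mono[OF polyfun_mat_symbol[OF sl(1,2) mat_index_less[OF sl(3) that]]])
      have "g s' < t" if "s' \<in> mat_slots q" "fst s' < J" for s'
        using mono[of t "g s'"] g_less[OF that(1)] fg[OF that(1)] that(2) ft by (cases "t \<le> g s'") auto
      then show "(\<lambda>(s, r, a). (g s, r, a)) ` ((mat_slots q \<inter> {s. fst s < J}) \<times> {..<q} \<times> {..<q})
          \<subseteq> csi_index K {..<t}"
        by (auto simp: csi_index_def q_def)
    qed
    then have *: "polyfun (csi_index K {..<t}) (mat_coeff q g f t i s)"
      by (cases "i < q - J") (simp_all add: mat_coeff_def[abs_def] ft polyfun.const)
    show "mat_coeff q g f t i s \<in> borel_measurable (PiM UNIV (\<lambda>_. borel))"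
      by (rule polyfun_measurable_UNIV[OF *])
    show "mat_coeff q g f t i s H = mat_coeff q g f t i s H'"
      if "\<And>x. x \<in> csi_index K {..<t} \<Longrightarrow> H x = H' x" for H H'
      by (rule polyfun_cong_on[OF *]) (rule that)
  next
    have noiseless: "noiseless K id ?S (mat_coeff q g f) k t u H =
        mat_heard q g H (\<lambda>s. if s \<in> ?S then u s else 0) J U \<rho> k"
      if t: "t < ?T" and ft: "f t = (J, U, \<rho>)" for k t u H J U \<rho>
    proof -
      have "precoded ?S (mat_coeff q g f) t i u H =
          (if i < q - J then mat_symbol q g H (\<lambda>s. if s \<in> ?S then u s else 0) J U (\<rho> * (q - J) + i) else 0)" for i
        by (simp add: precoded_def mat_coeff_def ft mat_symbol_linear)
      then have "noiseless K id ?S (mat_coeff q g f) k t u H = (\<Sum>i<q. if i < q - J then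
          H (t, k, i) * mat_symbol q g H (\<lambda>s. if s \<in> ?S then u s else 0) J U (\<rho> * (q - J) + i) else 0)"
        unfolding noiseless_def q_def by (intro sum.cong) auto
      also have "\<dots> = (\<Sum>i<q - J. H (t, k, i) * mat_symbol q g H (\<lambda>s. if s \<in> ?S then u s else 0) J U (\<rho> * (q - J) + i))"
        by (rule sum.mono_neutral_cong_right) auto
      finally show ?thesis
        using gf[OF t] by (simp add: mat_heard_def ft)
    qed
    show "AE H in fading_space K D. \<forall>k<K. \<forall>u.
        (\<forall>t<?T. noiseless K id ?S (mat_coeff q g f) k t u H = 0) \<longrightarrow> (\<forall>s\<in>?S. fst s = k \<longrightarrow> u s = 0)"
      using AE_minors_nonzero[where K = K and n = ?T]
    proof eventually_elim
      case (elim H)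
      show ?case
      proof (intro allI impI ballI)
        fix k u s assume u: "\<forall>t<?T. noiseless K id ?S (mat_coeff q g f) k t u H = 0"
          and s: "s \<in> ?S" "fst s = k"
        let ?u = "\<lambda>s. if s \<in> ?S then u s else 0"
        have q: "0 < q" using assms by (simp add: q_def)
        have k: "k < q" using s by auto
        have "mat_symbol q g H ?u 0 {k} (snd s) = 0"
        proof (rule mat_symbol_zero[OF k])
          fix s R w a
          assume "s \<in> mat_slots q" "R \<subseteq> {..<q}" "\<And>r. r \<in> R \<Longrightarrow> (\<Sum>a<card R. H (g s, r, a) * w a) = 0" "a < card R"
          moreover from \<open>s \<in> mat_slots q\<close> have "R \<subseteq> {..<K - 1} \<longrightarrow>
              (\<forall>r\<in>R. (\<Sum>a<card R. H (g s, r, a) * w a) = 0) \<longrightarrow> a < card R \<longrightarrow> w a = 0"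
            using elim g_less by blast
          ultimately show "w a = 0" by (simp add: q_def)
        next
          fix J U \<rho> assume s: "(J, U, \<rho>) \<in> mat_slots q"
          show "mat_heard q g H ?u J U \<rho> k = 0"
            using noiseless[OF g_less[OF s] fg[OF s]] u g_less[OF s] by metis
        next
          \<comment> \<open>In phase \<open>0\<close> a user's \<open>fact q\<close> symbols are
            spread over \<open>fact (q - 1)\<close> repetitions with \<open>q\<close> antennas
            each.\<close>
          have "fact q = fact (q - 1) * q"
            using q fact_reduce[of q, where 'a = nat] by (simp add: mult.commute)
          then show "snd s < mat_reps q 0 * (q - 0)"
            using s by (auto simp: mat_reps_def)
        qed (use q k in auto)
        then show "u s = 0" using s by (cases s) auto
      qed
    qed
  qed (auto simp: q_def)
  then show ?thesis by (intro exI[of _ "mat_coeff q g f"]) (simp add: q_def)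
qed

subsection \<open>Interleaving of schemes\<close>

text \<open>Presents block \<open>b j\<close> of the whole process to a scheme as its block
  \<open>j\<close>.\<close>

definition pull_back :: "(nat \<Rightarrow> nat) \<Rightarrow> fading \<Rightarrow> fading" where
  "pull_back b H = (\<lambda>(j, k, i). H (b j, k, i))"

lemma pull_back_apply [simp]: "pull_back b H (j, k, i) = H (b j, k, i)"
  by (simp add: pull_back_def)

lemma measurable_pull_back: "pull_back b \<in> measurable (PiM UNIV (\<lambda>_. borel)) (PiM UNIV (\<lambda>_. borel))"
  by (rule measurable_PiM_single') (auto simp: pull_back_def space_PiM split: prod.split)

text \<open>An i.i.d. family keeps its law under injective reindexing, so almost sure decodability
  transfers to the blocks at which a scheme is placed.\<close>

lemma distr_fading_pull_back:
  assumes "prob_space D" "inj b"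
  shows "distr (fading_space K D) (fading_space K D) (\<lambda>H. restrict (pull_back b H) (csi_index K UNIV)) = fading_space K D"
proof -
  let ?f = "\<lambda>(j, k, i). (b j, k, i) :: nat \<times> nat \<times> nat"
  have "distr (PiM (csi_index K UNIV) (\<lambda>_. D)) (PiM (csi_index K UNIV) (\<lambda>_. D))
      (\<lambda>\<omega>. \<lambda>x\<in>csi_index K UNIV. \<omega> (?f x)) = PiM (csi_index K UNIV) (\<lambda>_. D)"
    using assms by (intro distr_PiM_reindex) (auto simp: inj_on_def csi_index_def)
  moreover have "(\<lambda>x. \<omega> (?f x)) = pull_back b \<omega>" for \<omega> :: fading
    by (auto simp: pull_back_def)
  ultimately show ?thesis by (simp add: fading_space_def)
qed

lemma measurable_restrict_pull_back:
  "(\<lambda>H. restrict (pull_back b H) (csi_index K UNIV)) \<in> measurable (fading_space K D) (fading_space K D)"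
  unfolding fading_space_def
  by (rule measurable_restrict) (auto simp: pull_back_def csi_index_def intro!: measurable_component_singleton)

lemma AE_fading_pull_back:
  assumes "prob_space D" "inj b" "AE H in fading_space K D. P H"
  shows "AE H in fading_space K D. P (restrict (pull_back b H) (csi_index K UNIV))"
  by (rule AE_distrD[OF measurable_restrict_pull_back[of b K D]])
     (unfold distr_fading_pull_back[OF assms(1,2)], rule assms(3))

context linear_scheme
begin

lemma precoded_cong:
  assumes "t < n" "i < K - 1" "\<And>x. x \<in> csi_index K (kn t) \<Longrightarrow> H x = H' x"
  shows "precoded S v t i u H = precoded S v t i u H'"
  unfolding precoded_def using assms by (intro sum.cong arg_cong2[where f = "(*)"] refl causal) auto

lemma noiseless_cong:
  assumes "t < n" "k < K" "\<And>x. x \<in> csi_index K (kn t) \<Longrightarrow> H x = H' x"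
    and "\<And>i. i < K - 1 \<Longrightarrow> H (ch t, k, i) = H' (ch t, k, i)"
  shows "noiseless K ch S v k t u H = noiseless K ch S v k t u H'"
  unfolding noiseless_def using assms
  by (intro sum.cong arg_cong2[where f = "(*)"] refl precoded_cong) auto

end

text \<open>Slot \<open>j\<close> of the group \<open>e\<close> becomes slot \<open>pos e j\<close>
  of block \<open>blk e j\<close>. Groups never share a slot, so their signals do not mix, and
  \<open>known\<close> expresses that the required feedback has arrived. Injectivity of
  \<open>blk e\<close> is demanded on all numbers because the whole fading process is
  reindexed.\<close>

lemma linear_scheme_interleave:
  fixes E :: "'e set" and S :: "'e \<Rightarrow> 'a set" and D :: "complex measure"
  assumes D: "prob_space D"
    and E: "finite E"
    and schemes: "\<And>e. e \<in> E \<Longrightarrow> linear_scheme K D (kn e) id (len e) (S e) (own e) (v e)"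
    and pos: "\<And>e j. e \<in> E \<Longrightarrow> j < len e \<Longrightarrow> pos e j < Tc"
    and blk: "\<And>e j. e \<in> E \<Longrightarrow> j < len e \<Longrightarrow> blk e j < L"
    and inj_blk: "\<And>e. e \<in> E \<Longrightarrow> inj (blk e)"
    and inj: "\<And>e e' j j'. \<lbrakk>e \<in> E; e' \<in> E; j < len e; j' < len e'; blk e j = blk e' j'; pos e j = pos e' j'\<rbrakk>
      \<Longrightarrow> e = e' \<and> j = j'"
    and known: "\<And>e j j'. \<lbrakk>e \<in> E; j < len e; j' \<in> kn e j\<rbrakk> \<Longrightarrow> blk e j' * Tc + Tfb \<le> blk e j * Tc + pos e j"
  shows "\<exists>w. linear_scheme K D (\<lambda>t. {b. b * Tc + Tfb \<le> t}) (\<lambda>t. t div Tc) (L * Tc)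
    (SIGMA e:E. S e) (\<lambda>(e, s). own e s) w"
proof -
  define slot where "slot e j = blk e j * Tc + pos e j" for e j
  \<comment> \<open>At most one \<open>j\<close> contributes; the empty sum keeps the group silent
    in all other slots.\<close>
  define w where "w t i x H = (case x of (e, s) \<Rightarrow>
    \<Sum>j | j < len e \<and> slot e j = t. v e j i s (pull_back (blk e) H))" for t i x H
  let ?S = "SIGMA e:E. S e"
  have "linear_scheme K D (\<lambda>t. {b. b * Tc + Tfb \<le> t}) (\<lambda>t. t div Tc) (L * Tc) ?S (\<lambda>(e, s). own e s) w"
  proof
    show "finite ?S"
      using E schemes by (intro finite_SigmaI) (auto dest: linear_scheme.finite_symbols)
    show "(\<lambda>(e, s). own e s) x < K" if "x \<in> ?S" for x
      using that schemes by (auto dest: linear_scheme.own_less)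
    fix t i x assume t: "t < L * Tc" and i: "i < K - 1" and "x \<in> ?S"
    then obtain e s where x: "x = (e, s)" and e: "e \<in> E" and s: "s \<in> S e" by auto
    interpret linear_scheme K D "kn e" id "len e" "S e" "own e" "v e" by (rule schemes[OF e])
    show "w t i x \<in> borel_measurable (PiM UNIV (\<lambda>_. borel))"
      unfolding w_def[abs_def] x prod.case
      by (intro borel_measurable_sum measurable_compose[OF measurable_pull_back measurable_coeff] i s) simp
    show "w t i x H = w t i x H'"
      if eq: "\<And>x. x \<in> csi_index K {b. b * Tc + Tfb \<le> t} \<Longrightarrow> H x = H' x" for H H'
      unfolding w_def x prod.case
    proof (intro sum.cong refl)
      fix j assume "j \<in> {j. j < len e \<and> slot e j = t}"
      then have j: "j < len e" "blk e j * Tc + pos e j = t" by (auto simp: slot_def)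
      show "v e j i s (pull_back (blk e) H) = v e j i s (pull_back (blk e) H')"
      proof (rule causal[OF j(1) i s])
        fix y assume "y \<in> csi_index K (kn e j)"
        then show "pull_back (blk e) H y = pull_back (blk e) H' y"
          using known[OF e j(1)] j(2) by (auto simp: csi_index_def intro!: eq)
      qed
    qed
  next
    have slot: "slot e j < L * Tc" "slot e j div Tc = blk e j" if "e \<in> E" "j < len e" for e j
    proof -
      show "slot e j < L * Tc"
        unfolding slot_def by (rule mat_index_less[OF blk pos]) fact+
      show "slot e j div Tc = blk e j"
        using pos[OF that] by (simp add: slot_def)
    qed
    have slot_inj: "e = e' \<and> j = j'" if "e \<in> E" "e' \<in> E" "j < len e" "j' < len e'" "slot e j = slot e' j'" for e e' j j'
    proof (rule inj[OF that(1-4)])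
      show "blk e j = blk e' j'" using slot(2) that by metis
      then show "pos e j = pos e' j'" using that(5) by (simp add: slot_def)
    qed
    have noiseless_w: "noiseless K (\<lambda>t. t div Tc) ?S w k (slot e j) u H =
        noiseless K id (S e) (v e) k j (\<lambda>s. u (e, s)) (restrict (pull_back (blk e) H) (csi_index K UNIV))"
      if e: "e \<in> E" and j: "j < len e" and k: "k < K" for e j k u H
    proof -
      interpret linear_scheme K D "kn e" id "len e" "S e" "own e" "v e" by (rule schemes[OF e])
      have "precoded ?S w (slot e j) i u H = precoded (S e) (v e) j i (\<lambda>s. u (e, s)) (pull_back (blk e) H)" for i
      proof -
        have "precoded ?S w (slot e j) i u H = (\<Sum>e'\<in>E. \<Sum>s\<in>S e'. w (slot e j) i (e', s) H * u (e', s))"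
          unfolding precoded_def using E schemes
          by (subst sum.Sigma) (auto dest: linear_scheme.finite_symbols simp: case_prod_beta)
        also have "\<dots> = (\<Sum>e'\<in>E. if e' = e then \<Sum>s\<in>S e. v e j i s (pull_back (blk e) H) * u (e, s) else 0)"
        proof (intro sum.cong refl)
          fix e' assume e': "e' \<in> E"
          have "{j'. j' < len e' \<and> slot e' j' = slot e j} = (if e' = e then {j} else {})"
            using slot_inj[OF e e' j] slot_inj[OF e' e _ j] e j by auto
          then show "(\<Sum>s\<in>S e'. w (slot e j) i (e', s) H * u (e', s)) =
              (if e' = e then \<Sum>s\<in>S e. v e j i s (pull_back (blk e) H) * u (e, s) else 0)"
            by (simp add: w_def)
        qed
        finally show ?thesis using e E by (simp add: precoded_def)
      qed
      then have "noiseless K (\<lambda>t. t div Tc) ?S w k (slot e j) u H =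
          noiseless K id (S e) (v e) k j (\<lambda>s. u (e, s)) (pull_back (blk e) H)"
        using slot(2)[OF e j] by (simp add: noiseless_def)
      also have "\<dots> = noiseless K id (S e) (v e) k j (\<lambda>s. u (e, s)) (restrict (pull_back (blk e) H) (csi_index K UNIV))"
        by (rule noiseless_cong[OF j k]) (use k in \<open>auto simp: csi_index_def\<close>)
      finally show ?thesis .
    qed
    have "AE H in fading_space K D. \<forall>e\<in>E. \<forall>k<K. \<forall>u.
        (\<forall>j<len e. noiseless K id (S e) (v e) k j u (restrict (pull_back (blk e) H) (csi_index K UNIV)) = 0) \<longrightarrow>
        (\<forall>s\<in>S e. own e s = k \<longrightarrow> u s = 0)"
      by (intro AE_finite_allI[OF E] AE_fading_pull_back[OF D inj_blk linear_scheme.decodable[OF schemes]])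
    then show "AE H in fading_space K D. \<forall>k<K. \<forall>u.
        (\<forall>t<L * Tc. noiseless K (\<lambda>t. t div Tc) ?S w k t u H = 0) \<longrightarrow>
        (\<forall>x\<in>?S. (\<lambda>(e, s). own e s) x = k \<longrightarrow> u x = 0)"
    proof eventually_elim
      case (elim H)
      show ?case
      proof (intro allI impI ballI)
        fix k u x assume k: "k < K" and u: "\<forall>t<L * Tc. noiseless K (\<lambda>t. t div Tc) ?S w k t u H = 0"
          and x: "x \<in> ?S" "(\<lambda>(e, s). own e s) x = k"
        obtain e s where es: "x = (e, s)" "e \<in> E" "s \<in> S e" "own e s = k" using x by auto
        have "\<forall>j<len e. noiseless K id (S e) (v e) k j (\<lambda>s. u (e, s)) (restrict (pull_back (blk e) H) (csi_index K UNIV)) = 0"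
          using u slot(1)[OF es(2)] noiseless_w[OF es(2) _ k] by metis
        with elim es k show "u x = 0" by blast
      qed
    qed
  qed
  then show ?thesis by blast
qed

text \<open>Place \<open>A\<close> inside \<open>C\<close> first; \<open>B\<close> has no constraint
  and takes any of the remaining places.\<close>

lemma ex_inj_into_prescribed:
  assumes fin: "finite A" "finite B" "finite P" and "A \<inter> B = {}" "C \<subseteq> P" "card A \<le> card C"
    and "card A + card B \<le> card P"
  shows "\<exists>p. inj_on p (A \<union> B) \<and> p ` (A \<union> B) \<subseteq> P \<and> p ` A \<subseteq> C"
proof -
  obtain X where X: "X \<subseteq> C" "card X = card A"
    by (rule obtain_subset_with_card_n[OF assms(6)])
  have finX: "finite X"
    using finite_subset[OF subset_trans[OF X(1) assms(5)] fin(3)] .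
  obtain f where f: "bij_betw f A X"
    using finite_same_card_bij[OF fin(1) finX] X by auto
  have "card (P - X) = card P - card A"
    using X assms(5) finX by (subst card_Diff_subset) auto
  then have "card B \<le> card (P - X)" using assms(7) by simp
  then obtain g where g: "inj_on g B" "g ` B \<subseteq> P - X"
    using card_le_inj[OF fin(2), of "P - X"] fin(3) by auto
  define p where "p x = (if x \<in> A then f x else g x)" for x
  have "inj_on p (A \<union> B)"
    using f g assms(4) by (auto simp: p_def inj_on_def bij_betw_def)
  moreover have "p ` (A \<union> B) \<subseteq> P" "p ` A \<subseteq> C"
    using f g assms(4,5) X by (auto simp: p_def bij_betw_def)
  ultimately show ?thesis by blast
qed

text \<open>One hyperblock of \<open>K (K - 1) T\<close> blocks, where \<open>T\<close> is the number of slots of the second scheme,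
  is a period for which the numbers of groups are integral. Slot \<open>j\<close> of a group is
  delayed by \<open>j (Tfb + 1)\<close> hyperblocks, after which the feedback of the earlier slots has arrived.\<close>

lemma (in diffuse) ex_periodic_scheme:
  fixes K Tc Tfb n :: nat
  assumes K: "2 \<le> K" and Tc: "1 \<le> Tc"
  defines "T \<equiv> card (mat_slots (K - 1))"
  defines "a \<equiv> min ((K - 1) * Tc) (K * (Tc - Tfb))"
  defines "M \<equiv> K * (K - 1) * T"
  defines "L \<equiv> (n + (K + T) * Suc Tfb) * M"
  shows "\<exists>(S :: ((nat \<times> nat) \<times> nat \<times> nat) set) own w.
    linear_scheme K D (\<lambda>t. {b. b * Tc + Tfb \<le> t}) (\<lambda>t. t div Tc) (L * Tc) S own w \<and>
    card S = n * (a * T * (K * (K - 1)) + (K * (K - 1) * Tc - K * a) * ((K - 1) * fact (K - 1)))"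
proof -
  define q where "q = K - 1"
  have q: "0 < q" "K = Suc q" using K by (auto simp: q_def)
  \<comment> \<open>Numbers of groups started per hyperblock: \<open>A\<close> of the alignment
    scheme, \<open>B\<close> of the outdated one. They use \<open>A * K + B * T = M * Tc\<close>
    slots, that is, all of them, and the \<open>A * (K - 1)\<close> slots that need current CSI are
    at most the \<open>M * (Tc - Tfb)\<close> available ones.\<close>
  define A where "A = a * T"
  define B where "B = K * q * Tc - K * a"
  have "real T = fact q * harm q" by (simp add: T_def q_def card_mat_slots)
  also have "\<dots> > 0" using q by (simp add: harm_pos)
  finally have T: "0 < T" by simp
  have M: "0 < M" using T K by (simp add: M_def)
  have "\<exists>v. linear_scheme K D (\<lambda>t. {..<t}) id T ({..<q} \<times> {..<fact q :: nat}) fst v"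
    unfolding T_def q_def by (rule linear_scheme_mat[OF K])
  then obtain vm where vm: "linear_scheme K D (\<lambda>t. {..<t}) id T ({..<q} \<times> {..<fact q :: nat}) fst vm"
    by blast
  define len where "len e = (if e < A then K else T)" for e
  \<comment> \<open>\<open>I1\<close> collects the slots that need current CSI, the later slots of
    alignment groups; \<open>I2\<close> collects all others. With positions counted from 0, the
    current block is known exactly at the positions in \<open>C\<close>.\<close>
  define I1 where "I1 = {..<A} \<times> {1..<K}"
  define I2 where "I2 = {..<A} \<times> {0} \<union> {A..<A + B} \<times> {..<T}"
  define P where "P = {..<M} \<times> {..<Tc}"
  define C where "C = {..<M} \<times> {Tfb..<Tc}"
  have "\<exists>p. inj_on p (I1 \<union> I2) \<and> p ` (I1 \<union> I2) \<subseteq> P \<and> p ` I1 \<subseteq> C"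
  proof (rule ex_inj_into_prescribed)
    show "finite I1" "finite I2" "finite P" "I1 \<inter> I2 = {}" "C \<subseteq> P"
      by (auto simp: I1_def I2_def P_def C_def)
    have a: "a \<le> q * Tc" "a \<le> K * (Tc - Tfb)" by (auto simp: a_def q_def)
    have cI1: "card I1 = A * q" by (simp add: I1_def q_def)
    have "A * q \<le> K * (Tc - Tfb) * T * q"
      unfolding A_def using a(2) by (intro mult_right_mono) auto
    then show "card I1 \<le> card C" by (simp add: cI1 C_def M_def q_def mult_ac)
    have "card I2 = A + B * T"
      unfolding I2_def by (subst card_Un_disjoint) auto
    moreover have "A * q + (A + B * T) = (K * a + B) * T"
      by (simp add: A_def q(2) algebra_simps)
    moreover have "K * a + B = K * q * Tc"
      using mult_le_mono2[OF a(1), of K] by (simp add: B_def mult.assoc)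
    ultimately show "card I1 + card I2 \<le> card P"
      by (simp add: cI1 P_def M_def q_def mult_ac)
  qed
  then obtain p where p: "inj_on p (I1 \<union> I2)" "p ` (I1 \<union> I2) \<subseteq> P" "p ` I1 \<subseteq> C"
    by blast
  have I: "(e, j) \<in> I1 \<union> I2" if "e < A + B" "j < len e" for e j
    using that by (auto simp: len_def I1_def I2_def split: if_splits)
  have pP: "fst (p (e, j)) < M" "snd (p (e, j)) < Tc" if "e < A + B" "j < len e" for e j
  proof -
    have "p (e, j) \<in> P" using p(2) I[OF that] by blast
    then show "fst (p (e, j)) < M" "snd (p (e, j)) < Tc" by (auto simp: P_def mem_Times_iff)
  qed
  \<comment> \<open>The value for \<open>j\<close> beyond the length of the group only serves
    injectivity on all numbers.\<close>
  define blk where "blk = (\<lambda>(h, e) j. (h + j * Suc Tfb) * M + (if j < len e then fst (p (e, j)) else 0))"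
  define pos where "pos = (\<lambda>(h :: nat, e) j. snd (p (e, j)))"
  define E where "E = {..<n} \<times> {..<A + B}"
  define kn where "kn = (\<lambda>(h :: nat, e) j. if e < A then if j = 0 then {} else {..j} else {..<j :: nat})"
  define S where "S = (\<lambda>(h :: nat, e). if e < A then {..<K} \<times> {..<K - 1} else {..<q} \<times> {..<fact q :: nat})"
  define v where "v = (\<lambda>(h :: nat, e). if e < A then stia_coeff K else vm)"
  have blk_div: "blk (h, e) j div M = h + j * Suc Tfb" "blk (h, e) j mod M = (if j < len e then fst (p (e, j)) else 0)"
    if "e < A + B" for h e j
  proof -
    have "(if j < len e then fst (p (e, j)) else 0) < M" using pP(1)[OF that] M by simp
    then show "blk (h, e) j div M = h + j * Suc Tfb" "blk (h, e) j mod M = (if j < len e then fst (p (e, j)) else 0)"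
      by (simp_all add: blk_def)
  qed
  have "\<exists>w. linear_scheme K D (\<lambda>t. {b. b * Tc + Tfb \<le> t}) (\<lambda>t. t div Tc) (L * Tc)
    (SIGMA x:E. S x) (\<lambda>(x, s). fst s) w"
  proof (rule linear_scheme_interleave[where kn = kn and len = "\<lambda>(h, e). len e" and v = v and pos = pos and blk = blk and own = "\<lambda>_. fst"])
    show "prob_space D" by (rule prob_space_axioms)
    show "finite E" by (simp add: E_def)
    show "linear_scheme K D (kn x) id ((\<lambda>(h, e). len e) x) (S x) fst (v x)" for x
      using linear_scheme_stia[of K] vm by (cases x) (simp add: kn_def len_def S_def v_def)
    fix x assume "x \<in> E"
    then obtain h e where x: "x = (h, e)" and h: "h < n" and e: "e < A + B" by (auto simp: E_def)
    show "inj (blk x)"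
    proof (rule injI)
      fix j j' assume "blk x j = blk x j'"
      then have "h + j * Suc Tfb = h + j' * Suc Tfb" using blk_div(1)[OF e] x by metis
      then show "j = j'" by (metis add_left_cancel mult_cancel2 nat.distinct(1))
    qed
    fix j assume "j < (\<lambda>(h, e). len e) x"
    then have j: "j < len e" by (simp add: x)
    show "pos x j < Tc" using pP(2)[OF e j] by (simp add: pos_def x)
    show "blk x j < L"
    proof -
      \<comment> \<open>The last summand of the number of hyperblocks in \<open>L\<close> makes room
        for the delayed slots of the groups started last.\<close>
      have "j * Suc Tfb < (K + T) * Suc Tfb"
        using j by (intro mult_less_mono1) (auto simp: len_def split: if_splits)
      then have "h + j * Suc Tfb < n + (K + T) * Suc Tfb" using h by linarith
      then show ?thesis
        unfolding L_def x blk_def prod.case using pP(1)[OF e j] j by (intro mat_index_less) auto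
    qed
    show "blk x j' * Tc + Tfb \<le> blk x j * Tc + pos x j" if "j' \<in> kn x j" for j'
    proof (cases "j' = j")
      case True
      then have "e < A" "0 < j" using that by (auto simp: kn_def x split: if_splits)
      then have "(e, j) \<in> I1" using j by (auto simp: I1_def len_def)
      then have "p (e, j) \<in> C" using p(3) by auto
      then show ?thesis using True by (auto simp: pos_def x C_def)
    next
      case False
      then have j': "j' < j" using that by (auto simp: kn_def x split: if_splits)
      \<comment> \<open>A delay of \<open>Suc Tfb\<close> hyperblocks leaves at least
        \<open>Tfb\<close> blocks between the two slots, hence at least \<open>Tfb\<close> slots,
        whatever \<open>Tc\<close> is.\<close>
      have "blk x j' < (h + j' * Suc Tfb) * M + M"
        unfolding x blk_def prod.case using pP(1)[OF e, of j'] j j' by simp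
      also have "\<dots> + Tfb * M = (h + Suc j' * Suc Tfb) * M"
        by (simp add: algebra_simps)
      also have "\<dots> \<le> (h + j * Suc Tfb) * M"
        using j' by (intro mult_right_mono add_left_mono) auto
      also have "\<dots> \<le> blk x j" by (simp add: x blk_def)
      finally have "blk x j' + Tfb * M \<le> blk x j" by simp
      moreover have "Tfb \<le> Tfb * M" using M by simp
      ultimately have "blk x j' + Tfb \<le> blk x j" by linarith
      then have "(blk x j' + Tfb) * Tc \<le> blk x j * Tc" by (rule mult_le_mono1)
      moreover have "Tfb \<le> Tfb * Tc" using Tc by simp
      ultimately show ?thesis unfolding distrib_right by linarith
    qed
    fix x' j' assume "x' \<in> E" and j': "j' < (\<lambda>(h, e). len e) x'"
      and eq: "blk x j = blk x' j'" "pos x j = pos x' j'"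
    then obtain h' e' where x': "x' = (h', e')" and e': "e' < A + B" by (auto simp: E_def)
    have j': "j' < len e'" using j' by (simp add: x')
    have "fst (p (e, j)) = fst (p (e', j'))"
      using eq(1) blk_div(2)[OF e, of h j] blk_div(2)[OF e', of h' j'] j j' by (simp add: x x')
    moreover have "snd (p (e, j)) = snd (p (e', j'))"
      using eq(2) by (simp add: pos_def x x')
    ultimately have "p (e, j) = p (e', j')"
      by (simp add: prod_eq_iff)
    then have "(e, j) = (e', j')"
      by (rule inj_onD[OF p(1) _ I[OF e j] I[OF e' j']])
    moreover have "h + j * Suc Tfb = h' + j' * Suc Tfb"
      using eq(1) blk_div(1)[OF e, of h j] blk_div(1)[OF e', of h' j'] by (simp add: x x')
    ultimately show "x = x' \<and> j = j'" by (simp add: x x')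
  qed
  moreover have "card (SIGMA x:E. S x) = n * (A * (K * q) + B * (q * fact q))"
  proof -
    have "card (SIGMA x:E. S x) = (\<Sum>x\<in>E. card (S x))"
      by (rule card_SigmaI) (auto simp: E_def S_def)
    also have "\<dots> = (\<Sum>h<n. \<Sum>e<A + B. card (S (h, e)))"
      by (simp add: E_def sum.cartesian_product)
    also have "\<dots> = (\<Sum>h<n. A * (K * q) + B * (q * fact q))"
    proof (intro sum.cong refl)
      fix h
      have "(\<Sum>e<A + B. card (S (h, e))) = (\<Sum>e\<in>{..<A} \<union> {A..<A + B}. card (S (h, e)))"
        by (intro sum.cong) auto
      also have "\<dots> = (\<Sum>e<A. card (S (h, e))) + (\<Sum>e = A..<A + B. card (S (h, e)))"
        by (rule sum.union_disjoint) auto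
      finally show "(\<Sum>e<A + B. card (S (h, e))) = A * (K * q) + B * (q * fact q)"
        by (simp add: S_def q_def)
    qed
    finally show ?thesis by simp
  qed
  ultimately show ?thesis unfolding A_def B_def q_def by blast
qed

text \<open>\<open>x\<close> is the contribution of the alignment scheme: it runs on a fraction
  \<open>x / (K - 1)\<close> of the slots at \<open>K - 1\<close> symbols per slot, and the rest is
  served at \<open>dof_outdated\<close>. The two terms of the minimum correspond to running out of
  slots and running out of slots with current CSI. Truncated subtraction gives \<open>x = 0\<close>
  when \<open>Tfb\<close> exceeds \<open>Tc\<close>.\<close>

lemma dof_eq:
  fixes K Tc Tfb :: nat
  assumes K: "2 \<le> K" and Tc: "1 \<le> Tc"
  defines "x \<equiv> real (min ((K - 1) * Tc) (K * (Tc - Tfb))) / real Tc"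
  shows "dof K (real Tfb / real Tc) = x + (real K - 1 - x) / harm (K - 1)"
proof -
  define g where "g = real Tfb / real Tc"
  define h where "h = (harm (K - 1) :: real)"
  have h: "h > 0" unfolding h_def using K by (intro harm_pos) simp
  have K1: "real (K - 1) = real K - 1" using K by simp
  have x: "x = min (real K - 1) (real K * (real (Tc - Tfb) / real Tc))"
    using Tc by (simp add: x_def of_nat_min min_divide_distrib_right K1[simplified])
  show ?thesis
  proof (cases "Tfb \<le> Tc")
    case True
    then have x: "x = min (real K - 1) (real K * (1 - g))"
      using Tc by (simp add: x g_def of_nat_diff diff_divide_distrib)
    have g1: "g \<le> 1" using True Tc by (simp add: g_def)
    show ?thesis
    proof (cases "g \<le> 1 / real K")
      case True
      then have "real K - 1 \<le> real K * (1 - g)" using K by (simp add: field_simps)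
      then show ?thesis using True by (simp add: x dof_def flip: g_def)
    next
      case False
      then have "real K * (1 - g) \<le> real K - 1" using K by (simp add: field_simps)
      then have x: "x = real K * (1 - g)" by (simp add: x)
      have "dof_outdated K / (real K - 1) = 1 / h" "real K * dof_outdated K / (real K - 1) = real K / h"
        using K by (simp_all add: dof_outdated_def h_def)
      then have "dof K g = (- real K + real K / h) * g + real K - 1 / h"
        using False g1 by (simp add: dof_def)
      also have "\<dots> = x + (real K - 1 - x) / h"
        using h by (simp add: x field_simps)
      finally show ?thesis by (simp add: g_def h_def)
    qed
  next
    case False
    then have "\<not> g \<le> 1" "\<not> g \<le> 1 / real K"
      using Tc K order_trans[of g "1 / real K" 1] by (auto simp: g_def)
    moreover have "x = 0" using False K by (simp add: x)
    ultimately show ?thesis by (simp add: dof_def dof_outdated_def flip: g_def)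
  qed
qed

text \<open>The overhang of \<open>G\<close> hyperblocks caused by the delays does not grow with
  \<open>n\<close>, so the density \<open>n / (n + G)\<close> tends to 1.\<close>

lemma (in diffuse) ex_scheme_near_dof:
  fixes K Tc Tfb :: nat
  assumes K: "2 \<le> K" and Tc: "1 \<le> Tc" and "0 < \<epsilon>"
  shows "\<exists>L (S :: ((nat \<times> nat) \<times> nat \<times> nat) set) own w. 0 < L \<and>
    linear_scheme K D (\<lambda>t. {b. b * Tc + Tfb \<le> t}) (\<lambda>t. t div Tc) (L * Tc) S own w \<and>
    \<bar>real (card S) / real (L * Tc) - dof K (real Tfb / real Tc)\<bar> < \<epsilon>"
proof -
  define q where "q = K - 1"
  have q: "0 < q" "K = Suc q" using K by (auto simp: q_def)
  define T where "T = card (mat_slots q)"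
  define a where "a = min (q * Tc) (K * (Tc - Tfb))"
  define M where "M = K * q * T"
  define G where "G = (K + T) * Suc Tfb"
  define \<sigma> where "\<sigma> = a * T * (K * q) + (K * q * Tc - K * a) * (q * fact q)"
  have rT: "real T = fact q * harm q" by (simp add: T_def card_mat_slots)
  also have hq: "\<dots> > 0" using q by (simp add: harm_pos)
  finally have T: "0 < T" by simp
  have aux: "(a * T * (K * q) + K * (q * c - a) * (q * F)) / (K * q * T * c) = a / c + (q - a / c) * (F / T)"
    if "K \<noteq> 0" "q \<noteq> 0" "T \<noteq> 0" "c \<noteq> 0" for a T K q c F :: real
    using that by (simp add: field_simps)
  have "K * a \<le> K * (q * Tc)" unfolding a_def by (intro mult_le_mono2) simp
  then have "real (K * q * Tc - K * a) = real K * (real q * Tc - a)"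
    by (simp add: of_nat_diff mult.assoc right_diff_distrib)
  then have "real \<sigma> / real (M * Tc) =
      (real a * real T * (real K * real q) + real K * (real q * real Tc - real a) * (real q * fact q)) / (real K * real q * real T * real Tc)"
    by (simp add: \<sigma>_def M_def)
  also have "\<dots> = real a / Tc + (real q - real a / Tc) * (fact q / T)"
    using q T Tc by (intro aux) auto
  also have "fact q / real T = 1 / harm q"
    by (simp add: rT)
  finally have dof: "real \<sigma> / real (M * Tc) = dof K (real Tfb / real Tc)"
    using dof_eq[OF K Tc, of Tfb] by (simp add: a_def q_def) (use K in simp)
  have "(\<lambda>n. real n / (real n + real G)) \<longlonglongrightarrow> 1"
    by real_asymp
  then have "(\<lambda>n. real \<sigma> / real (M * Tc) * (real n / (real n + real G))) \<longlonglongrightarrow> real \<sigma> / real (M * Tc) * 1"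
    by (intro tendsto_mult tendsto_const)
  then have "\<forall>\<^sub>F n in sequentially. dist (real \<sigma> / real (M * Tc) * (real n / (real n + real G))) (real \<sigma> / real (M * Tc) * 1) < \<epsilon>"
    by (rule tendstoD) fact
  then obtain n where n: "dist (real \<sigma> / real (M * Tc) * (real n / (real n + real G))) (real \<sigma> / real (M * Tc) * 1) < \<epsilon>"
    using eventually_happens sequentially_bot by blast
  define L where "L = (n + G) * M"
  have "\<exists>(S :: ((nat \<times> nat) \<times> nat \<times> nat) set) own w.
      linear_scheme K D (\<lambda>t. {b. b * Tc + Tfb \<le> t}) (\<lambda>t. t div Tc) (L * Tc) S own w \<and> card S = n * \<sigma>"
    unfolding L_def G_def M_def \<sigma>_def a_def T_def q_def by (rule ex_periodic_scheme[OF K Tc])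
  then obtain S :: "((nat \<times> nat) \<times> nat \<times> nat) set" and own w where
    S: "linear_scheme K D (\<lambda>t. {b. b * Tc + Tfb \<le> t}) (\<lambda>t. t div Tc) (L * Tc) S own w"
    "card S = n * \<sigma>"
    by blast
  have "0 < L" using T q by (simp add: L_def G_def M_def)
  moreover have "real (card S) / real (L * Tc) = real \<sigma> / real (M * Tc) * (real n / (real n + real G))"
    by (simp add: S(2) L_def mult_ac)
  ultimately show ?thesis
    using S(1) n dof by (intro exI[of _ L] exI[of _ S] exI[of _ own] exI[of _ w]) (simp add: dist_real_def)
qed

subsection \<open>Well-conditioned channels\<close>

text \<open>A functional vanishing on the common kernel of finitely many others is a combination of
  them. The coefficients turn decodability, a kernel condition, into a quantitative bound.\<close>

lemma functional_in_span:
  fixes A :: "'i \<Rightarrow> 'a \<Rightarrow> complex"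
  assumes "finite I" and "\<And>u. (\<forall>i\<in>I. (\<Sum>s\<in>S. A i s * u s) = 0) \<Longrightarrow> (\<Sum>s\<in>S. c s * u s) = 0"
  shows "\<exists>w. \<forall>u. (\<Sum>s\<in>S. c s * u s) = (\<Sum>i\<in>I. w i * (\<Sum>s\<in>S. A i s * u s))"
  using assms
proof (induction I arbitrary: c rule: finite_induct)
  case empty
  then show ?case by simp
next
  case (insert i I)
  define \<phi> where "\<phi> c u = (\<Sum>s\<in>S. c s * u s)" for c u :: "'a \<Rightarrow> complex"
  have lin: "\<phi> (\<lambda>s. c s - r * d s) u = \<phi> c u - r * \<phi> d u" "\<phi> c (\<lambda>s. u s - r * w s) = \<phi> c u - r * \<phi> c w" for c d u w r
    by (simp_all add: \<phi>_def sum_subtractf sum_distrib_left algebra_simps)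
  show ?case
  proof (cases "\<forall>u. (\<forall>i\<in>I. \<phi> (A i) u = 0) \<longrightarrow> \<phi> (A i) u = 0")
    case True
    have "\<exists>w. \<forall>u. \<phi> c u = (\<Sum>i\<in>I. w i * \<phi> (A i) u)"
      unfolding \<phi>_def
    proof (rule insert.IH)
      fix u assume u: "\<forall>i\<in>I. (\<Sum>s\<in>S. A i s * u s) = 0"
      then have "(\<Sum>s\<in>S. A i s * u s) = 0" using True unfolding \<phi>_def by blast
      then show "(\<Sum>s\<in>S. c s * u s) = 0" using u insert.prems by blast
    qed
    then obtain w where w: "\<forall>u. \<phi> c u = (\<Sum>i\<in>I. w i * \<phi> (A i) u)" ..
    have "(\<Sum>j\<in>I. (w(i := 0)) j * \<phi> (A j) u) = (\<Sum>j\<in>I. w j * \<phi> (A j) u)" for u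
      using insert.hyps by (intro sum.cong) auto
    then show ?thesis
      using insert.hyps w unfolding \<phi>_def by (intro exI[of _ "w(i := 0)"]) simp
  next
    case False
    then obtain v0 where v0: "\<forall>i\<in>I. \<phi> (A i) v0 = 0" "\<phi> (A i) v0 \<noteq> 0" by blast
    \<comment> \<open>The functional \<open>c - r * A i\<close> vanishes at \<open>v0\<close>. Since
      any \<open>u\<close> in the kernel of the functionals in \<open>I\<close> can be moved into
      the kernel of \<open>A i\<close> along \<open>v0\<close>, the induction hypothesis applies to
      it.\<close>
    define r where "r = \<phi> c v0 / \<phi> (A i) v0"
    have "\<exists>w. \<forall>u. \<phi> (\<lambda>s. c s - r * A i s) u = (\<Sum>i\<in>I. w i * \<phi> (A i) u)"
      unfolding \<phi>_def
    proof (rule insert.IH)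
      fix u assume u: "\<forall>i\<in>I. (\<Sum>s\<in>S. A i s * u s) = 0"
      let ?u = "\<lambda>s. u s - \<phi> (A i) u / \<phi> (A i) v0 * v0 s"
      have "\<phi> (A j) ?u = 0" if "j \<in> insert i I" for j
        using that u v0 unfolding lin by (auto simp: \<phi>_def)
      then have "\<phi> c ?u = 0"
        using insert.prems[of ?u] unfolding \<phi>_def by blast
      then show "(\<Sum>s\<in>S. (c s - r * A i s) * u s) = 0"
        unfolding \<phi>_def[symmetric] lin r_def using v0(2) by (simp add: field_simps)
    qed
    then obtain w where "\<forall>u. \<phi> (\<lambda>s. c s - r * A i s) u = (\<Sum>i\<in>I. w i * \<phi> (A i) u)" ..
    then have w: "\<phi> c u = r * \<phi> (A i) u + (\<Sum>i\<in>I. w i * \<phi> (A i) u)" for u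
      unfolding lin by (simp add: algebra_simps)
    have "(\<Sum>j\<in>I. (w(i := r)) j * \<phi> (A j) u) = (\<Sum>j\<in>I. w j * \<phi> (A j) u)" for u
      using insert.hyps by (intro sum.cong) auto
    then show ?thesis
      using insert.hyps w unfolding \<phi>_def by (intro exI[of _ "w(i := r)"]) simp
  qed
qed

definition gauss_ints :: "complex set" where
  "gauss_ints = range (\<lambda>(a, b). Complex (of_int a) (of_int b))"

lemma countable_gauss_ints: "countable gauss_ints"
  by (simp add: gauss_ints_def)

lemma norm_gauss_int_ge_1:
  assumes "z \<in> gauss_ints" "z \<noteq> 0"
  shows "1 \<le> cmod z"
proof -
  obtain a b where z: "z = Complex (of_int a) (of_int b)"
    using assms(1) by (auto simp: gauss_ints_def)
  have "a\<^sup>2 + b\<^sup>2 \<noteq> 0" using assms(2) by (auto simp: z complex_eq_iff)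
  then have "1 \<le> a\<^sup>2 + b\<^sup>2"
    using zero_le_power2[of a] zero_le_power2[of b] by linarith
  then have "1 \<le> (of_int a :: real)\<^sup>2 + (of_int b)\<^sup>2"
    by (metis of_int_1 of_int_add of_int_le_iff of_int_power)
  then show ?thesis by (simp add: z cmod_def)
qed

text \<open>Outside \<open>J\<close> the points of the product are constantly
  \<open>undefined\<close>. Thus functions of total channels can be applied to partial channel
  knowledge without losing measurability.\<close>

lemma measurable_ident_UNIV:
  assumes "sets D = sets borel"
  shows "(\<lambda>H. H) \<in> measurable (PiM J (\<lambda>_. D)) (PiM UNIV (\<lambda>_. borel))"
proof (rule measurable_PiM_single')
  fix x
  show "(\<lambda>H. H x) \<in> measurable (PiM J (\<lambda>_. D)) borel"
  proof (cases "x \<in> J")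
    case True
    then show ?thesis
      using measurable_component_singleton[OF True, of "\<lambda>_. D"] measurable_cong_sets[OF refl assms] by blast
  next
    case False
    have "(\<lambda>H. undefined) \<in> measurable (PiM J (\<lambda>_. D)) borel" by simp
    then show ?thesis
      by (rule measurable_cong[THEN iffD1, rotated]) (use False in \<open>auto simp: space_PiM PiE_def extensional_def\<close>)
  qed
qed auto

context linear_scheme
begin

text \<open>The second clause covers differences of symbol vectors from grids of any size, so that
  \<open>c\<close> is independent of the power; the countability of the Gaussian integers keeps it
  measurable. The first clause is what makes clipping inactive. One constant in both makes the
  condition monotone in \<open>c\<close>.\<close>

definition well_conditioned :: "real \<Rightarrow> fading \<Rightarrow> bool" where
  "well_conditioned c H \<longleftrightarrow>
    (\<forall>t<n. \<forall>i<K - 1. \<forall>s\<in>S. cmod (v t i s H) \<le> c) \<and>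
    (\<forall>k<K. \<forall>u\<in>PiE S (\<lambda>_. gauss_ints). (\<exists>s\<in>S. own s = k \<and> u s \<noteq> 0) \<longrightarrow>
      (\<exists>t<n. 1 \<le> c * cmod (noiseless K ch S v k t u H)))"

lemma noiseless_eq: "noiseless K ch S v k t u H = (\<Sum>s\<in>S. (\<Sum>i<K - 1. H (ch t, k, i) * v t i s H) * u s)"
  unfolding noiseless_def precoded_def sum_distrib_left sum_distrib_right
  by (subst sum.swap) (simp add: mult.assoc)

lemma well_conditioned_mono:
  assumes "well_conditioned c H" "c \<le> c'"
  shows "well_conditioned c' H"
proof -
  have "1 \<le> c' * cmod z" if "1 \<le> c * cmod z" for z
    using that mult_right_mono[OF assms(2), of "cmod z"] by simp
  then show ?thesis
    using assms unfolding well_conditioned_def by (meson order_trans)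
qed

text \<open>Each own symbol is a fixed combination of the observations. A nonzero Gaussian integer
  has modulus at least 1, so not all observations can be smaller than the reciprocal of the sum of
  the weights.\<close>

lemma ex_well_conditioned:
  assumes dec: "\<forall>k<K. \<forall>u. (\<forall>t<n. noiseless K ch S v k t u H = 0) \<longrightarrow> (\<forall>s\<in>S. own s = k \<longrightarrow> u s = 0)"
  shows "\<exists>c::nat. well_conditioned (real c) H"
proof -
  have "\<exists>w. \<forall>u. u s = (\<Sum>t<n. w t * noiseless K ch S v (own s) t u H)" if s: "s \<in> S" for s
  proof -
    let ?A = "\<lambda>t s'. \<Sum>i<K - 1. H (ch t, own s, i) * v t i s' H"
    have del: "(\<Sum>s'\<in>S. (if s' = s then 1 else 0) * u s') = u s" for u :: "'a \<Rightarrow> complex"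
      using finite_symbols s by (simp add: if_distrib[where f = "\<lambda>x. x * _"] cong: if_cong)
    have "\<exists>w. \<forall>u. (\<Sum>s'\<in>S. (if s' = s then 1 else 0) * u s') = (\<Sum>t\<in>{..<n}. w t * (\<Sum>s'\<in>S. ?A t s' * u s'))"
    proof (rule functional_in_span)
      fix u assume "\<forall>t\<in>{..<n}. (\<Sum>s'\<in>S. ?A t s' * u s') = 0"
      then have "\<forall>t<n. noiseless K ch S v (own s) t u H = 0"
        by (simp add: noiseless_eq)
      then have "u s = 0" using dec own_less[OF s] s by blast
      then show "(\<Sum>s'\<in>S. (if s' = s then 1 else 0) * u s') = 0" by (simp only: del)
    qed simp
    then show ?thesis by (simp only: del noiseless_eq)
  qed
  then obtain w where w: "\<And>s u. s \<in> S \<Longrightarrow> u s = (\<Sum>t<n. w s t * noiseless K ch S v (own s) t u H)"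
    by metis
  define c where "c = (\<Sum>s\<in>S. \<Sum>t<n. cmod (w s t)) + (\<Sum>t<n. \<Sum>i<K - 1. \<Sum>s\<in>S. cmod (v t i s H))"
  have "well_conditioned c H"
    unfolding well_conditioned_def
  proof (intro conjI allI impI ballI)
    fix t i s assume *: "t < n" "i < K - 1" "s \<in> S"
    have "cmod (v t i s H) \<le> (\<Sum>s\<in>S. cmod (v t i s H))"
      using * finite_symbols by (intro member_le_sum) auto
    also have "\<dots> \<le> (\<Sum>i<K - 1. \<Sum>s\<in>S. cmod (v t i s H))"
      using * by (intro member_le_sum[where f = "\<lambda>i. \<Sum>s\<in>S. cmod (v t i s H)"]) (auto intro: sum_nonneg)
    also have "\<dots> \<le> (\<Sum>t<n. \<Sum>i<K - 1. \<Sum>s\<in>S. cmod (v t i s H))"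
      using * by (intro member_le_sum[where f = "\<lambda>t. \<Sum>i<K - 1. \<Sum>s\<in>S. cmod (v t i s H)"]) (auto intro!: sum_nonneg)
    also have "\<dots> \<le> c" by (simp add: c_def sum_nonneg)
    finally show "cmod (v t i s H) \<le> c" .
  next
    fix k u assume u: "u \<in> PiE S (\<lambda>_. gauss_ints)" and "\<exists>s\<in>S. own s = k \<and> u s \<noteq> 0"
    then obtain s where s: "s \<in> S" "own s = k" "u s \<noteq> 0" by blast
    show "\<exists>t<n. 1 \<le> c * cmod (noiseless K ch S v k t u H)"
    proof (rule ccontr)
      assume "\<not> ?thesis"
      then have less: "c * cmod (noiseless K ch S v k t u H) < 1" if "t < n" for t
        using that by force
      have c: "(\<Sum>t<n. cmod (w s t)) \<le> c"
      proof -
        have "(\<Sum>t<n. cmod (w s t)) \<le> (\<Sum>s\<in>S. \<Sum>t<n. cmod (w s t))"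
          using s finite_symbols by (intro member_le_sum[where f = "\<lambda>s. \<Sum>t<n. cmod (w s t)"]) (auto intro: sum_nonneg)
        then show ?thesis by (simp add: c_def sum_nonneg add_increasing2)
      qed
      have us: "1 \<le> cmod (u s)" using u s by (intro norm_gauss_int_ge_1) auto
      have "cmod (u s) \<le> (\<Sum>t<n. cmod (w s t) * cmod (noiseless K ch S v k t u H))"
        using s by (subst w[OF s(1)]) (auto intro!: sum_norm_le simp: norm_mult)
      moreover have "\<exists>t<n. w s t \<noteq> 0"
      proof (rule ccontr)
        assume "\<not> (\<exists>t<n. w s t \<noteq> 0)"
        then have "u s = 0" by (subst w[OF s(1)]) simp
        with s show False by simp
      qed
      then obtain t0 where t0: "t0 < n" "w s t0 \<noteq> 0" by blast
      have "0 < (\<Sum>t<n. cmod (w s t))"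
        using t0 by (intro sum_pos2[of _ t0]) auto
      then have c0: "0 < c" using c by linarith
      have "(\<Sum>t<n. cmod (w s t) * cmod (noiseless K ch S v k t u H)) < (\<Sum>t<n. cmod (w s t) * (1 / c))"
      proof (rule sum_strict_mono_ex1)
        have le: "cmod (noiseless K ch S v k t u H) < 1 / c" if "t < n" for t
          using less[OF that] c0 by (simp add: field_simps)
        then show "\<forall>t\<in>{..<n}. cmod (w s t) * cmod (noiseless K ch S v k t u H) \<le> cmod (w s t) * (1 / c)"
          by (intro ballI mult_left_mono less_imp_le[OF le]) auto
        show "\<exists>t\<in>{..<n}. cmod (w s t) * cmod (noiseless K ch S v k t u H) < cmod (w s t) * (1 / c)"
          using t0 le[OF t0(1)] by (intro bexI[of _ t0] mult_strict_left_mono) auto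
      qed simp
      also have "\<dots> = (\<Sum>t<n. cmod (w s t)) / c"
        by (simp add: sum_divide_distrib)
      also have "\<dots> \<le> 1" using c c0 by simp
      finally show False using us \<open>cmod (u s) \<le> _\<close> by linarith
    qed
  qed
  then have "well_conditioned (real (nat \<lceil>c\<rceil>)) H"
    by (rule well_conditioned_mono) (rule real_nat_ceiling_ge)
  then show ?thesis ..
qed

lemma measurable_noiseless:
  assumes "t < n"
  shows "noiseless K ch S v k t u \<in> borel_measurable (PiM UNIV (\<lambda>_. borel))"
proof -
  have [measurable]: "v t i s \<in> borel_measurable (PiM UNIV (\<lambda>_. borel))" if "i < K - 1" "s \<in> S" for i s
    using that assms by (rule measurable_coeff[rotated 1])
  show ?thesis
    unfolding noiseless_def[abs_def] precoded_def by (intro borel_measurable_sum borel_measurable_times) auto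
qed

lemma measurable_well_conditioned:
  "Measurable.pred (PiM UNIV (\<lambda>_. borel)) (well_conditioned c)"
proof -
  let ?M = "PiM UNIV (\<lambda>_. borel) :: fading measure"
  have U: "countable (PiE S (\<lambda>_. gauss_ints))"
    by (rule countable_PiE[OF finite_symbols]) (rule countable_gauss_ints)
  have [measurable]: "Measurable.pred ?M (\<lambda>H. cmod (v t i s H) \<le> c)" if "t < n" "i < K - 1" "s \<in> S" for t i s
    using measurable_coeff[OF that] by measurable
  have [measurable]: "Measurable.pred ?M (\<lambda>H. 1 \<le> c * cmod (noiseless K ch S v k t u H))" if "t < n" for k t u
    using measurable_noiseless[OF that] by measurable
  have "Measurable.pred ?M (\<lambda>H.
    (\<forall>t\<in>{..<n}. \<forall>i\<in>{..<K - 1}. \<forall>s\<in>S. cmod (v t i s H) \<le> c) \<and>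
    (\<forall>k\<in>{..<K}. \<forall>u\<in>PiE S (\<lambda>_. gauss_ints). (\<exists>s\<in>S. own s = k \<and> u s \<noteq> 0) \<longrightarrow>
      (\<exists>t\<in>{..<n}. 1 \<le> c * cmod (noiseless K ch S v k t u H))))"
  proof (intro pred_intros_logic(3))
    show "Measurable.pred ?M (\<lambda>H. \<forall>t\<in>{..<n}. \<forall>i\<in>{..<K - 1}. \<forall>s\<in>S. cmod (v t i s H) \<le> c)"
      using finite_symbols by (intro pred_intros_finite) auto
    have "Measurable.pred ?M (\<lambda>H. \<forall>u\<in>PiE S (\<lambda>_. gauss_ints). (\<exists>s\<in>S. own s = k \<and> u s \<noteq> 0) \<longrightarrow>
        (\<exists>t\<in>{..<n}. 1 \<le> c * cmod (noiseless K ch S v k t u H)))" for k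
    proof (rule measurable_pred_countable(1)[OF U])
      fix u
      have "Measurable.pred ?M (\<lambda>H. \<exists>t\<in>{..<n}. 1 \<le> c * cmod (noiseless K ch S v k t u H))"
        by (intro pred_intros_finite) auto
      then show "Measurable.pred ?M (\<lambda>H. (\<exists>s\<in>S. own s = k \<and> u s \<noteq> 0) \<longrightarrow>
          (\<exists>t\<in>{..<n}. 1 \<le> c * cmod (noiseless K ch S v k t u H)))"
        by (intro pred_intros_logic(4)) auto
    qed
    then show "Measurable.pred ?M (\<lambda>H. \<forall>k\<in>{..<K}. \<forall>u\<in>PiE S (\<lambda>_. gauss_ints). (\<exists>s\<in>S. own s = k \<and> u s \<noteq> 0) \<longrightarrow>
        (\<exists>t\<in>{..<n}. 1 \<le> c * cmod (noiseless K ch S v k t u H)))"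
      by (rule pred_intros_finite(3)[OF finite_lessThan])
  qed
  moreover have "well_conditioned c = (\<lambda>H.
    (\<forall>t\<in>{..<n}. \<forall>i\<in>{..<K - 1}. \<forall>s\<in>S. cmod (v t i s H) \<le> c) \<and>
    (\<forall>k\<in>{..<K}. \<forall>u\<in>PiE S (\<lambda>_. gauss_ints). (\<exists>s\<in>S. own s = k \<and> u s \<noteq> 0) \<longrightarrow>
      (\<exists>t\<in>{..<n}. 1 \<le> c * cmod (noiseless K ch S v k t u H))))"
    by (rule ext) (simp only: well_conditioned_def Ball_def Bex_def lessThan_iff)
  ultimately show ?thesis by (simp only:)
qed

text \<open>The events increase with \<open>c\<close> to an almost sure one; continuity of the
  measure gives the bound.\<close>

lemma ex_prob_not_well_conditioned_less:
  assumes D: "prob_space D" "sets D = sets borel" and "0 < \<delta>"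
  shows "\<exists>c::nat. measure (fading_space K D) {H \<in> space (fading_space K D). \<not> well_conditioned c H} < \<delta>"
proof -
  interpret F: prob_space "fading_space K D"
    unfolding fading_space_def using D(1) by (intro prob_space_PiM)
  let ?A = "\<lambda>c::nat. {H \<in> space (fading_space K D). well_conditioned c H}"
  have A: "?A c \<in> sets (fading_space K D)" for c
    using measurable_compose[OF measurable_ident_UNIV[OF D(2)] measurable_well_conditioned]
    unfolding fading_space_def by (simp add: pred_def)
  have "incseq ?A"
    by (auto simp: incseq_def intro: well_conditioned_mono)
  then have "(\<lambda>c. F.prob (?A c)) \<longlonglongrightarrow> F.prob (\<Union>c. ?A c)"
    using A by (intro F.finite_Lim_measure_incseq) auto
  moreover have "F.prob (\<Union>c. ?A c) = 1"
  proof (subst F.prob_eq_1)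
    show "(\<Union>c. ?A c) \<in> F.events" using A by auto
    show "AE H in fading_space K D. H \<in> (\<Union>c. ?A c)"
      using decodable AE_space by eventually_elim (auto dest: ex_well_conditioned)
  qed
  ultimately have "\<forall>\<^sub>F c in sequentially. 1 - \<delta> < F.prob (?A c)"
    using \<open>0 < \<delta>\<close> by (intro order_tendstoD(1)) auto
  then obtain c where c: "1 - \<delta> < F.prob (?A c)"
    using eventually_happens sequentially_bot by blast
  have "{H \<in> space (fading_space K D). \<not> well_conditioned c H} = space (fading_space K D) - ?A c" by auto
  then show ?thesis
    using c F.prob_compl[OF A, of c] by (intro exI[of _ c]) simp
qed

end

subsection \<open>Concentration over disjoint sets of coordinates\<close>

lemma indep_vars_PiM_coordinates:
  assumes D: "prob_space D" and "I \<noteq> {}"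
  shows "prob_space.indep_vars (PiM I (\<lambda>_. D)) (\<lambda>_. D) (\<lambda>i \<omega>. \<omega> i) I"
proof -
  interpret P: prob_space "PiM I (\<lambda>_. D)" using D by (intro prob_space_PiM)
  have "distr (PiM I (\<lambda>_. D)) (PiM I (\<lambda>_. D)) (\<lambda>x. \<lambda>i\<in>I. x i) = distr (PiM I (\<lambda>_. D)) (PiM I (\<lambda>_. D)) (\<lambda>x. x)"
    by (rule distr_cong) (auto simp: space_PiM PiE_restrict)
  also have "\<dots> = PiM I (\<lambda>_. D)" by (rule distr_id2) simp
  also have "\<dots> = PiM I (\<lambda>i. distr (PiM I (\<lambda>_. D)) D (\<lambda>\<omega>. \<omega> i))"
    using D by (intro PiM_cong refl distr_PiM_component[symmetric]) auto
  finally show ?thesis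
    using assms(2) by (subst P.indep_vars_iff_distr_eq_PiM') (auto intro: measurable_component_singleton)
qed

text \<open>Events on disjoint coordinates are independent, and each has probability at most
  \<open>p < \<tau>\<close>; Hoeffding's inequality makes the excess exponentially unlikely.\<close>

lemma prob_many_disjoint_events_tendsto_0:
  fixes J :: "nat \<Rightarrow> 'i set"
  assumes D: "prob_space D"
    and J: "\<And>s. J s \<subseteq> I" "disjoint_family J"
    and Q: "\<And>s. Measurable.pred (PiM (J s) (\<lambda>_. D)) (Q s)"
    and p: "\<And>s. measure (PiM I (\<lambda>_. D)) {\<omega> \<in> space (PiM I (\<lambda>_. D)). Q s (restrict \<omega> (J s))} \<le> p" "p < \<tau>"
    and "I \<noteq> {}"
  shows "(\<lambda>N. measure (PiM I (\<lambda>_. D))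
    {\<omega> \<in> space (PiM I (\<lambda>_. D)). \<tau> * real N < real (card {s. s < N \<and> Q s (restrict \<omega> (J s))})}) \<longlonglongrightarrow> 0"
    (is "(\<lambda>N. measure ?M (?E N)) \<longlonglongrightarrow> 0")
proof -
  interpret P: prob_space "PiM I (\<lambda>_. D)" using D by (intro prob_space_PiM)
  define X :: "nat \<Rightarrow> ('i \<Rightarrow> 'a) \<Rightarrow> real" where "X s \<omega> = (if Q s (restrict \<omega> (J s)) then 1 else 0)" for s \<omega>
  have "P.indep_vars (\<lambda>s. PiM (J s) (\<lambda>_. D)) (\<lambda>s \<omega>. restrict (\<lambda>i. \<omega> i) (J s)) UNIV"
    using indep_vars_PiM_coordinates[OF D \<open>I \<noteq> {}\<close>] J by (intro P.indep_vars_restrict) auto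
  then have "P.indep_vars (\<lambda>_. borel) (\<lambda>s \<omega>. (\<lambda>\<omega>. if Q s \<omega> then 1 else 0 :: real) (restrict (\<lambda>i. \<omega> i) (J s))) UNIV"
  proof (rule P.indep_vars_compose2)
    fix s show "(\<lambda>\<omega>. if Q s \<omega> then 1 else 0 :: real) \<in> borel_measurable (PiM (J s) (\<lambda>_. D))"
      using Q[of s] by (intro measurable_If) (auto simp: pred_def)
  qed
  then have indep: "P.indep_vars (\<lambda>_. borel) X UNIV"
    by (simp add: X_def[abs_def])
  then have rv: "X s \<in> borel_measurable ?M" for s
    by (auto simp: P.indep_vars_def)
  have E: "?E N = {\<omega> \<in> space ?M. \<tau> * real N < (\<Sum>s<N. X s \<omega>)}" for N
  proof -
    have "(\<Sum>s<N. X s \<omega>) = real (card {s. s < N \<and> Q s (restrict \<omega> (J s))})" for \<omega>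
    proof -
      have "(\<Sum>s<N. X s \<omega>) = (\<Sum>s\<in>{s \<in> {..<N}. Q s (restrict \<omega> (J s))}. 1)"
        unfolding X_def by (rule sum.inter_filter[symmetric]) simp
      then show ?thesis by (simp add: lessThan_def)
    qed
    then show ?thesis by simp
  qed
  have exp: "P.expectation (X s) \<le> p" for s
  proof -
    have ev: "{\<omega> \<in> space ?M. Q s (restrict \<omega> (J s))} \<in> P.events"
    proof -
      have "{\<omega> \<in> space ?M. Q s (restrict \<omega> (J s))} = X s -` {1} \<inter> space ?M"
        by (auto simp: X_def split: if_splits)
      then show ?thesis using measurable_sets[OF rv, of "{1}" s] by simp
    qed
    have "P.expectation (X s) = P.expectation (indicator {\<omega> \<in> space ?M. Q s (restrict \<omega> (J s))})"
      by (intro Bochner_Integration.integral_cong) (auto simp: X_def indicator_def)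
    also have "\<dots> = P.prob {\<omega> \<in> space ?M. Q s (restrict \<omega> (J s))}"
      using ev by simp
    finally show ?thesis using p(1) by simp
  qed
  have bound: "measure ?M (?E N) \<le> exp (- 2 * (\<tau> - p)\<^sup>2 * real N)" if N: "0 < N" for N
  proof -
    interpret H: Hoeffding_ineq ?M "{..<N}" X "\<lambda>_. 0" "\<lambda>_. 1" "\<Sum>s<N. P.expectation (X s)"
    proof unfold_locales
      show "P.indep_vars (\<lambda>_. borel) X {..<N}"
        by (rule P.indep_vars_subset[OF indep]) simp
    qed (auto simp: X_def)
    have "(\<Sum>s<N. P.expectation (X s)) \<le> (\<Sum>s<N. p)" by (intro sum_mono exp)
    then have mu: "(\<Sum>s<N. P.expectation (X s)) + real N * (\<tau> - p) \<le> \<tau> * real N"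
      by (simp add: algebra_simps)
    have "measure ?M (?E N) \<le> P.prob {\<omega> \<in> space ?M. (\<Sum>s<N. X s \<omega>) \<ge> (\<Sum>s<N. P.expectation (X s)) + real N * (\<tau> - p)}"
      unfolding E using mu rv by (intro P.finite_measure_mono) auto
    also have "\<dots> \<le> exp (- 2 * (real N * (\<tau> - p))\<^sup>2 / (\<Sum>s<N. (1 - 0)\<^sup>2))"
      using p(2) N by (intro H.Hoeffding_ineq_ge) auto
    also have "- 2 * (real N * (\<tau> - p))\<^sup>2 / (\<Sum>s<N. (1 - 0)\<^sup>2) = - 2 * (\<tau> - p)\<^sup>2 * real N"
      using N by (simp add: power2_eq_square)
    finally show ?thesis .
  qed
  have "0 < (\<tau> - p)\<^sup>2" using p(2) by simp
  then have "(\<lambda>N. exp (- 2 * (\<tau> - p)\<^sup>2 * real N)) \<longlonglongrightarrow> 0"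
    by real_asymp
  then show ?thesis
  proof (rule tendsto_sandwich[OF _ _ tendsto_const, rotated 2])
    show "\<forall>\<^sub>F N in sequentially. measure ?M (?E N) \<le> exp (- 2 * (\<tau> - p)\<^sup>2 * real N)"
      using bound by (auto intro: eventually_sequentiallyI[of 1])
  qed simp
qed

subsection \<open>Codes of large minimum distance\<close>

definition words :: "nat \<Rightarrow> 'b set \<Rightarrow> (nat \<Rightarrow> 'b) set" where
  "words N A = PiE {..<N} (\<lambda>_. A)"

definition hdist :: "nat \<Rightarrow> (nat \<Rightarrow> 'b) \<Rightarrow> (nat \<Rightarrow> 'b) \<Rightarrow> nat" where
  "hdist N x y = card {s. s < N \<and> x s \<noteq> y s}"

lemma finite_words: "finite A \<Longrightarrow> finite (words N A)"
  by (simp add: words_def finite_PiE)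

lemma card_words: "finite A \<Longrightarrow> card (words N A) = card A ^ N"
  by (simp add: words_def card_PiE)

lemma hdist_sym: "hdist N x y = hdist N y x"
  unfolding hdist_def by (rule arg_cong[where f = card]) auto

text \<open>Choose a set of at most \<open>d\<close> positions outside which the words agree, then
  the letters on it. The crude factor \<open>2 ^ N\<close> costs \<open>ln 2\<close> per letter,
  which is negligible against \<open>ln P\<close>.\<close>

lemma card_hamming_ball_le:
  assumes A: "finite A" "A \<noteq> {}"
  shows "card {y \<in> words N A. hdist N x y \<le> d} \<le> 2 ^ N * card A ^ d"
proof -
  let ?\<I> = "{I \<in> Pow {..<N}. card I \<le> d}"
  let ?F = "\<lambda>I. {y \<in> words N A. \<forall>s<N. s \<notin> I \<longrightarrow> y s = x s}"
  have F: "card (?F I) \<le> card A ^ d" if I: "I \<in> ?\<I>" for I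
  proof -
    have finI: "finite I" using I finite_subset by auto
    have "inj_on (\<lambda>y. restrict y I) (?F I)"
    proof (rule inj_onI)
      fix y y' assume y: "y \<in> ?F I" and y': "y' \<in> ?F I" and eq: "restrict y I = restrict y' I"
      show "y = y'"
      proof
        fix s
        show "y s = y' s"
        proof (cases "s \<in> I")
          case True
          then show ?thesis using fun_cong[OF eq, of s] by simp
        next
          case False
          then show ?thesis using y y' by (cases "s < N") (auto simp: words_def PiE_def extensional_def)
        qed
      qed
    qed
    moreover have "(\<lambda>y. restrict y I) ` ?F I \<subseteq> PiE I (\<lambda>_. A)"
      using I by (auto simp: words_def PiE_def Pi_def)
    ultimately have "card (?F I) \<le> card (PiE I (\<lambda>_. A))"
      using A finI by (intro card_inj_on_le finite_PiE) auto
    also have "\<dots> = card A ^ card I" using finI by (simp add: card_PiE)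
    also have "\<dots> \<le> card A ^ d"
      using I A by (intro power_increasing) (auto simp: Suc_le_eq card_gt_0_iff)
    finally show ?thesis .
  qed
  have "{y \<in> words N A. hdist N x y \<le> d} \<subseteq> (\<Union>I\<in>?\<I>. ?F I)"
  proof
    fix y assume y: "y \<in> {y \<in> words N A. hdist N x y \<le> d}"
    then show "y \<in> (\<Union>I\<in>?\<I>. ?F I)"
      by (intro UN_I[of "{s. s < N \<and> x s \<noteq> y s}"]) (auto simp: hdist_def)
  qed
  then have "card {y \<in> words N A. hdist N x y \<le> d} \<le> card (\<Union>I\<in>?\<I>. ?F I)"
    using finite_words[OF A(1)] by (intro card_mono) auto
  also have "\<dots> \<le> (\<Sum>I\<in>?\<I>. card (?F I))"
    by (rule card_UN_le) simp
  also have "\<dots> \<le> (\<Sum>I\<in>?\<I>. card A ^ d)" by (rule sum_mono) (rule F)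
  also have "\<dots> = card ?\<I> * card A ^ d" by simp
  also have "card ?\<I> \<le> card (Pow {..<N})" by (rule card_mono) auto
  then have "card ?\<I> * card A ^ d \<le> 2 ^ N * card A ^ d"
    by (simp add: card_Pow)
  finally show ?thesis .
qed

text \<open>Greedy choice: a new word only has to avoid the balls around the earlier ones, at most
  \<open>M - 1\<close> in number.\<close>

lemma gilbert_varshamov:
  assumes A: "finite A" "A \<noteq> {}"
    and "(M - 1) * (2 ^ N * card A ^ d) < card A ^ N"
  shows "\<exists>c. (\<forall>m<M. c m \<in> words N A) \<and> (\<forall>m<M. \<forall>m'<M. m \<noteq> m' \<longrightarrow> d < hdist N (c m) (c m'))"
  using assms(3)
proof (induction M)
  case 0
  then show ?case by simp
next
  case (Suc M)
  have "(M - 1) * (2 ^ N * card A ^ d) \<le> (Suc M - 1) * (2 ^ N * card A ^ d)"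
    by (intro mult_le_mono1) simp
  then obtain c where c: "\<forall>m<M. c m \<in> words N A" "\<forall>m<M. \<forall>m'<M. m \<noteq> m' \<longrightarrow> d < hdist N (c m) (c m')"
    using Suc.IH Suc.prems by (meson le_less_trans)
  let ?B = "\<Union>m<M. {y \<in> words N A. hdist N (c m) y \<le> d}"
  have "card ?B \<le> (\<Sum>m<M. card {y \<in> words N A. hdist N (c m) y \<le> d})"
    by (rule card_UN_le) simp
  also have "\<dots> \<le> (\<Sum>m<M. 2 ^ N * card A ^ d)"
    by (intro sum_mono card_hamming_ball_le A)
  also have "\<dots> < card (words N A)"
    using Suc.prems A by (simp add: card_words)
  finally have "card ?B < card (words N A)" .
  then have "\<not> words N A \<subseteq> ?B"
    using finite_words[OF A(1)] card_mono[of ?B "words N A"] by (auto simp: not_le[symmetric] intro: card_mono)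
  then obtain y where y: "y \<in> words N A" "y \<notin> ?B" by blast
  have far: "d < hdist N (c m) y" "d < hdist N y (c m)" if "m < M" for m
    using y that by (auto simp: not_le hdist_sym[of N y])
  show ?case
    using c y far by (intro exI[of _ "c(M := y)"]) (auto simp: less_Suc_eq)
qed

text \<open>Rate in nats per outer letter over an alphabet of size \<open>a\<close>: the exponent of
  \<open>a ^ N\<close> divided by the bound on balls of radius \<open>2 * \<tau> * N\<close>. The
  maximum covers small alphabets, for which a single message remains.\<close>

definition code_rate :: "real \<Rightarrow> nat \<Rightarrow> real" where
  "code_rate \<tau> a = max 0 ((1 - 2 * \<tau>) * ln (real a) - ln 2)"

definition code_size :: "real \<Rightarrow> nat \<Rightarrow> nat" where
  "code_size \<rho> N = nat \<lfloor>exp (real N * \<rho>)\<rfloor>"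

lemma code_size_ge_1:
  assumes "0 \<le> \<rho>"
  shows "1 \<le> code_size \<rho> N"
proof -
  have "1 \<le> exp (real N * \<rho>)" using assms by simp
  then have "1 \<le> \<lfloor>exp (real N * \<rho>)\<rfloor>" by simp
  then show ?thesis unfolding code_size_def by linarith
qed

lemma code_size_gv:
  assumes "0 < a" "0 \<le> \<tau>"
  shows "(code_size (code_rate \<tau> a) N - 1) * (2 ^ N * a ^ nat \<lfloor>2 * \<tau> * real N\<rfloor>) < a ^ N"
proof (cases "code_rate \<tau> a = 0")
  case True
  then show ?thesis using assms by (simp add: code_size_def)
next
  case False
  define \<rho> where "\<rho> = (1 - 2 * \<tau>) * ln (real a) - ln 2"
  define d where "d = nat \<lfloor>2 * \<tau> * real N\<rfloor>"
  have rate: "code_rate \<tau> a = \<rho>" using False by (auto simp: code_rate_def \<rho>_def max_def split: if_splits)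
  have lna: "0 \<le> ln (real a)" using assms by (simp add: ln_ge_zero_iff)
  have d: "real d \<le> 2 * \<tau> * real N" using assms by (simp add: d_def)
  have M: "1 \<le> code_size \<rho> N"
    by (rule code_size_ge_1) (simp flip: rate add: code_rate_def)
  have "real (code_size \<rho> N - 1) < real (code_size \<rho> N)" using M by simp
  also have "\<dots> \<le> exp (real N * \<rho>)" by (simp add: code_size_def)
  finally have "real (code_size \<rho> N - 1) * (2 ^ N * real a ^ d) < exp (real N * \<rho>) * (2 ^ N * real a ^ d)"
    using assms by (intro mult_strict_right_mono) auto
  also have "exp (real N * \<rho>) * (2 ^ N * real a ^ d) =
      exp (real N * \<rho>) * (exp (real N * ln 2) * exp (real d * ln (real a)))"
    using assms by (simp add: exp_of_nat_mult)
  also have "\<dots> =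
      exp (real N * ln (real a) - (2 * \<tau> * real N - real d) * ln (real a))"
    by (simp add: \<rho>_def algebra_simps flip: exp_add)
  also have "\<dots> \<le> exp (real N * ln (real a))"
    using d lna by simp
  also have "\<dots> = real a ^ N" using assms by (simp add: exp_of_nat_mult)
  finally have "real ((code_size \<rho> N - 1) * (2 ^ N * a ^ d)) < real (a ^ N)"
    by simp
  then show ?thesis unfolding rate d_def[symmetric] by (simp only: of_nat_less_iff)
qed

lemma ln_code_size_bounds:
  assumes "0 \<le> \<rho>"
  shows "real N * \<rho> - ln 2 \<le> ln (real (code_size \<rho> N))" "ln (real (code_size \<rho> N)) \<le> real N * \<rho>"
proof -
  let ?x = "exp (real N * \<rho>)"
  have 1: "1 \<le> real (code_size \<rho> N)" using code_size_ge_1[OF assms, of N] by simp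
  have fl: "real (code_size \<rho> N) = of_int \<lfloor>?x\<rfloor>" by (simp add: code_size_def)
  have "?x < real (code_size \<rho> N) + 1" unfolding fl by linarith
  then have "?x / 2 \<le> real (code_size \<rho> N)" using 1 by simp
  then have "ln (?x / 2) \<le> ln (real (code_size \<rho> N))"
    using 1 by (subst ln_le_cancel_iff) auto
  then show "real N * \<rho> - ln 2 \<le> ln (real (code_size \<rho> N))" by (simp add: ln_div)
  have "real (code_size \<rho> N) \<le> ?x" unfolding fl by linarith
  then have "ln (real (code_size \<rho> N)) \<le> ln ?x" using 1 by (subst ln_le_cancel_iff) auto
  then show "ln (real (code_size \<rho> N)) \<le> real N * \<rho>" by simp
qed

text \<open>Only \<open>n div l\<close> superblocks fit into \<open>n\<close> slots; the rounding
  losses are bounded and vanish after division by \<open>n\<close>.\<close>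

lemma code_size_rate_tendsto:
  assumes "0 \<le> \<rho>" "0 < l"
  shows "(\<lambda>n. ln (real (code_size \<rho> (n div l))) / real n) \<longlonglongrightarrow> \<rho> / real l"
proof (rule tendsto_sandwich)
  have div: "real n / real l - 1 \<le> real (n div l)" "real (n div l) \<le> real n / real l" for n
  proof -
    have "real n = real l * real (n div l) + real (n mod l)"
      by (metis mult_div_mod_eq of_nat_add of_nat_mult)
    moreover have "real (n mod l) < real l" using assms(2) by simp
    ultimately show "real n / real l - 1 \<le> real (n div l)" "real (n div l) \<le> real n / real l"
      using assms(2) by (simp_all add: field_simps)
  qed
  show "\<forall>\<^sub>F n in sequentially. ((real n / real l - 1) * \<rho> - ln 2) / real n \<le> ln (real (code_size \<rho> (n div l))) / real n"
  proof (intro always_eventually allI divide_right_mono)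
    fix n
    have "(real n / real l - 1) * \<rho> \<le> real (n div l) * \<rho>"
      using div(1)[of n] assms(1) by (rule mult_right_mono)
    then show "(real n / real l - 1) * \<rho> - ln 2 \<le> ln (real (code_size \<rho> (n div l)))"
      using ln_code_size_bounds(1)[OF assms(1), of "n div l"] by linarith
  qed simp
  show "\<forall>\<^sub>F n in sequentially. ln (real (code_size \<rho> (n div l))) / real n \<le> (real n / real l * \<rho>) / real n"
  proof (intro always_eventually allI divide_right_mono)
    fix n
    have "real (n div l) * \<rho> \<le> real n / real l * \<rho>"
      using div(2)[of n] assms(1) by (rule mult_right_mono)
    then show "ln (real (code_size \<rho> (n div l))) \<le> real n / real l * \<rho>"
      using ln_code_size_bounds(2)[OF assms(1), of "n div l"] by linarith
  qed simp
  show "(\<lambda>n. ((real n / real l - 1) * \<rho> - ln 2) / real n) \<longlonglongrightarrow> \<rho> / real l"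
    using assms by real_asymp (simp add: divide_inverse mult.commute)
  show "(\<lambda>n. (real n / real l * \<rho>) / real n) \<longlonglongrightarrow> \<rho> / real l"
    using assms by real_asymp (simp add: divide_inverse mult.commute)
qed

text \<open>A symbol has about \<open>\<kappa>\<^sup>2 * P\<close> values, and its logarithm is
  \<open>ln P\<close> up to a bounded term: one degree of freedom per complex symbol.\<close>

lemma code_rate_tendsto:
  fixes Q :: "real \<Rightarrow> nat"
  assumes "0 < \<kappa>" and "\<tau> \<le> 1 / 2"
    and Q: "\<And>P. 0 < P \<Longrightarrow> Q P = Suc (nat \<lfloor>\<kappa> * sqrt P\<rfloor>)"
  shows "((\<lambda>P. code_rate \<tau> ((Q P)\<^sup>2 ^ j) / ln P) \<longlongrightarrow> (1 - 2 * \<tau>) * real j) at_top"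
proof -
  have lnQ: "((\<lambda>P. ln (real (Q P)) / ln P) \<longlongrightarrow> 1 / 2) at_top"
  proof (rule tendsto_sandwich)
    have ge: "\<forall>\<^sub>F P in at_top. 1 < P \<and> 1 < \<kappa> * sqrt P"
    proof -
      have "\<forall>\<^sub>F P in at_top. 1 < \<kappa> * sqrt P" using assms(1) by real_asymp
      then show ?thesis using eventually_gt_at_top[of 1] by eventually_elim auto
    qed
    show "\<forall>\<^sub>F P in at_top. ln (\<kappa> * sqrt P) / ln P \<le> ln (real (Q P)) / ln P"
      using ge
    proof eventually_elim
      case (elim P)
      have "\<kappa> * sqrt P \<le> real (Q P)" using Q[of P] elim by (simp, linarith)
      then have "ln (\<kappa> * sqrt P) \<le> ln (real (Q P))" using elim by (subst ln_le_cancel_iff) auto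
      then show ?case using elim by (intro divide_right_mono) auto
    qed
    show "\<forall>\<^sub>F P in at_top. ln (real (Q P)) / ln P \<le> ln (\<kappa> * sqrt P + 1) / ln P"
      using ge
    proof eventually_elim
      case (elim P)
      have "real (Q P) \<le> \<kappa> * sqrt P + 1" using Q[of P] elim by simp
      moreover have "0 < real (Q P)" using Q[of P] elim by (subst of_nat_0_less_iff) simp
      ultimately have "ln (real (Q P)) \<le> ln (\<kappa> * sqrt P + 1)" using elim by (subst ln_le_cancel_iff) auto
      then show ?case using elim by (intro divide_right_mono) auto
    qed
    show "((\<lambda>P. ln (\<kappa> * sqrt P) / ln P) \<longlongrightarrow> 1 / 2) at_top" using assms(1) by real_asymp
    show "((\<lambda>P. ln (\<kappa> * sqrt P + 1) / ln P) \<longlongrightarrow> 1 / 2) at_top" using assms(1) by real_asymp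
  qed
  have "((\<lambda>P::real. ln 2 / ln P) \<longlongrightarrow> 0) at_top" by real_asymp
  then have "((\<lambda>P. max 0 ((1 - 2 * \<tau>) * (2 * real j * (ln (real (Q P)) / ln P)) - ln 2 / ln P)) \<longlongrightarrow>
      max 0 ((1 - 2 * \<tau>) * (2 * real j * (1 / 2)) - 0)) at_top"
    by (intro tendsto_max tendsto_diff tendsto_mult tendsto_const lnQ)
  moreover have "\<forall>\<^sub>F P in at_top. max 0 ((1 - 2 * \<tau>) * (2 * real j * (ln (real (Q P)) / ln P)) - ln 2 / ln P) =
      code_rate \<tau> ((Q P)\<^sup>2 ^ j) / ln P"
    using eventually_gt_at_top[of 1]
  proof eventually_elim
    case (elim P)
    have "0 < real (Q P)" using Q[of P] elim by simp
    then have "ln (real ((Q P)\<^sup>2 ^ j)) = 2 * real j * ln (real (Q P))"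
      by (simp add: ln_realpow)
    then have "code_rate \<tau> ((Q P)\<^sup>2 ^ j) = max 0 ((1 - 2 * \<tau>) * (2 * real j * ln (real (Q P))) - ln 2)"
      by (simp add: code_rate_def)
    moreover have "max 0 x / ln P = max 0 (x / ln P)" for x
      using elim by (simp add: max_def zero_le_divide_iff divide_le_0_iff)
    ultimately show ?case by (simp add: diff_divide_distrib)
  qed
  moreover have "max 0 ((1 - 2 * \<tau>) * (2 * real j * (1 / 2)) - 0) = (1 - 2 * \<tau>) * real j"
    using assms(2) by simp
  ultimately show ?thesis by (simp only: tendsto_cong)
qed

subsection \<open>Coding over superblocks\<close>

text \<open>Oversized signals are replaced by 0, so the power constraint holds for every single
  channel and message.\<close>

definition clip :: "real \<Rightarrow> complex \<Rightarrow> complex" where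
  "clip A z = (if cmod z \<le> A then z else 0)"

lemma cmod_clip_le: "0 \<le> A \<Longrightarrow> cmod (clip A z) \<le> A"
  by (simp add: clip_def)

lemma measurable_clip [measurable]: "clip A \<in> borel_measurable borel"
  unfolding clip_def[abs_def] by measurable

definition qam :: "nat \<Rightarrow> complex set" where
  "qam Q = (\<lambda>(a, b). Complex (real a) (real b)) ` ({..<Q} \<times> {..<Q})"

lemma finite_qam: "finite (qam Q)"
  by (simp add: qam_def)

lemma card_qam: "card (qam Q) = Q\<^sup>2"
proof -
  have "inj_on (\<lambda>(a, b). Complex (real a) (real b)) ({..<Q} \<times> {..<Q})"
    by (auto simp: inj_on_def)
  then show ?thesis unfolding qam_def by (simp add: card_image power2_eq_square)
qed

lemma qam_diff:
  assumes "x \<in> qam Q" "y \<in> qam Q"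
  shows "x - y \<in> gauss_ints"
proof -
  obtain a b c d where "x = Complex (real a) (real b)" "y = Complex (real c) (real d)"
    using assms by (auto simp: qam_def)
  then have "x - y = Complex (of_int (int a - int c)) (of_int (int b - int d))"
    by (simp add: complex_eq_iff)
  then show ?thesis
    unfolding gauss_ints_def by (intro image_eqI[of _ _ "(int a - int c, int b - int d)"]) simp_all
qed

lemma cmod_qam_le:
  assumes "x \<in> qam Q"
  shows "cmod x \<le> 2 * real (Q - 1)"
proof -
  obtain a b where x: "x = Complex (real a) (real b)" "a < Q" "b < Q"
    using assms by (auto simp: qam_def)
  have "cmod x \<le> \<bar>Re x\<bar> + \<bar>Im x\<bar>" by (rule cmod_le)
  also have "\<dots> \<le> real (Q - 1) + real (Q - 1)"
    using x by (intro add_mono) auto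
  finally show ?thesis by simp
qed

text \<open>Slot \<open>t\<close> of the scheme is slot \<open>t + 1\<close> of the channel model,
  so the set of known blocks agrees with \<open>known_blocks\<close>.\<close>

locale superblock_scheme =
  linear_scheme K D "\<lambda>t. {b. b * Tc + Tfb \<le> t}" "\<lambda>t. t div Tc" "L * Tc" S own v + diffuse D
  for K Tc Tfb L :: nat and D :: "complex measure" and S :: "'a set" and own v +
  assumes K: "2 \<le> K" and Tc: "1 \<le> Tc" and L: "0 < L"
begin

abbreviation "len \<equiv> L * Tc"

lemma len_pos: "0 < len"
  using Tc L by simp

abbreviation "clean \<equiv> noiseless K (\<lambda>t. t div Tc) S v"

definition sent :: "real \<Rightarrow> real \<Rightarrow> nat \<Rightarrow> nat \<Rightarrow> ('a \<Rightarrow> complex) \<Rightarrow> fading \<Rightarrow> complex" where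
  "sent A \<Delta> t i u H = clip A (of_real \<Delta> * precoded S v t i u H)"

definition heard :: "real \<Rightarrow> real \<Rightarrow> nat \<Rightarrow> nat \<Rightarrow> ('a \<Rightarrow> complex) \<Rightarrow> fading \<Rightarrow> complex" where
  "heard A \<Delta> k t u H = (\<Sum>i<K - 1. H (t div Tc, k, i) * sent A \<Delta> t i u H)"

definition symbols_of :: "nat \<Rightarrow> 'a set" where
  "symbols_of k = {s \<in> S. own s = k}"

text \<open>The symbols of the other users are quantified existentially: interference has to be
  explained, not identified. The quantifiers are finite, which makes decoding measurable.\<close>

definition consistent ::
  "real \<Rightarrow> real \<Rightarrow> real \<Rightarrow> nat \<Rightarrow> nat \<Rightarrow> ('a \<Rightarrow> complex) \<Rightarrow> (nat \<Rightarrow> complex) \<Rightarrow> fading \<Rightarrow> bool" where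
  "consistent A \<Delta> \<nu> Q k a y H \<longleftrightarrow> (\<exists>u\<in>PiE S (\<lambda>_. qam Q). (\<forall>s\<in>symbols_of k. u s = a s) \<and>
     (\<forall>t\<in>{..<len}. cmod (y t - heard A \<Delta> k t u H) \<le> \<nu>))"

lemma sent_cong:
  assumes "t < len" "i < K - 1" "\<And>x. x \<in> csi_index K {b. b * Tc + Tfb \<le> t} \<Longrightarrow> H x = H' x"
  shows "sent A \<Delta> t i u H = sent A \<Delta> t i u H'"
  unfolding sent_def using precoded_cong[OF assms] by simp

lemma known_subset:
  assumes "t < len" "b * Tc + Tfb \<le> t"
  shows "b < L"
proof -
  have "b * Tc < L * Tc" using assms by linarith
  then show ?thesis by simp
qed

lemma local_block_less: "t < len \<Longrightarrow> t div Tc < L"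
  by (simp add: less_mult_imp_div_less)

lemma heard_cong:
  assumes "t < len" "k < K" "\<And>x. x \<in> csi_index K {..<L} \<Longrightarrow> H x = H' x"
  shows "heard A \<Delta> k t u H = heard A \<Delta> k t u H'"
  unfolding heard_def
proof (intro sum.cong refl arg_cong2[where f = "(*)"])
  fix i assume i: "i \<in> {..<K - 1}"
  show "H (t div Tc, k, i) = H' (t div Tc, k, i)"
    using assms(1,2) i local_block_less by (intro assms(3)) (simp add: csi_index_def)
  show "sent A \<Delta> t i u H = sent A \<Delta> t i u H'"
    using i known_subset[OF assms(1)] by (intro sent_cong assms) (auto simp: csi_index_def)
qed

lemma consistent_cong:
  assumes "k < K" "\<And>x. x \<in> csi_index K {..<L} \<Longrightarrow> H x = H' x" "\<And>t. t < len \<Longrightarrow> y t = y' t"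
  shows "consistent A \<Delta> \<nu> Q k a y H \<longleftrightarrow> consistent A \<Delta> \<nu> Q k a y' H'"
proof -
  have "heard A \<Delta> k t u H = heard A \<Delta> k t u H'" if "t < len" for t u
    by (rule heard_cong[OF that assms(1,2)])
  then show ?thesis
    unfolding consistent_def using assms(3) by (metis (no_types, lifting) lessThan_iff)
qed

text \<open>A slot of a superblock lies in, and uses feedback from, that superblock only. This
  locality yields the independence of superblocks.\<close>

lemma well_conditioned_cong:
  assumes eq: "\<And>x. x \<in> csi_index K {..<L} \<Longrightarrow> H x = H' x"
  shows "well_conditioned c H \<longleftrightarrow> well_conditioned c H'"
proof -
  have v: "v t i s H = v t i s H'" if "t < len" "i < K - 1" "s \<in> S" for t i s
    using known_subset[OF that(1)] by (intro causal[OF that] eq) (auto simp: csi_index_def)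
  have "clean k t u H = clean k t u H'" if "t < len" "k < K" for t k u
    using that known_subset[OF that(1)] local_block_less
    by (intro noiseless_cong eq) (auto simp: csi_index_def)
  with v show ?thesis
    unfolding well_conditioned_def by (simp cong: conj_cong imp_cong)
qed

text \<open>\<open>c\<close> bounds every precoder entry and \<open>2 * (Q - 1)\<close> every
  symbol, so the assumption on \<open>A\<close> keeps all signals below the clipping level.\<close>

lemma heard_unclipped:
  assumes wc: "well_conditioned c H" and t: "t < len"
    and u: "u \<in> PiE S (\<lambda>_. qam Q)" and A: "\<Delta> * c * real (card S) * (2 * real (Q - 1)) \<le> A" and \<Delta>: "0 \<le> \<Delta>"
  shows "heard A \<Delta> k t u H = of_real \<Delta> * clean k t u H"
proof -
  have "sent A \<Delta> t i u H = of_real \<Delta> * precoded S v t i u H" if i: "i < K - 1" for i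
  proof -
    have "cmod (precoded S v t i u H) \<le> (\<Sum>s\<in>S. c * (2 * real (Q - 1)))"
      unfolding precoded_def
    proof (rule sum_norm_le)
      fix s assume s: "s \<in> S"
      have "cmod (v t i s H) \<le> c" using wc t i s by (auto simp: well_conditioned_def)
      moreover have "cmod (u s) \<le> 2 * real (Q - 1)" using u s by (intro cmod_qam_le) auto
      ultimately show "cmod (v t i s H * u s) \<le> c * (2 * real (Q - 1))"
        unfolding norm_mult by (intro mult_mono) (auto intro: order_trans[OF norm_ge_zero])
    qed
    then have "\<Delta> * cmod (precoded S v t i u H) \<le> \<Delta> * (\<Sum>s\<in>S. c * (2 * real (Q - 1)))"
      using \<Delta> by (rule mult_left_mono)
    also have "\<dots> \<le> A" using A by (simp add: mult_ac)
    finally show ?thesis using \<Delta> by (simp add: sent_def clip_def norm_mult)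
  qed
  then show ?thesis
    unfolding heard_def noiseless_def sum_distrib_left by (intro sum.cong) (auto simp: mult_ac)
qed

text \<open>Two explanations of the same observations differ by at most \<open>2 * \<nu>\<close> in
  every slot, whereas a differing own symbol separates them by at least \<open>\<Delta> / c\<close>
  in some slot.\<close>

lemma consistent_iff:
  assumes wc: "well_conditioned c H" and k: "k < K" and c: "0 < c"
    and u: "u \<in> PiE S (\<lambda>_. qam Q)"
    and A: "\<Delta> * c * real (card S) * (2 * real (Q - 1)) \<le> A" and \<nu>: "2 * \<nu> * c < \<Delta>" "0 \<le> \<nu>"
    and y: "\<And>t. t < len \<Longrightarrow> cmod (y t - heard A \<Delta> k t u H) \<le> \<nu>"
  shows "consistent A \<Delta> \<nu> Q k a y H \<longleftrightarrow> (\<forall>s\<in>symbols_of k. u s = a s)"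
proof
  assume "\<forall>s\<in>symbols_of k. u s = a s"
  then show "consistent A \<Delta> \<nu> Q k a y H"
    unfolding consistent_def using u y by blast
next
  assume "consistent A \<Delta> \<nu> Q k a y H"
  then obtain u' where u': "u' \<in> PiE S (\<lambda>_. qam Q)" "\<forall>s\<in>symbols_of k. u' s = a s"
    and y': "\<forall>t\<in>{..<len}. cmod (y t - heard A \<Delta> k t u' H) \<le> \<nu>"
    unfolding consistent_def by blast
  have \<Delta>: "0 < \<Delta>" using \<nu> c by (smt (verit) mult_nonneg_nonneg)
  define w where "w = (\<lambda>s\<in>S. u s - u' s)"
  have w: "w \<in> PiE S (\<lambda>_. gauss_ints)"
    using u u'(1) by (auto simp: w_def intro!: qam_diff)
  have clean_w: "clean k t w H = clean k t u H - clean k t u' H" for t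
    unfolding noiseless_eq w_def by (simp add: sum_subtractf right_diff_distrib)
  show "\<forall>s\<in>symbols_of k. u s = a s"
  proof (rule ccontr)
    assume "\<not> ?thesis"
    then obtain s where "s \<in> S" "own s = k" "w s \<noteq> 0"
      using u'(2) by (auto simp: symbols_of_def w_def)
    then obtain t where t: "t < len" "1 \<le> c * cmod (clean k t w H)"
      using wc w k unfolding well_conditioned_def by blast
    have "heard A \<Delta> k t u H - heard A \<Delta> k t u' H = of_real \<Delta> * clean k t w H"
      using \<Delta> by (simp add: heard_unclipped[OF wc t(1) u A] heard_unclipped[OF wc t(1) u'(1) A] clean_w right_diff_distrib)
    then have "\<Delta> * cmod (clean k t w H) = cmod (heard A \<Delta> k t u H - heard A \<Delta> k t u' H)"
      using \<Delta> by (simp add: norm_mult)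
    also have "\<dots> = cmod ((y t - heard A \<Delta> k t u' H) - (y t - heard A \<Delta> k t u H))"
      by (simp add: algebra_simps)
    also have "\<dots> \<le> \<nu> + \<nu>"
      using y[OF t(1)] y' t(1)
        norm_triangle_ineq4[of "y t - heard A \<Delta> k t u' H" "y t - heard A \<Delta> k t u H"] by force
    finally have le: "\<Delta> * cmod (clean k t w H) \<le> 2 * \<nu>" by simp
    have "\<Delta> \<le> \<Delta> * (c * cmod (clean k t w H))"
      using t(2) \<Delta> by simp
    also have "\<dots> = (\<Delta> * cmod (clean k t w H)) * c" by simp
    also have "\<dots> \<le> 2 * \<nu> * c" using le c by (intro mult_right_mono) auto
    finally show False using \<nu>(1) by simp
  qed
qed

section \<open>Outer code and its decoder\<close>

abbreviation shift :: "nat \<Rightarrow> fading \<Rightarrow> fading" where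
  "shift \<sigma> \<equiv> pull_back (\<lambda>b. b + \<sigma> * L)"

text \<open>A letter of the outer codeword of user \<open>k\<close> is the tuple of its symbols in
  one superblock. Every superblock runs the linear scheme afresh on its shifted channel, and slots
  after the last complete superblock stay silent. The decoder takes the first message inconsistent
  with at most a fraction \<open>\<tau>\<close> of the superblocks.\<close>

definition outer_code ::
  "nat \<Rightarrow> (nat \<Rightarrow> nat) \<Rightarrow> (nat \<Rightarrow> nat \<Rightarrow> nat \<Rightarrow> 'a \<Rightarrow> complex) \<Rightarrow> real \<Rightarrow> real \<Rightarrow> real \<Rightarrow> nat \<Rightarrow> real \<Rightarrow> bc_code" where
  "outer_code N M c A \<Delta> \<nu> Q \<tau> =
    \<lparr> num_msgs = M,
      encode = (\<lambda>t m H i. if (t - 1) div len < N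
        then sent A \<Delta> ((t - 1) mod len) i (\<lambda>s\<in>S. c (own s) (m (own s)) ((t - 1) div len) s) (shift ((t - 1) div len) H)
        else 0),
      decode = (\<lambda>k y H. LEAST m. m < M k \<and>
        (\<Sum>\<sigma><N. if consistent A \<Delta> \<nu> Q k (c k m \<sigma>) (\<lambda>t. y (\<sigma> * len + t + 1)) (shift \<sigma> H) then 0 else 1) \<le> \<tau> * real N) \<rparr>"

lemma slot_div_mod:
  assumes "t < len"
  shows "(\<sigma> * len + t + 1 - 1) div len = \<sigma>" "(\<sigma> * len + t + 1 - 1) mod len = t"
proof -
  have nz: "len \<noteq> 0" using len_pos by simp
  then show "(\<sigma> * len + t + 1 - 1) div len = \<sigma>" "(\<sigma> * len + t + 1 - 1) mod len = t"
    by (simp_all only: add_diff_cancel_right' div_mult_self3[OF nz] mod_mult_self3 div_less[OF assms] mod_less[OF assms] add_0_right)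
qed

lemma block_of_slot:
  assumes "t < len"
  shows "block_of Tc (\<sigma> * len + t + 1) = t div Tc + \<sigma> * L"
proof -
  have "(\<sigma> * (L * Tc) + t) div Tc = (t + \<sigma> * L * Tc) div Tc" by (simp add: mult_ac add_ac)
  also have "\<dots> = t div Tc + \<sigma> * L" using Tc by (subst div_mult_self1) auto
  finally show ?thesis by (simp add: block_of_def)
qed

lemma received_slot:
  assumes t: "t < len" and \<sigma>: "\<sigma> < N" and k: "k < K"
  shows "received K Tc Tfb (outer_code N M c A \<Delta> \<nu> Q \<tau>) k (\<sigma> * len + t + 1) m h z =
    heard A \<Delta> k t (\<lambda>s\<in>S. c (own s) (m (own s)) \<sigma> s) (shift \<sigma> h) + z (\<sigma> * len + t + 1, k)"
proof -
  have "transmitted K Tc Tfb (outer_code N M c A \<Delta> \<nu> Q \<tau>) (\<sigma> * len + t + 1) m h i =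
      sent A \<Delta> t i (\<lambda>s\<in>S. c (own s) (m (own s)) \<sigma> s) (shift \<sigma> h)" if i: "i < K - 1" for i
  proof -
    have "transmitted K Tc Tfb (outer_code N M c A \<Delta> \<nu> Q \<tau>) (\<sigma> * len + t + 1) m h i =
        sent A \<Delta> t i (\<lambda>s\<in>S. c (own s) (m (own s)) \<sigma> s)
          (shift \<sigma> (restrict h (csi_index K (known_blocks Tc Tfb (\<sigma> * len + t + 1)))))"
      unfolding transmitted_def outer_code_def using \<sigma> by (simp only: bc_code.simps slot_div_mod[OF t] if_True)
    also have "\<dots> = sent A \<Delta> t i (\<lambda>s\<in>S. c (own s) (m (own s)) \<sigma> s) (shift \<sigma> h)"
    proof (rule sent_cong[OF t i])
      fix x assume "x \<in> csi_index K {b. b * Tc + Tfb \<le> t}"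
      then show "shift \<sigma> (restrict h (csi_index K (known_blocks Tc Tfb (\<sigma> * len + t + 1)))) x = shift \<sigma> h x"
        by (auto simp: csi_index_def known_blocks_def algebra_simps)
    qed
    finally show ?thesis .
  qed
  then show ?thesis
    unfolding received_def heard_def block_of_slot[OF t] by simp
qed

lemma slot_le:
  assumes "t < len" "\<sigma> < n div len"
  shows "\<sigma> * len + t + 1 \<le> n"
proof -
  have "\<sigma> * len + t < (n div len) * len" by (rule mat_index_less[OF assms(2,1)])
  also have "\<dots> \<le> n" by simp
  finally show ?thesis by simp
qed

lemma spanned_blocks_superblock:
  assumes "b < L" "\<sigma> < n div len"
  shows "b + \<sigma> * L \<in> spanned_blocks Tc n"
proof -
  have t: "b * Tc < len" using assms(1) Tc by simp
  have "block_of Tc (\<sigma> * len + b * Tc + 1) = b + \<sigma> * L"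
    using block_of_slot[OF t] Tc by simp
  then show ?thesis
    unfolding spanned_blocks_def using slot_le[OF t assms(2)] by (intro image_eqI[of _ _ "\<sigma> * len + b * Tc + 1"]) auto
qed

text \<open>In a good superblock, consistency means equality of the letters. The sent message thus
  fails in bad superblocks only, at most \<open>\<tau> * N\<close> times. Another accepted message
  would fail at most \<open>\<tau> * N\<close> times as well, and its word would differ from the
  sent one in at most \<open>2 * \<tau> * N\<close> places, contradicting the distance.\<close>

lemma decoded_eq:
  fixes n N Q :: nat and \<tau> c' :: real
  defines "N \<equiv> n div len"
  assumes k: "k < K" and m: "\<And>k. k < K \<Longrightarrow> m k < M k"
    and words: "\<And>k m. k < K \<Longrightarrow> m < M k \<Longrightarrow> c k m \<in> words N (PiE (symbols_of k) (\<lambda>_. qam Q))"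
    and far: "\<And>m m'. m < M k \<Longrightarrow> m' < M k \<Longrightarrow> m \<noteq> m' \<Longrightarrow> 2 * \<tau> * real N < real (hdist N (c k m) (c k m'))"
    and c': "0 < c'" and A: "\<Delta> * c' * real (card S) * (2 * real (Q - 1)) \<le> A" and \<nu>: "2 * \<nu> * c' < \<Delta>" "0 \<le> \<nu>"
    and bad: "real (card {\<sigma>. \<sigma> < N \<and> (\<not> well_conditioned c' (shift \<sigma> h) \<or>
      (\<exists>t<len. \<exists>k<K. \<nu> < cmod (z (\<sigma> * len + t + 1, k))))}) \<le> \<tau> * real N"
      (is "real (card ?B) \<le> _")
  shows "decoded K Tc Tfb n (outer_code N M c A \<Delta> \<nu> Q \<tau>) k m h z = m k"
proof -
  let ?C = "outer_code N M c A \<Delta> \<nu> Q \<tau>"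
  let ?y = "\<lambda>t\<in>{1..n}. received K Tc Tfb ?C k t m h z"
  let ?H = "restrict h (csi_index K (spanned_blocks Tc n))"
  let ?ok = "\<lambda>m' \<sigma>. consistent A \<Delta> \<nu> Q k (c k m' \<sigma>) (\<lambda>t. ?y (\<sigma> * len + t + 1)) (shift \<sigma> ?H)"
  have count: "(\<Sum>\<sigma><N. if ?ok m' \<sigma> then 0 else 1 :: real) = real (card {\<sigma>. \<sigma> < N \<and> \<not> ?ok m' \<sigma>})" for m'
  proof -
    have "(\<Sum>\<sigma><N. if ?ok m' \<sigma> then 0 else 1 :: real) = (\<Sum>\<sigma><N. if \<not> ?ok m' \<sigma> then 1 else 0)"
      by (intro sum.cong) auto
    also have "\<dots> = (\<Sum>\<sigma>\<in>{\<sigma> \<in> {..<N}. \<not> ?ok m' \<sigma>}. 1)"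
      by (rule sum.inter_filter[symmetric]) simp
    finally show ?thesis by (simp add: lessThan_def)
  qed
  have ok: "?ok m' \<sigma> \<longleftrightarrow> c k m' \<sigma> = c k (m k) \<sigma>" if \<sigma>: "\<sigma> < N" "\<sigma> \<notin> ?B" and m': "m' < M k" for m' \<sigma>
  proof -
    define u where "u = (\<lambda>s\<in>S. c (own s) (m (own s)) \<sigma> s)"
    have wc: "well_conditioned c' (shift \<sigma> h)"
      and "\<not> (\<exists>t<len. \<exists>k<K. \<nu> < cmod (z (\<sigma> * len + t + 1, k)))"
      using \<sigma> by auto
    then have z: "\<And>t. t < len \<Longrightarrow> cmod (z (\<sigma> * len + t + 1, k)) \<le> \<nu>"
      using k by (meson not_less)
    have word: "c k' m'' \<sigma> \<in> PiE (symbols_of k') (\<lambda>_. qam Q)" if "k' < K" "m'' < M k'" for k' m''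
      using words[OF that] \<sigma>(1) by (auto simp: words_def)
    have u: "u \<in> PiE S (\<lambda>_. qam Q)"
      using word own_less m by (auto simp: u_def symbols_of_def PiE_iff)
    have y: "?y (\<sigma> * len + t + 1) = heard A \<Delta> k t u (shift \<sigma> h) + z (\<sigma> * len + t + 1, k)" if t: "t < len" for t
      using slot_le[OF t, of \<sigma> n] \<sigma>(1) received_slot[OF t \<sigma>(1) k] by (simp add: N_def u_def)
    have "?ok m' \<sigma> \<longleftrightarrow> consistent A \<Delta> \<nu> Q k (c k m' \<sigma>) (\<lambda>t. heard A \<Delta> k t u (shift \<sigma> h) + z (\<sigma> * len + t + 1, k)) (shift \<sigma> h)"
    proof (rule consistent_cong[OF k _ y])
      fix x assume "x \<in> csi_index K {..<L}"
      then show "shift \<sigma> ?H x = shift \<sigma> h x"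
        using spanned_blocks_superblock[of _ \<sigma> n] \<sigma>(1) by (auto simp: csi_index_def N_def)
    qed
    also have "\<dots> \<longleftrightarrow> (\<forall>s\<in>symbols_of k. u s = c k m' \<sigma> s)"
      by (rule consistent_iff[OF wc k c' u A \<nu>]) (simp only: add_diff_cancel_left' z)
    also have "\<dots> \<longleftrightarrow> (\<forall>s\<in>symbols_of k. c k (m k) \<sigma> s = c k m' \<sigma> s)"
      by (auto simp: u_def symbols_of_def)
    also have "\<dots> \<longleftrightarrow> c k m' \<sigma> = c k (m k) \<sigma>"
      using PiE_ext[OF word[OF k m'] word[OF k m[OF k]]] by (metis (mono_tags))
    finally show ?thesis .
  qed
  have "(LEAST m'. m' < M k \<and> (\<Sum>\<sigma><N. if ?ok m' \<sigma> then 0 else 1 :: real) \<le> \<tau> * real N) = m k"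
  proof (rule Least_equality)
    have "{\<sigma>. \<sigma> < N \<and> \<not> ?ok (m k) \<sigma>} \<subseteq> ?B"
      using ok[OF _ _ m[OF k]] by blast
    then have "card {\<sigma>. \<sigma> < N \<and> \<not> ?ok (m k) \<sigma>} \<le> card ?B"
      by (intro card_mono) auto
    then show "m k < M k \<and> (\<Sum>\<sigma><N. if ?ok (m k) \<sigma> then 0 else 1 :: real) \<le> \<tau> * real N"
      using m[OF k] bad unfolding count by simp
    fix m' assume m': "m' < M k \<and> (\<Sum>\<sigma><N. if ?ok m' \<sigma> then 0 else 1 :: real) \<le> \<tau> * real N"
    have "m' = m k"
    proof (rule ccontr)
      assume "m' \<noteq> m k"
      then have "2 * \<tau> * real N < real (hdist N (c k m') (c k (m k)))"
        using far m' m[OF k] by blast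
      \<comment> \<open>Where the words differ, \<open>m'\<close> is inconsistent or the superblock
        is bad.\<close>
      also have "hdist N (c k m') (c k (m k)) \<le> card ({\<sigma>. \<sigma> < N \<and> \<not> ?ok m' \<sigma>} \<union> ?B)"
        unfolding hdist_def using ok m' by (intro card_mono) auto
      also have "\<dots> \<le> card {\<sigma>. \<sigma> < N \<and> \<not> ?ok m' \<sigma>} + card ?B"
        by (rule card_Un_le)
      finally show False using m' bad unfolding count by simp
    qed
    then show "m k \<le> m'" by simp
  qed
  then show ?thesis
    by (simp add: decoded_def outer_code_def)
qed

end

subsection \<open>Validity and error probability\<close>

lemma measure_pair_Times:
  assumes "prob_space M" "prob_space N" "A \<in> sets M" "B \<in> sets N"
  shows "measure (M \<Otimes>\<^sub>M N) (A \<times> B) = measure M A * measure N B"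
proof -
  interpret N: prob_space N by fact
  show ?thesis
    using assms(3,4) by (simp add: measure_def N.emeasure_pair_measure_Times enn2real_mult)
qed

lemma sets_many_events:
  fixes N :: nat and R :: "nat \<Rightarrow> 'a \<Rightarrow> bool"
  assumes "\<And>s. Measurable.pred M (R s)"
  shows "{\<omega> \<in> space M. \<tau> < real (card {s. s < N \<and> R s \<omega>})} \<in> sets M"
proof -
  have "real (card {s. s < N \<and> R s \<omega>}) = (\<Sum>s<N. if R s \<omega> then 1 else 0)" for \<omega>
  proof -
    have "(\<Sum>s<N. if R s \<omega> then 1 else 0 :: real) = (\<Sum>s\<in>{s \<in> {..<N}. R s \<omega>}. 1)"
      by (rule sum.inter_filter[symmetric]) simp
    then show ?thesis by (simp add: lessThan_def)
  qed
  moreover have "(\<lambda>\<omega>. \<Sum>s<N. if R s \<omega> then 1 else 0 :: real) \<in> borel_measurable M"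
    using assms by (intro borel_measurable_sum measurable_If) (auto simp: pred_def)
  ultimately show ?thesis by simp
qed

lemma prob_space_message_space:
  assumes "\<And>k. k < K \<Longrightarrow> 1 \<le> M k"
  shows "prob_space (message_space K M)"
  unfolding message_space_def
proof (rule prob_space_PiM)
  fix k assume "k \<in> {..<K}"
  then have "0 < M k" using assms[of k] by simp
  then show "prob_space (uniform_count_measure {..<M k})"
    by (intro prob_space_uniform_count_measure) auto
qed

lemma space_message_space: "space (message_space K M) = PiE {..<K} (\<lambda>k. {..<M k})"
  by (simp add: message_space_def space_PiM space_uniform_count_measure)

lemma sets_std_complex_normal [measurable_cong]: "sets std_complex_normal = sets borel"
  by (simp add: std_complex_normal_def Let_def)

lemma ex_noise_bound:
  assumes "0 < \<delta>"
  shows "\<exists>\<nu>::nat. measure std_complex_normal {z \<in> space std_complex_normal. real \<nu> < cmod z} < \<delta>"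
proof -
  interpret Z: prob_space std_complex_normal by (rule prob_space_std_complex_normal)
  let ?A = "\<lambda>\<nu>::nat. {z \<in> space std_complex_normal. cmod z \<le> real \<nu>}"
  have A: "?A \<nu> \<in> sets std_complex_normal" for \<nu> by measurable
  have "incseq ?A" by (auto simp: incseq_def)
  then have "(\<lambda>\<nu>. Z.prob (?A \<nu>)) \<longlonglongrightarrow> Z.prob (\<Union>\<nu>. ?A \<nu>)"
    using A by (intro Z.finite_Lim_measure_incseq) auto
  moreover have "(\<Union>\<nu>. ?A \<nu>) = space std_complex_normal"
    using real_arch_simple by auto
  ultimately have "\<forall>\<^sub>F \<nu> in sequentially. 1 - \<delta> < Z.prob (?A \<nu>)"
    using \<open>0 < \<delta>\<close> by (intro order_tendstoD(1)) (auto simp: Z.prob_space)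
  then obtain \<nu> where \<nu>: "1 - \<delta> < Z.prob (?A \<nu>)"
    using eventually_happens sequentially_bot by blast
  have "{z \<in> space std_complex_normal. real \<nu> < cmod z} = space std_complex_normal - ?A \<nu>" by auto
  then show ?thesis
    using \<nu> Z.prob_compl[OF A, of \<nu>] by (intro exI[of _ \<nu>]) simp
qed

lemma filterlim_div_at_top:
  assumes "0 < (l::nat)"
  shows "filterlim (\<lambda>n. n div l) at_top at_top"
  unfolding filterlim_at_top eventually_at_top_linorder
proof
  fix Z
  have "Z \<le> n div l" if "Z * l \<le> n" for n
    using div_le_mono[OF that, of l] assms by simp
  then show "\<exists>N. \<forall>n\<ge>N. Z \<le> n div l" by blast
qed

lemma disjoint_intervals:
  fixes a b l x :: nat
  assumes "a * l \<le> x" "x < Suc a * l" "b * l \<le> x" "x < Suc b * l"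
  shows "a = b"
proof -
  have "x div l = a" using assms(1,2) by (intro div_nat_eqI) (simp_all add: mult.commute)
  moreover have "x div l = b" using assms(3,4) by (intro div_nat_eqI) (simp_all add: mult.commute)
  ultimately show ?thesis by simp
qed

context superblock_scheme
begin

lemma measurable_sent:
  assumes "t < len" "i < K - 1"
  shows "sent A \<Delta> t i u \<in> borel_measurable (PiM UNIV (\<lambda>_. borel))"
proof -
  have "precoded S v t i u \<in> borel_measurable (PiM UNIV (\<lambda>_. borel))"
    unfolding precoded_def[abs_def] using assms
    by (intro borel_measurable_sum borel_measurable_times measurable_coeff) auto
  then show ?thesis unfolding sent_def[abs_def] by measurable
qed

lemma measurable_heard:
  assumes "t < len"
  shows "heard A \<Delta> k t u \<in> borel_measurable (PiM UNIV (\<lambda>_. borel))"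
  unfolding heard_def[abs_def]
  using assms by (intro borel_measurable_sum borel_measurable_times measurable_sent) auto

lemma measurable_shift:
  assumes "sets M = sets borel"
  shows "shift \<sigma> \<in> measurable (PiM J (\<lambda>_. M)) (PiM UNIV (\<lambda>_. borel))"
  using measurable_compose[OF measurable_ident_UNIV[OF assms] measurable_pull_back] .

lemma measurable_decode:
  "(\<lambda>(y, H). decode (outer_code (n div len) M c A \<Delta> \<nu> Q \<tau>) k y H) \<in>
    measurable (PiM {1..n} (\<lambda>_. borel) \<Otimes>\<^sub>M PiM J (\<lambda>_. borel)) (count_space UNIV)"
proof -
  let ?M = "PiM {1..n} (\<lambda>_. borel) \<Otimes>\<^sub>M PiM J (\<lambda>_. borel) :: ((nat \<Rightarrow> complex) \<times> fading) measure"
  have H: "(\<lambda>x. shift \<sigma> (snd x)) \<in> measurable ?M (PiM UNIV (\<lambda>_. borel))" for \<sigma>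
    by (rule measurable_compose[OF measurable_snd measurable_shift]) simp
  have consistent: "Measurable.pred ?M (\<lambda>x. consistent A \<Delta> \<nu> Q k a (\<lambda>t. fst x (\<sigma> * len + t + 1)) (shift \<sigma> (snd x)))"
    if \<sigma>: "\<sigma> < n div len" for a \<sigma>
    unfolding consistent_def
  proof (intro pred_intros_finite(4) finite_PiE finite_symbols finite_qam pred_intros_logic(3))
    fix u
    show "Measurable.pred ?M (\<lambda>x. \<forall>t\<in>{..<len}. cmod (fst x (\<sigma> * len + t + 1) - heard A \<Delta> k t u (shift \<sigma> (snd x))) \<le> \<nu>)"
    proof (rule pred_intros_finite(3)[OF finite_lessThan])
      fix t assume "t \<in> {..<len}"
      then have t: "t < len" by simp
      have "\<sigma> * len + t + 1 \<in> {1..n}" using slot_le[OF t \<sigma>] by simp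
      then have [measurable]: "(\<lambda>x. fst x (\<sigma> * len + t + 1)) \<in> borel_measurable ?M"
        by (rule measurable_compose[OF measurable_fst measurable_component_singleton])
      have [measurable]: "(\<lambda>x. heard A \<Delta> k t u (shift \<sigma> (snd x))) \<in> borel_measurable ?M"
        by (rule measurable_compose[OF H measurable_heard[OF t]])
      show "Measurable.pred ?M (\<lambda>x. cmod (fst x (\<sigma> * len + t + 1) - heard A \<Delta> k t u (shift \<sigma> (snd x))) \<le> \<nu>)"
        by measurable
    qed
  qed simp
  have "(\<lambda>x. LEAST m. m < M k \<and> (\<Sum>\<sigma><n div len. if consistent A \<Delta> \<nu> Q k (c k m \<sigma>)
      (\<lambda>t. fst x (\<sigma> * len + t + 1)) (shift \<sigma> (snd x)) then 0 else 1) \<le> \<tau> * real (n div len)) \<in> measurable ?M (count_space UNIV)"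
  proof (rule measurable_Least)
    fix m
    define g where "g = (\<lambda>x. \<Sum>\<sigma><n div len. if consistent A \<Delta> \<nu> Q k (c k m \<sigma>)
      (\<lambda>t. fst x (\<sigma> * len + t + 1)) (shift \<sigma> (snd x)) then 0 else 1 :: real)"
    have [measurable]: "g \<in> borel_measurable ?M"
      unfolding g_def using consistent by (intro borel_measurable_sum measurable_If) (auto simp: pred_def)
    have "Measurable.pred ?M (\<lambda>x. m < M k \<and> g x \<le> \<tau> * real (n div len))"
      by measurable
    then show "Measurable.pred ?M (\<lambda>x. m < M k \<and> (\<Sum>\<sigma><n div len. if consistent A \<Delta> \<nu> Q k (c k m \<sigma>)
      (\<lambda>t. fst x (\<sigma> * len + t + 1)) (shift \<sigma> (snd x)) then 0 else 1) \<le> \<tau> * real (n div len))"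
      by (simp only: g_def)
  qed
  then show ?thesis by (simp only: outer_code_def bc_code.simps case_prod_unfold)
qed

text \<open>Clipping at \<open>A\<close> bounds the transmitted power pointwise, and hence its
  expectation.\<close>

lemma valid_outer_code:
  assumes M: "\<And>k. k < K \<Longrightarrow> 1 \<le> M k" and A: "0 \<le> A" "real (K - 1) * A\<^sup>2 \<le> P"
  shows "valid_code K Tc Tfb D P n (outer_code (n div len) M c A \<Delta> \<nu> Q \<tau>)"
proof -
  let ?C = "outer_code (n div len) M c A \<Delta> \<nu> Q \<tau>"
  have enc: "encode ?C t m H i = (if (t - 1) div len < n div len
      then sent A \<Delta> ((t - 1) mod len) i (\<lambda>s\<in>S. c (own s) (m (own s)) ((t - 1) div len) s) (shift ((t - 1) div len) H)
      else 0)" for t m H i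
    by (simp add: outer_code_def)
  have "encode ?C t m H i \<in> {z. cmod z \<le> A}" for t m H i
    unfolding enc using A(1) cmod_clip_le by (simp add: sent_def)
  then have power: "(\<Sum>i<K - 1. (cmod (transmitted K Tc Tfb ?C t m h i))\<^sup>2) \<le> P" for t m h
  proof -
    have "(\<Sum>i<K - 1. (cmod (transmitted K Tc Tfb ?C t m h i))\<^sup>2) \<le> (\<Sum>i<K - 1. A\<^sup>2)"
      using \<open>\<And>t m H i. encode ?C t m H i \<in> {z. cmod z \<le> A}\<close>
      by (intro sum_mono power_mono) (auto simp: transmitted_def)
    then show ?thesis using A(2) by simp
  qed
  interpret Msg: prob_space "message_space K (num_msgs ?C)"
    using M by (intro prob_space_message_space) (simp add: outer_code_def)
  interpret Fad: prob_space "fading_space K D"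
    unfolding fading_space_def by (intro prob_space_PiM prob_space_axioms)
  interpret MF: pair_prob_space "message_space K (num_msgs ?C)" "fading_space K D" ..
  show ?thesis
    unfolding valid_code_def
  proof (intro conjI allI impI ballI)
    fix k assume "k < K"
    then show "1 \<le> num_msgs ?C k" using M by (simp add: outer_code_def)
  next
    fix t m i assume "i < K - 1"
    have "(\<lambda>H. sent A \<Delta> ((t - 1) mod len) i (\<lambda>s\<in>S. c (own s) (m (own s)) ((t - 1) div len) s) (shift ((t - 1) div len) H))
        \<in> borel_measurable (PiM (csi_index K (known_blocks Tc Tfb t)) (\<lambda>_. borel))"
      using len_pos \<open>i < K - 1\<close> by (intro measurable_compose[OF measurable_shift measurable_sent]) auto
    then show "(\<lambda>H. encode ?C t m H i) \<in> borel_measurable (PiM (csi_index K (known_blocks Tc Tfb t)) (\<lambda>_. borel))"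
      unfolding enc by (cases "(t - 1) div len < n div len") simp_all
  next
    fix k
    show "(\<lambda>(y, H). decode ?C k y H) \<in>
      measurable (PiM {1..n} (\<lambda>_. borel) \<Otimes>\<^sub>M PiM (csi_index K (spanned_blocks Tc n)) (\<lambda>_. borel)) (count_space UNIV)"
      by (rule measurable_decode)
  next
    fix t
    have "(\<integral>\<^sup>+ (m, h). ennreal (\<Sum>i<K - 1. (cmod (transmitted K Tc Tfb ?C t m h i))\<^sup>2)
        \<partial>(message_space K (num_msgs ?C) \<Otimes>\<^sub>M fading_space K D)) \<le>
      (\<integral>\<^sup>+ x. ennreal P \<partial>(message_space K (num_msgs ?C) \<Otimes>\<^sub>M fading_space K D))"
      using power by (intro nn_integral_mono) (auto intro!: ennreal_leI simp: case_prod_beta)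
    also have "\<dots> = ennreal P" by (simp add: MF.emeasure_space_1)
    finally show "(\<integral>\<^sup>+ (m, h). ennreal (\<Sum>i<K - 1. (cmod (transmitted K Tc Tfb ?C t m h i))\<^sup>2)
        \<partial>(message_space K (num_msgs ?C) \<Otimes>\<^sub>M fading_space K D)) \<le> ennreal P" .
  qed
qed

section \<open>Ill-conditioned and noisy superblocks\<close>

definition superblock_channels :: "nat \<Rightarrow> (nat \<times> nat \<times> nat) set" where
  "superblock_channels \<sigma> = csi_index K {\<sigma> * L..<Suc \<sigma> * L}"

definition superblock_noises :: "nat \<Rightarrow> (nat \<times> nat) set" where
  "superblock_noises \<sigma> = {\<sigma> * len + 1..Suc \<sigma> * len} \<times> {..<K}"

definition noisy :: "real \<Rightarrow> nat \<Rightarrow> (nat \<times> nat \<Rightarrow> complex) \<Rightarrow> bool" where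
  "noisy \<nu> \<sigma> z \<longleftrightarrow> (\<exists>x\<in>{..<len} \<times> {..<K}. \<nu> < cmod (z (\<sigma> * len + fst x + 1, snd x)))"

lemma disjoint_superblock_channels: "disjoint_family superblock_channels"
proof -
  have "a = b" if "x \<in> superblock_channels a" "x \<in> superblock_channels b" for a b x
    using that by (intro disjoint_intervals[of a L "fst x" b]) (auto simp: superblock_channels_def csi_index_def)
  then show ?thesis unfolding disjoint_family_on_def by blast
qed

lemma disjoint_superblock_noises: "disjoint_family superblock_noises"
proof -
  have "a = b" if "x \<in> superblock_noises a" "x \<in> superblock_noises b" for a b x
    using that by (intro disjoint_intervals[of a len "fst x - 1" b]) (auto simp: superblock_noises_def)
  then show ?thesis unfolding disjoint_family_on_def by blast
qed

lemma well_conditioned_restrict: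
  "well_conditioned c (shift \<sigma> (restrict h (superblock_channels \<sigma>))) \<longleftrightarrow> well_conditioned c (shift \<sigma> h)"
  by (rule well_conditioned_cong) (auto simp: superblock_channels_def csi_index_def add.commute)

lemma noisy_restrict: "noisy \<nu> \<sigma> (restrict z (superblock_noises \<sigma>)) \<longleftrightarrow> noisy \<nu> \<sigma> z"
proof -
  have "(\<sigma> * len + fst x + 1, snd x) \<in> superblock_noises \<sigma>" if "x \<in> {..<len} \<times> {..<K}" for x
    using that by (auto simp: superblock_noises_def)
  then show ?thesis unfolding noisy_def by (intro bex_cong refl) simp
qed

lemma pred_not_well_conditioned:
  "Measurable.pred (PiM J (\<lambda>_. D)) (\<lambda>h. \<not> well_conditioned c (shift \<sigma> h))"
  using measurable_compose[OF measurable_shift[OF sets_D] measurable_well_conditioned]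
  by (intro pred_intros_logic(2))

lemma pred_noisy:
  assumes "superblock_noises \<sigma> \<subseteq> J"
  shows "Measurable.pred (PiM J (\<lambda>_. std_complex_normal)) (noisy \<nu> \<sigma>)"
  unfolding noisy_def[abs_def]
proof (intro pred_intros_finite(4))
  fix x assume "x \<in> {..<len} \<times> {..<K}"
  then have "(\<sigma> * len + fst x + 1, snd x) \<in> J"
    using assms by (auto simp: superblock_noises_def)
  from measurable_component_singleton[OF this, of "\<lambda>_. std_complex_normal"]
  have [measurable]: "(\<lambda>z. z (\<sigma> * len + fst x + 1, snd x)) \<in> borel_measurable (PiM J (\<lambda>_. std_complex_normal))"
    by (simp add: measurable_cong_sets[OF refl sets_std_complex_normal])
  show "Measurable.pred (PiM J (\<lambda>_. std_complex_normal)) (\<lambda>z. \<nu> < cmod (z (\<sigma> * len + fst x + 1, snd x)))"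
    by measurable
qed simp

text \<open>The fading process is stationary under shifts by whole blocks, so all superblocks are
  equally likely to be ill-conditioned.\<close>

lemma prob_not_well_conditioned:
  "measure (fading_space K D) {h \<in> space (fading_space K D). \<not> well_conditioned c (shift \<sigma> h)} =
    measure (fading_space K D) {h \<in> space (fading_space K D). \<not> well_conditioned c h}" (is "?l = _")
proof -
  let ?F = "fading_space K D"
  let ?f = "\<lambda>h. restrict (shift \<sigma> h) (csi_index K UNIV)"
  have B: "{h \<in> space ?F. \<not> well_conditioned c h} \<in> sets ?F"
    using measurable_compose[OF measurable_ident_UNIV[OF sets_D] measurable_well_conditioned]
    unfolding fading_space_def by (simp add: pred_def)
  have "measure ?F {h \<in> space ?F. \<not> well_conditioned c h} =
      measure (distr ?F ?F ?f) {h \<in> space ?F. \<not> well_conditioned c h}"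
    by (subst distr_fading_pull_back) (auto simp: inj_on_def prob_space_axioms)
  also have "\<dots> = measure ?F (?f -` {h \<in> space ?F. \<not> well_conditioned c h} \<inter> space ?F)"
    by (rule measure_distr[OF measurable_restrict_pull_back B])
  also have "?f -` {h \<in> space ?F. \<not> well_conditioned c h} \<inter> space ?F = {h \<in> space ?F. \<not> well_conditioned c (shift \<sigma> h)}"
  proof -
    have "well_conditioned c (?f h) \<longleftrightarrow> well_conditioned c (shift \<sigma> h)" for h
      by (rule well_conditioned_cong) (auto simp: csi_index_def)
    then show ?thesis using measurable_space[OF measurable_restrict_pull_back[of "\<lambda>b. b + \<sigma> * L" K D]] by auto
  qed
  finally show ?thesis by simp
qed

text \<open>Union bound over the slots of the superblock and the users.\<close>

lemma prob_noisy_le: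
  "measure (noise_space K) {z \<in> space (noise_space K). noisy \<nu> \<sigma> z} \<le>
    real (len * K) * measure std_complex_normal {z \<in> space std_complex_normal. \<nu> < cmod z}"
proof -
  let ?I = "{..<len} \<times> {..<K}"
  let ?N = "noise_space K"
  let ?B = "{z \<in> space std_complex_normal. \<nu> < cmod z}"
  interpret N: prob_space ?N
    unfolding noise_space_def by (intro prob_space_PiM prob_space_std_complex_normal)
  have B: "?B \<in> sets std_complex_normal" by measurable
  have comp: "{z \<in> space ?N. \<nu> < cmod (z x)} \<in> N.events \<and> N.prob {z \<in> space ?N. \<nu> < cmod (z x)} = measure std_complex_normal ?B"
    if x: "x \<in> {1..} \<times> {..<K}" for x
  proof -
    have m: "(\<lambda>z. z x) \<in> measurable ?N std_complex_normal"
      unfolding noise_space_def by (rule measurable_component_singleton[OF x])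
    have eq: "{z \<in> space ?N. \<nu> < cmod (z x)} = (\<lambda>z. z x) -` ?B \<inter> space ?N"
      using measurable_space[OF m] by auto
    have "distr ?N std_complex_normal (\<lambda>z. z x) = std_complex_normal"
      unfolding noise_space_def using x prob_space_std_complex_normal
      by (intro distr_PiM_component) auto
    then have "measure std_complex_normal ?B = N.prob ((\<lambda>z. z x) -` ?B \<inter> space ?N)"
      using measure_distr[OF m B] by simp
    then show ?thesis using measurable_sets[OF m B] by (simp add: eq)
  qed
  let ?A = "\<lambda>x. {z \<in> space ?N. \<nu> < cmod (z (\<sigma> * len + fst x + 1, snd x))}"
  have A: "?A x \<in> N.events" "N.prob (?A x) = measure std_complex_normal ?B" if "x \<in> ?I" for x
    using comp[of "(\<sigma> * len + fst x + 1, snd x)"] that by auto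
  have "{z \<in> space ?N. noisy \<nu> \<sigma> z} = (\<Union>x\<in>?I. ?A x)"
    unfolding noisy_def by blast
  then have "N.prob {z \<in> space ?N. noisy \<nu> \<sigma> z} \<le> (\<Sum>x\<in>?I. N.prob (?A x))"
    using A(1) by (simp only:) (rule N.finite_measure_subadditive_finite, auto)
  also have "\<dots> = real (card ?I) * measure std_complex_normal ?B"
    using A(2) by simp
  finally show ?thesis by (simp add: card_cartesian_product)
qed

end

section \<open>Error probability and achievable rates of the outer code\<close>

context superblock_scheme
begin

abbreviation "F \<equiv> fading_space K D"
abbreviation "Z \<equiv> noise_space K"

definition bad_channels :: "real \<Rightarrow> real \<Rightarrow> nat \<Rightarrow> fading set" where
  "bad_channels c \<theta> N = {h \<in> space F. \<theta> * real N < real (card {\<sigma>. \<sigma> < N \<and> \<not> well_conditioned c (shift \<sigma> h)})}"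

definition bad_noises :: "real \<Rightarrow> real \<Rightarrow> nat \<Rightarrow> (nat \<times> nat \<Rightarrow> complex) set" where
  "bad_noises \<nu> \<theta> N = {z \<in> space Z. \<theta> * real N < real (card {\<sigma>. \<sigma> < N \<and> noisy \<nu> \<sigma> z})}"

lemma superblock_noises_subset: "superblock_noises \<sigma> \<subseteq> {1..} \<times> {..<K}"
  by (auto simp: superblock_noises_def)

lemma sets_bad_channels: "bad_channels c \<theta> N \<in> sets F"
  unfolding bad_channels_def fading_space_def
  by (rule sets_many_events) (rule pred_not_well_conditioned)

lemma sets_bad_noises: "bad_noises \<nu> \<theta> N \<in> sets Z"
  unfolding bad_noises_def noise_space_def
  by (rule sets_many_events) (rule pred_noisy[OF superblock_noises_subset])

lemma bad_channels_tendsto_0: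
  assumes "measure F {h \<in> space F. \<not> well_conditioned c h} < \<theta>"
  shows "(\<lambda>N. measure F (bad_channels c \<theta> N)) \<longlonglongrightarrow> 0"
proof -
  have "(\<lambda>N. measure (PiM (csi_index K UNIV) (\<lambda>_. D)) {h \<in> space (PiM (csi_index K UNIV) (\<lambda>_. D)).
      \<theta> * real N < real (card {\<sigma>. \<sigma> < N \<and> \<not> well_conditioned c (shift \<sigma> (restrict h (superblock_channels \<sigma>)))})}) \<longlonglongrightarrow> 0"
  proof (rule prob_many_disjoint_events_tendsto_0[OF prob_space_axioms _ disjoint_superblock_channels pred_not_well_conditioned _ assms])
    show "superblock_channels \<sigma> \<subseteq> csi_index K UNIV" for \<sigma>
      by (auto simp: superblock_channels_def csi_index_def)
    have "(0, 0, 0) \<in> csi_index K UNIV" using K by (simp add: csi_index_def)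
    then show "csi_index K UNIV \<noteq> {}" by blast
    show "measure (PiM (csi_index K UNIV) (\<lambda>_. D)) {h \<in> space (PiM (csi_index K UNIV) (\<lambda>_. D)).
        \<not> well_conditioned c (shift \<sigma> (restrict h (superblock_channels \<sigma>)))} \<le>
      measure F {h \<in> space F. \<not> well_conditioned c h}" for \<sigma>
      unfolding well_conditioned_restrict prob_not_well_conditioned[of c \<sigma>, symmetric]
      by (simp add: fading_space_def)
  qed
  then show ?thesis
    unfolding well_conditioned_restrict by (simp add: bad_channels_def fading_space_def)
qed

lemma bad_noises_tendsto_0:
  assumes "real (len * K) * measure std_complex_normal {z \<in> space std_complex_normal. \<nu> < cmod z} < \<theta>"
  shows "(\<lambda>N. measure Z (bad_noises \<nu> \<theta> N)) \<longlonglongrightarrow> 0"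
proof -
  let ?I = "{1..} \<times> {..<K} :: (nat \<times> nat) set"
  have "(\<lambda>N. measure (PiM ?I (\<lambda>_. std_complex_normal)) {z \<in> space (PiM ?I (\<lambda>_. std_complex_normal)).
      \<theta> * real N < real (card {\<sigma>. \<sigma> < N \<and> noisy \<nu> \<sigma> (restrict z (superblock_noises \<sigma>))})}) \<longlonglongrightarrow> 0"
  proof (rule prob_many_disjoint_events_tendsto_0[OF prob_space_std_complex_normal superblock_noises_subset
        disjoint_superblock_noises pred_noisy[OF order_refl] _ assms])
    have "(1, 0) \<in> ?I" using K by auto
    then show "?I \<noteq> {}" by blast
    show "measure (PiM ?I (\<lambda>_. std_complex_normal)) {z \<in> space (PiM ?I (\<lambda>_. std_complex_normal)).
        noisy \<nu> \<sigma> (restrict z (superblock_noises \<sigma>))} \<le>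
      real (len * K) * measure std_complex_normal {z \<in> space std_complex_normal. \<nu> < cmod z}" for \<sigma>
      unfolding noisy_restrict using prob_noisy_le[of \<nu> \<sigma>] by (simp only: noise_space_def)
  qed
  then show ?thesis
    unfolding noisy_restrict by (simp add: bad_noises_def noise_space_def)
qed

text \<open>The tolerated fraction \<open>\<tau>\<close> is shared equally between ill-conditioned
  channels and large noise. An error requires one of the halves to be exceeded, and each of these
  events depends on the channel alone or on the noise alone.\<close>

lemma error_prob_le:
  fixes n N Q :: nat and \<tau> c' :: real
  defines "N \<equiv> n div len"
  assumes k: "k < K" and M: "\<And>k. k < K \<Longrightarrow> 1 \<le> M k"
    and words: "\<And>k m. k < K \<Longrightarrow> m < M k \<Longrightarrow> c k m \<in> words N (PiE (symbols_of k) (\<lambda>_. qam Q))"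
    and far: "\<And>m m'. m < M k \<Longrightarrow> m' < M k \<Longrightarrow> m \<noteq> m' \<Longrightarrow> 2 * \<tau> * real N < real (hdist N (c k m) (c k m'))"
    and c': "0 < c'" and A: "\<Delta> * c' * real (card S) * (2 * real (Q - 1)) \<le> A" and \<nu>: "2 * \<nu> * c' < \<Delta>" "0 \<le> \<nu>"
  shows "error_prob K Tc Tfb D n (outer_code N M c A \<Delta> \<nu> Q \<tau>) k \<le>
    measure F (bad_channels c' (\<tau> / 2) N) + measure Z (bad_noises \<nu> (\<tau> / 2) N)"
proof -
  let ?C = "outer_code N M c A \<Delta> \<nu> Q \<tau>"
  let ?Msg = "message_space K M"
  let ?\<Omega> = "?Msg \<Otimes>\<^sub>M (F \<Otimes>\<^sub>M Z)"
  interpret Msg: prob_space ?Msg by (rule prob_space_message_space[OF M])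
  interpret F: prob_space F
    unfolding fading_space_def by (intro prob_space_PiM prob_space_axioms)
  interpret Z: prob_space Z
    unfolding noise_space_def by (intro prob_space_PiM prob_space_std_complex_normal)
  interpret FZ: pair_prob_space F Z ..
  interpret \<Omega>: pair_prob_space ?Msg "F \<Otimes>\<^sub>M Z" ..
  let ?BF = "bad_channels c' (\<tau> / 2) N"
  let ?BZ = "bad_noises \<nu> (\<tau> / 2) N"
  let ?E1 = "space ?Msg \<times> (?BF \<times> space Z)"
  let ?E2 = "space ?Msg \<times> (space F \<times> ?BZ)"
  have E: "?E1 \<in> sets ?\<Omega>" "?E2 \<in> sets ?\<Omega>"
    using sets_bad_channels sets_bad_noises by auto
  have m1: "measure ?\<Omega> ?E1 = measure F ?BF" "measure ?\<Omega> ?E2 = measure Z ?BZ"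
    using sets_bad_channels sets_bad_noises
    by (simp_all add: measure_pair_Times Msg.prob_space_axioms F.prob_space_axioms Z.prob_space_axioms
        FZ.prob_space_axioms Msg.prob_space F.prob_space Z.prob_space)
  have "{(m, h, z) \<in> space ?\<Omega>. decoded K Tc Tfb n ?C k m h z \<noteq> m k} \<subseteq> ?E1 \<union> ?E2"
  proof (rule subsetI)
    fix x assume x: "x \<in> {(m, h, z) \<in> space ?\<Omega>. decoded K Tc Tfb n ?C k m h z \<noteq> m k}"
    then obtain m h z where mhz: "x = (m, h, z)" and m: "m \<in> space ?Msg" and h: "h \<in> space F" and z: "z \<in> space Z"
      and err: "decoded K Tc Tfb n ?C k m h z \<noteq> m k"
      by (cases x) (auto simp: space_pair_measure)
    show "x \<in> ?E1 \<union> ?E2"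
    proof (rule ccontr)
      assume "x \<notin> ?E1 \<union> ?E2"
      then have "h \<notin> ?BF" "z \<notin> ?BZ" using m h z by (auto simp: mhz)
      then have good: "real (card {\<sigma>. \<sigma> < N \<and> \<not> well_conditioned c' (shift \<sigma> h)}) \<le> \<tau> / 2 * real N"
        "real (card {\<sigma>. \<sigma> < N \<and> noisy \<nu> \<sigma> z}) \<le> \<tau> / 2 * real N"
        using h z by (auto simp: bad_channels_def bad_noises_def)
      have noisy: "noisy \<nu> \<sigma> z \<longleftrightarrow> (\<exists>t<len. \<exists>k<K. \<nu> < cmod (z (\<sigma> * len + t + 1, k)))" for \<sigma>
        unfolding noisy_def by auto
      let ?B = "{\<sigma>. \<sigma> < N \<and> (\<not> well_conditioned c' (shift \<sigma> h) \<or> (\<exists>t<len. \<exists>k<K. \<nu> < cmod (z (\<sigma> * len + t + 1, k))))}"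
      have "?B = {\<sigma>. \<sigma> < N \<and> \<not> well_conditioned c' (shift \<sigma> h)} \<union> {\<sigma>. \<sigma> < N \<and> noisy \<nu> \<sigma> z}"
        unfolding noisy by blast
      then have "card ?B \<le> card {\<sigma>. \<sigma> < N \<and> \<not> well_conditioned c' (shift \<sigma> h)} + card {\<sigma>. \<sigma> < N \<and> noisy \<nu> \<sigma> z}"
        by (simp only: card_Un_le)
      then have bad: "real (card ?B) \<le> \<tau> * real N"
        using good by linarith
      have "m k < M k" if "k < K" for k
        using m that by (auto simp: space_message_space)
      then have "decoded K Tc Tfb n ?C k m h z = m k"
        unfolding N_def by (intro decoded_eq[OF k _ words[unfolded N_def] far[unfolded N_def] c' A \<nu> bad[unfolded N_def]])
      then show False using err by simp
    qed
  qed
  then have "measure ?\<Omega> {(m, h, z) \<in> space ?\<Omega>. decoded K Tc Tfb n ?C k m h z \<noteq> m k} \<le> measure ?\<Omega> (?E1 \<union> ?E2)"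
    using E by (intro \<Omega>.finite_measure_mono) auto
  also have "\<dots> \<le> measure ?\<Omega> ?E1 + measure ?\<Omega> ?E2"
    using E by (rule measure_Un_le)
  finally show ?thesis
    unfolding m1 error_prob_def Let_def by (simp add: outer_code_def)
qed

lemma card_words_alphabet: "card (PiE (symbols_of k) (\<lambda>_. qam Q)) = (Q\<^sup>2) ^ card (symbols_of k)"
  using finite_symbols by (simp add: symbols_of_def card_PiE card_qam)

lemma sum_card_symbols_of: "(\<Sum>k<K. card (symbols_of k)) = card S"
proof -
  have "card S = card (\<Union>k<K. symbols_of k)"
    using own_less by (intro arg_cong[where f = card]) (auto simp: symbols_of_def)
  also have "\<dots> = (\<Sum>k<K. card (symbols_of k))"
    using finite_symbols by (intro card_UN_disjoint) (auto simp: symbols_of_def)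
  finally show ?thesis by simp
qed

text \<open>Each user has its own code over its own symbol tuples. A user without symbols has a
  one-letter alphabet, rate 0 and a single message.\<close>

lemma ex_outer_code:
  assumes "0 < Q" "0 \<le> \<tau>"
  shows "\<exists>c. \<forall>k. let M = code_size (code_rate \<tau> ((Q\<^sup>2) ^ card (symbols_of k))) N in
    (\<forall>m<M. c k m \<in> words N (PiE (symbols_of k) (\<lambda>_. qam Q))) \<and>
    (\<forall>m<M. \<forall>m'<M. m \<noteq> m' \<longrightarrow> 2 * \<tau> * real N < real (hdist N (c k m) (c k m')))"
proof (rule choice, rule allI)
  fix k
  let ?A = "PiE (symbols_of k) (\<lambda>_. qam Q)"
  let ?M = "code_size (code_rate \<tau> (card ?A)) N"
  have pos: "0 < card ?A" using assms(1) by (simp add: card_words_alphabet)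
  then have "finite ?A" "?A \<noteq> {}" by (auto simp: card_gt_0_iff)
  then obtain c where c: "\<forall>m<?M. c m \<in> words N ?A"
    "\<forall>m<?M. \<forall>m'<?M. m \<noteq> m' \<longrightarrow> nat \<lfloor>2 * \<tau> * real N\<rfloor> < hdist N (c m) (c m')"
    using gilbert_varshamov[OF _ _ code_size_gv[OF pos assms(2)]] by blast
  have "2 * \<tau> * real N < real d" if "nat \<lfloor>2 * \<tau> * real N\<rfloor> < d" for d
    using that by linarith
  with c show "\<exists>c. let M = code_size (code_rate \<tau> ((Q\<^sup>2) ^ card (symbols_of k))) N in
    (\<forall>m<M. c m \<in> words N ?A) \<and> (\<forall>m<M. \<forall>m'<M. m \<noteq> m' \<longrightarrow> 2 * \<tau> * real N < real (hdist N (c m) (c m')))"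
    unfolding Let_def card_words_alphabet[symmetric] by blast
qed

lemma achievable_rates_superblock:
  assumes \<tau>: "0 < \<tau>" and P: "0 < P"
    and c': "0 < c'" "measure F {h \<in> space F. \<not> well_conditioned c' h} < \<tau> / 2"
    and \<nu>: "0 \<le> \<nu>" "real (len * K) * measure std_complex_normal {z \<in> space std_complex_normal. \<nu> < cmod z} < \<tau> / 2"
    and \<Delta>: "2 * \<nu> * c' < \<Delta>" and Q: "0 < Q" "\<Delta> * c' * real (card S) * (2 * real (Q - 1)) \<le> sqrt (P / real (K - 1))"
  shows "achievable_rates K Tc Tfb D P (\<lambda>k. code_rate \<tau> ((Q\<^sup>2) ^ card (symbols_of k)) / real len)"
proof -
  define A where "A = sqrt (P / real (K - 1))"
  define M where "M N k = code_size (code_rate \<tau> ((Q\<^sup>2) ^ card (symbols_of k))) N" for N k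
  have "\<exists>c. \<forall>k. (\<forall>m<M N k. c k m \<in> words N (PiE (symbols_of k) (\<lambda>_. qam Q))) \<and>
    (\<forall>m<M N k. \<forall>m'<M N k. m \<noteq> m' \<longrightarrow> 2 * \<tau> * real N < real (hdist N (c k m) (c k m')))" for N
    using ex_outer_code[OF Q(1), of \<tau> N] \<tau> unfolding M_def Let_def by simp
  then obtain c where c: "\<And>N k m. m < M N k \<Longrightarrow> c N k m \<in> words N (PiE (symbols_of k) (\<lambda>_. qam Q))"
    "\<And>N k m m'. \<lbrakk>m < M N k; m' < M N k; m \<noteq> m'\<rbrakk> \<Longrightarrow> 2 * \<tau> * real N < real (hdist N (c N k m) (c N k m'))"
    by metis
  define C where "C n = outer_code (n div len) (M (n div len)) (c (n div len)) A \<Delta> \<nu> Q \<tau>" for n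
  have rate: "0 \<le> code_rate \<tau> a" for a by (simp add: code_rate_def)
  have M1: "1 \<le> M N k" for N k unfolding M_def by (rule code_size_ge_1[OF rate])
  have A: "0 \<le> A" "real (K - 1) * A\<^sup>2 \<le> P" using P K by (simp_all add: A_def)
  show ?thesis
    unfolding achievable_rates_def
  proof (intro exI[of _ C] conjI allI impI)
    fix n :: nat
    show "valid_code K Tc Tfb D P n (C n)"
      unfolding C_def by (rule valid_outer_code[OF M1 A])
  next
    fix k assume k: "k < K"
    show "(\<lambda>n. ln (real (num_msgs (C n) k)) / real n) \<longlonglongrightarrow> code_rate \<tau> ((Q\<^sup>2) ^ card (symbols_of k)) / real len"
      using code_size_rate_tendsto[OF rate len_pos] by (simp add: C_def outer_code_def M_def)
    let ?b = "\<lambda>N. measure F (bad_channels c' (\<tau> / 2) N) + measure Z (bad_noises \<nu> (\<tau> / 2) N)"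
    have "?b \<longlonglongrightarrow> 0 + 0"
      by (intro tendsto_add bad_channels_tendsto_0 bad_noises_tendsto_0 c' \<nu>)
    then have "(\<lambda>n. ?b (n div len)) \<longlonglongrightarrow> 0 + 0"
      by (rule filterlim_compose[OF _ filterlim_div_at_top[OF len_pos]])
    then have lim: "(\<lambda>n. ?b (n div len)) \<longlonglongrightarrow> 0" by simp
    show "(\<lambda>n. error_prob K Tc Tfb D n (C n) k) \<longlonglongrightarrow> 0"
    proof (rule tendsto_sandwich[OF _ _ tendsto_const lim])
      show "\<forall>\<^sub>F n in sequentially. 0 \<le> error_prob K Tc Tfb D n (C n) k"
        by (simp add: error_prob_def Let_def)
      show "\<forall>\<^sub>F n in sequentially. error_prob K Tc Tfb D n (C n) k \<le> ?b (n div len)"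
        unfolding C_def
        by (intro always_eventually allI error_prob_le[OF k M1 c(1) c(2) c'(1) _ \<Delta> \<nu>(1)]) (use Q(2) in \<open>auto simp: A_def\<close>)
    qed
  qed
qed

text \<open>The order of choice matters: \<open>\<tau>\<close> determines \<open>c'\<close> and
  \<open>\<nu>\<close>, these determine \<open>\<Delta>\<close> and \<open>\<kappa>\<close>, and
  only \<open>Q\<close> depends on \<open>P\<close>.\<close>

lemma superblock_sum_dof:
  assumes \<tau>: "0 < \<tau>" "\<tau> \<le> 1 / 2"
  shows "\<exists>R. (\<forall>P>0. achievable_rates K Tc Tfb D P (R P)) \<and>
    ((\<lambda>P. (\<Sum>k<K. R P k) / ln P) \<longlongrightarrow> (1 - 2 * \<tau>) * (real (card S) / real len)) at_top"
proof -
  obtain c :: nat where c: "measure F {h \<in> space F. \<not> well_conditioned (real c) h} < \<tau> / 2"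
    using ex_prob_not_well_conditioned_less[OF prob_space_axioms sets_D, of "\<tau> / 2"] \<tau> by auto
  \<comment> \<open>Adding 1 makes the constant positive.\<close>
  define c' where "c' = real c + 1"
  interpret F: prob_space F
    unfolding fading_space_def by (intro prob_space_PiM prob_space_axioms)
  have "F.prob {h \<in> space F. \<not> well_conditioned c' h} \<le> F.prob {h \<in> space F. \<not> well_conditioned (real c) h}"
  proof (rule F.finite_measure_mono)
    show "{h \<in> space F. \<not> well_conditioned c' h} \<subseteq> {h \<in> space F. \<not> well_conditioned (real c) h}"
      using well_conditioned_mono[of "real c" _ c'] by (auto simp: c'_def)
    show "{h \<in> space F. \<not> well_conditioned (real c) h} \<in> F.events"
      using measurable_compose[OF measurable_ident_UNIV[OF sets_D] measurable_well_conditioned]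
      unfolding fading_space_def by (simp add: pred_def)
  qed
  with c have c': "0 < c'" "F.prob {h \<in> space F. \<not> well_conditioned c' h} < \<tau> / 2"
    by (simp_all add: c'_def)
  have lK: "0 < real (len * K)" using len_pos K by simp
  obtain \<nu> :: nat where "measure std_complex_normal {z \<in> space std_complex_normal. real \<nu> < cmod z} < \<tau> / 2 / real (len * K)"
    using ex_noise_bound[of "\<tau> / 2 / real (len * K)"] \<tau> lK by auto
  then have \<nu>: "real (len * K) * measure std_complex_normal {z \<in> space std_complex_normal. real \<nu> < cmod z} < \<tau> / 2"
    using lK by (simp only: pos_less_divide_eq mult.commute)
  define \<Delta> where "\<Delta> = 2 * real \<nu> * c' + 1"
  have \<Delta>: "2 * real \<nu> * c' < \<Delta>" "0 < \<Delta>" using c' by (simp_all add: \<Delta>_def add_nonneg_pos)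
  \<comment> \<open>Adding 1 to the number of symbols keeps \<open>B\<close> positive even if there
    are none.\<close>
  define B where "B = 2 * \<Delta> * c' * (real (card S) + 1)"
  have B: "0 < B" using \<Delta> c' by (simp add: B_def add_nonneg_pos)
  have K1: "0 < real (K - 1)" using K by simp
  \<comment> \<open>Chosen such that \<open>B * (\<kappa> * sqrt P)\<close> is the largest amplitude
    allowed on each antenna, \<open>sqrt (P / (K - 1))\<close>.\<close>
  define \<kappa> where "\<kappa> = 1 / (sqrt (real (K - 1)) * B)"
  have \<kappa>: "0 < \<kappa>" using B K1 by (simp add: \<kappa>_def)
  \<comment> \<open>The successor makes the grid nonempty for every \<open>P\<close>, while
    \<open>Q P - 1\<close>, on which the amplitude depends, is at most
    \<open>\<kappa> * sqrt P\<close>.\<close>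
  define Q where "Q P = Suc (nat \<lfloor>\<kappa> * sqrt P\<rfloor>)" for P
  define R where "R P k = code_rate \<tau> (((Q P)\<^sup>2) ^ card (symbols_of k)) / real len" for P k
  have "achievable_rates K Tc Tfb D P (R P)" if P: "0 < P" for P
  proof -
    have "\<Delta> * c' * real (card S) * (2 * real (Q P - 1)) \<le> B * real (Q P - 1)"
      using \<Delta>(2) c'(1) by (simp add: B_def algebra_simps)
    also have "\<dots> \<le> B * (\<kappa> * sqrt P)"
      using B \<kappa> P by (intro mult_left_mono) (auto simp: Q_def)
    also have "\<dots> = sqrt (P / real (K - 1))"
      using B by (simp add: \<kappa>_def real_sqrt_divide)
    finally show ?thesis
      unfolding R_def[abs_def]
      by (intro achievable_rates_superblock[OF \<tau>(1) P c' _ \<nu> \<Delta>(1)]) (simp_all add: Q_def)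
  qed
  moreover have "((\<lambda>P. (\<Sum>k<K. R P k) / ln P) \<longlongrightarrow> (1 - 2 * \<tau>) * (real (card S) / real len)) at_top"
  proof -
    have "((\<lambda>P. (\<Sum>k<K. code_rate \<tau> (((Q P)\<^sup>2) ^ card (symbols_of k)) / ln P) / real len) \<longlongrightarrow>
        (\<Sum>k<K. (1 - 2 * \<tau>) * real (card (symbols_of k))) / real len) at_top"
      using len_pos by (intro tendsto_divide tendsto_sum tendsto_const code_rate_tendsto[OF \<kappa> \<tau>(2)]) (auto simp: Q_def)
    also have "(\<Sum>k<K. (1 - 2 * \<tau>) * real (card (symbols_of k))) = (1 - 2 * \<tau>) * real (card S)"
      by (simp add: sum_card_symbols_of flip: sum_distrib_left of_nat_sum)
    finally show ?thesis
      by (simp add: R_def sum_divide_distrib mult.commute)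
  qed
  ultimately show ?thesis by blast
qed

end

theorem theorem2:
  fixes K Tc Tfb :: nat and D :: "complex measure" and f :: "complex \<Rightarrow> ennreal"
    and hmin hmax :: real
  assumes "2 \<le> K" and "1 \<le> Tc"
    and "prob_space D"
    and "f \<in> borel_measurable lborel" and "D = density lborel f"
    and "0 < hmin" and "AE x in D. hmin \<le> cmod x \<and> cmod x \<le> hmax"
  shows "achievable_sum_dof K Tc Tfb D (dof K (real Tfb / real Tc))"
proof -
  have "emeasure D {x} = 0" for x
  proof -
    \<comment> \<open>A distribution with a density inherits the null points of Lebesgue
      measure.\<close>
    have "{x} \<in> null_sets lborel" by (rule null_setsI) auto
    then have "AE y in lborel. y \<notin> {x}" by (rule AE_not_in)
    then have "AE y in D. y \<notin> {x}"
      unfolding assms(5) AE_density[OF assms(4)] by eventually_elim simp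
    moreover have "sets D = sets borel" by (simp add: assms(5))
    ultimately show ?thesis using AE_iff_measurable[of "{x}" D] by (auto simp: assms(5))
  qed
  then interpret diffuse D
    using assms(3) by (intro diffuse.intro diffuse_axioms.intro) (auto simp: assms(5))
  show ?thesis
    unfolding achievable_sum_dof_def
  proof (intro allI impI)
    fix \<epsilon> :: real assume \<epsilon>: "0 < \<epsilon>"
    obtain L S own w where L: "0 < L"
      and scheme: "linear_scheme K D (\<lambda>t. {b. b * Tc + Tfb \<le> t}) (\<lambda>t. t div Tc) (L * Tc)
        (S :: ((nat \<times> nat) \<times> nat \<times> nat) set) own w"
      and near: "\<bar>real (card S) / real (L * Tc) - dof K (real Tfb / real Tc)\<bar> < \<epsilon> / 2"
      using ex_scheme_near_dof[OF assms(1,2), of "\<epsilon> / 2" Tfb] \<epsilon> by auto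
    interpret superblock_scheme K Tc Tfb L D S own w
      using scheme assms(1,2) L
      by (intro superblock_scheme.intro superblock_scheme_axioms.intro diffuse_axioms) auto
    define r where "r = real (card S) / real (L * Tc)"
    have r: "0 \<le> r" by (simp add: r_def)
    \<comment> \<open>The rate loss \<open>2 * \<tau> * r\<close> of the outer code has to stay
      within \<open>\<epsilon> / 2\<close>; \<open>r + 1\<close> avoids division by zero, and the
      bound \<open>1 / 2\<close> keeps \<open>1 - 2 * \<tau>\<close> nonnegative.\<close>
    define \<tau> where "\<tau> = min (1 / 2) (\<epsilon> / (4 * (r + 1)))"
    have \<tau>: "\<tau> \<le> 1 / 2" "0 < \<tau>"
      unfolding \<tau>_def by (rule min.cobounded1) (use \<epsilon> r in simp)
    have "\<tau> * (4 * (r + 1)) \<le> \<epsilon>"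
    proof -
      have "\<tau> \<le> \<epsilon> / (4 * (r + 1))" by (simp add: \<tau>_def)
      then show ?thesis using r by (simp add: pos_le_divide_eq)
    qed
    then have "2 * \<tau> * r \<le> \<epsilon> / 2" using \<tau> by (simp add: algebra_simps)
    moreover have "0 \<le> 2 * \<tau> * r" using \<tau> r by simp
    ultimately have close: "\<bar>(1 - 2 * \<tau>) * r - r\<bar> \<le> \<epsilon> / 2" by (simp add: algebra_simps)
    obtain R where R: "\<forall>P>0. achievable_rates K Tc Tfb D P (R P)"
      "((\<lambda>P. (\<Sum>k<K. R P k) / ln P) \<longlongrightarrow> (1 - 2 * \<tau>) * r) at_top"
      using superblock_sum_dof[OF \<tau>(2,1)] unfolding r_def by blast
    have "\<bar>(1 - 2 * \<tau>) * r - dof K (real Tfb / real Tc)\<bar> < \<epsilon>"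
      using close near unfolding r_def by linarith
    with R show "\<exists>R d'. (\<forall>P>0. achievable_rates K Tc Tfb D P (R P)) \<and>
        ((\<lambda>P. (\<Sum>k<K. R P k) / ln P) \<longlongrightarrow> d') at_top \<and> \<bar>d' - dof K (real Tfb / real Tc)\<bar> < \<epsilon>"
      by blast
  qed
qed

end
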